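(* Let $r\ge1$ be an integer, $1\le p<\infty$ and $K>0$. Let $\Lambda=\{\lambda_n\}_{n\in\mathbb Z}\subset\mathbb R$ be a strictly increasing sequence with $\lambda_{n+1}-\lambda_n\le K$ for all $n\in\mathbb Z$, and let $I=\bigcup_{n\in\mathbb Z}[\lambda_n,\lambda_{n+1}]$. (a) Assume that there are constants $A,B\in(0,\infty)$ such that $$A\,\|f\|_{\mathrm{eq},L}\le\|f\|_{L_p^r(I)|_\Lambda}\le B\,\|f\|_{\mathrm{eq},L}\qquad\text{for all } f\in L_p^r(I)|_\Lambda .$$ Then there are constants $C,C'\in(0,\infty)$, depending only on $r$, $K$, $A$ and $B$, such that $$C\,\|f\|_{\mathrm{eq},W}\le\|f\|_{W_p^r(I)|_\Lambda}\le C'\,\|f\|_{\mathrm{eq},W}\qquad\text{for all } f\in W_p^r(I)|_\Lambda .$$ (b) If $T:L_p^r(I)|_\Lambda\to L_p^r(I)$ is a quasi-optimal interpolator, then $T$ (restricted to $W_p^r(I)|_\Lambda\subset L_p^r(I)|_\Lambda$) is also a quasi-optimal interpolator $T:W_p^r(I)|_\Lambda\to W_p^r(I)$.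
   Context: Sobolev spaces. For an interval $I\subset\mathbb R$ (possibly infinite), an integer $r\ge1$ and $1\le p<\infty$, $W_p^r(I)$ is the completion of the space of complex functions $F\in\mathcal C^\infty(I)$ for which $\|F\|_{W_p^r(I)}^p=\int_I|F(x)|^p\,dx+\int_I|F^{(r)}(x)|^p\,dx$ is finite. $L_p^r(I)$ is the space of complex functions on $I$ with finite seminorm $\|F\|_{L_p^r(I)}^p=\int_I|F^{(r)}(x)|^p\,dx$. Elements of both spaces are identified with functions $F$ such that $F,\dots,F^{(r-1)}$ are continuous and $F^{(r-1)}$ is (locally) absolutely continuous. Trace spaces. For $\mathbb X=W_p^r(I)$ or $L_p^r(I)$ and $\Lambda\subset I$, $\mathbb X|_\Lambda=\{F|_\Lambda: F\in\mathbb X\}$, with the norm (or seminorm) $\|f\|_{\mathbb X|_\Lambda}=\inf\{\|F\|_{\mathbb X}: F\in\mathbb X,\ F|_\Lambda=f\}$. A quasi-optimal interpolator $T:\mathbb X|_\Lambda\to\mathbb X$ is a linear operator that is bounded for these (semi)norms and satisfies $(Tf)|_\Lambda=f$ for all $f\in\mathbb X|_\Lambda$. Divided differences. $f(x_1)$ is the value at $x_1$, $f(x_1,x_2)=\frac{f(x_2)-f(x_1)}{x_2-x_1}$, and $f(x_1,\dots,x_n)=\frac{f(x_2,\dots,x_n)-f(x_1,\dots,x_{n-1})}{x_n-x_1}$ for $n\ge3$. For $f:\Lambda\to\mathbb C$, $$\|f\|_{\mathrm{eq},L}^p=\sum_{n\in\mathbb Z}(\lambda_{n+r}-\lambda_n)|f(\lambda_n,\dots,\lambda_{n+r})|^p,$$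 $$\|f\|_{\mathrm{eq},W}^p=\|f\|_{\mathrm{eq},L}^p+\sum_{j=0}^{r-1}\sum_{n\in\mathbb Z}(\lambda_{n+r}-\lambda_n)^{jp+1}|f(\lambda_n,\dots,\lambda_{n+j})|^p.$$ *)

theory Defs
  imports "HOL-Analysis.Analysis"
begin

section \<open>Absolute continuity and derivatives on an interval\<close>

definition absolutely_continuous_on :: "real set \<Rightarrow> (real \<Rightarrow> complex) \<Rightarrow> bool" where
  "absolutely_continuous_on S G \<longleftrightarrow>
     (\<forall>e>0. \<exists>d>0. \<forall>D. D division_of \<Union>D \<and> \<Union>D \<subseteq> S \<and> (\<Sum>J\<in>D. Sup J - Inf J) < d
        \<longrightarrow> (\<Sum>J\<in>D. norm (G (Sup J) - G (Inf J))) < e)"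

definition locally_absolutely_continuous_on :: "real set \<Rightarrow> (real \<Rightarrow> complex) \<Rightarrow> bool" where
  "locally_absolutely_continuous_on I G \<longleftrightarrow>
     (\<forall>a b. {a..b} \<subseteq> I \<longrightarrow> absolutely_continuous_on {a..b} G)"

text \<open>
  The \<open>j\<close>-th derivative relative to \<open>I\<close> (one-sided at an endpoint belonging to \<open>I\<close>). Where it
  does not exist the value is an unspecified constant; for \<open>j = r\<close> and a locally absolutely
  continuous derivative of order \<open>r - 1\<close> this concerns a null set only.
\<close>

definition deriv_on :: "real set \<Rightarrow> nat \<Rightarrow> (real \<Rightarrow> complex) \<Rightarrow> real \<Rightarrow> complex" where
  "deriv_on I j = (\<lambda>G x. vector_derivative G (at x within I)) ^^ j"

definition sobolev_regular :: "nat \<Rightarrow> real set \<Rightarrow> (real \<Rightarrow> complex) \<Rightarrow> bool" where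
  "sobolev_regular r I F \<longleftrightarrow>
     (\<forall>j<r - 1. \<forall>x\<in>I. deriv_on I j F differentiable (at x within I)) \<and>
     (\<forall>j<r. continuous_on I (deriv_on I j F)) \<and>
     locally_absolutely_continuous_on I (deriv_on I (r - 1) F)"


section \<open>The spaces and their (semi)norms\<close>

definition ennroot :: "real \<Rightarrow> ennreal \<Rightarrow> ennreal" where
  "ennroot p x = (if x = \<infinity> then \<infinity> else ennreal (enn2real x powr (1 / p)))"

definition L_pow :: "nat \<Rightarrow> real \<Rightarrow> real set \<Rightarrow> (real \<Rightarrow> complex) \<Rightarrow> ennreal" where
  "L_pow r p I F = (\<integral>\<^sup>+x\<in>I. ennreal (norm (deriv_on I r F x) powr p) \<partial>lebesgue)"

definition W_pow :: "nat \<Rightarrow> real \<Rightarrow> real set \<Rightarrow> (real \<Rightarrow> complex) \<Rightarrow> ennreal" where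
  "W_pow r p I F = (\<integral>\<^sup>+x\<in>I. ennreal (norm (F x) powr p) \<partial>lebesgue) + L_pow r p I F"

definition L_norm :: "nat \<Rightarrow> real \<Rightarrow> real set \<Rightarrow> (real \<Rightarrow> complex) \<Rightarrow> ennreal" where
  "L_norm r p I F = ennroot p (L_pow r p I F)"

definition W_norm :: "nat \<Rightarrow> real \<Rightarrow> real set \<Rightarrow> (real \<Rightarrow> complex) \<Rightarrow> ennreal" where
  "W_norm r p I F = ennroot p (W_pow r p I F)"

text \<open>
  A complex function on a set \<open>S\<close> of reals is represented by its extension by zero to the whole
  line. Functions on \<open>S\<close> then correspond bijectively to their representatives, and the linear
  operations are the pointwise ones. The notions above look at values in \<open>I\<close> only.

  Elements of the Sobolev space are the continuous representatives: functions whose derivatives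
  up to order \<open>r - 1\<close> are continuous, the last one being locally absolutely continuous.
\<close>

definition L_space :: "nat \<Rightarrow> real \<Rightarrow> real set \<Rightarrow> (real \<Rightarrow> complex) set" where
  "L_space r p I = {F. (\<forall>x. x \<notin> I \<longrightarrow> F x = 0) \<and> sobolev_regular r I F \<and> L_pow r p I F < \<infinity>}"

definition W_space :: "nat \<Rightarrow> real \<Rightarrow> real set \<Rightarrow> (real \<Rightarrow> complex) set" where
  "W_space r p I = {F. (\<forall>x. x \<notin> I \<longrightarrow> F x = 0) \<and> sobolev_regular r I F \<and> W_pow r p I F < \<infinity>}"


section \<open>Traces and interpolators\<close>

definition restr :: "real set \<Rightarrow> (real \<Rightarrow> complex) \<Rightarrow> real \<Rightarrow> complex" where
  "restr S F = (\<lambda>x. if x \<in> S then F x else 0)"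

definition trace_space :: "(real \<Rightarrow> complex) set \<Rightarrow> real set \<Rightarrow> (real \<Rightarrow> complex) set" where
  "trace_space X S = restr S ` X"

definition trace_norm ::
  "((real \<Rightarrow> complex) \<Rightarrow> ennreal) \<Rightarrow> (real \<Rightarrow> complex) set \<Rightarrow> real set \<Rightarrow> (real \<Rightarrow> complex) \<Rightarrow> ennreal"
where
  "trace_norm N X S f = (INF F\<in>{F \<in> X. restr S F = f}. N F)"

text \<open>
  Only the values of \<open>T\<close> on the trace space matter, so the same \<open>T\<close> can be considered on a
  smaller trace space.
\<close>

definition quasi_optimal_interpolator ::
  "((real \<Rightarrow> complex) \<Rightarrow> ennreal) \<Rightarrow> (real \<Rightarrow> complex) set \<Rightarrow> real set
     \<Rightarrow> ((real \<Rightarrow> complex) \<Rightarrow> (real \<Rightarrow> complex)) \<Rightarrow> bool"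
where
  "quasi_optimal_interpolator N X S T \<longleftrightarrow>
     (\<forall>f\<in>trace_space X S. T f \<in> X) \<and>
     (\<forall>f\<in>trace_space X S. \<forall>g\<in>trace_space X S. T (\<lambda>x. f x + g x) = (\<lambda>x. T f x + T g x)) \<and>
     (\<forall>c. \<forall>f\<in>trace_space X S. T (\<lambda>x. c * f x) = (\<lambda>x. c * T f x)) \<and>
     (\<exists>M::real. \<forall>f\<in>trace_space X S. N (T f) \<le> ennreal M * trace_norm N X S f) \<and>
     (\<forall>f\<in>trace_space X S. restr S (T f) = f)"


section \<open>Divided differences and the discrete norms\<close>

fun divdiff :: "(real \<Rightarrow> complex) \<Rightarrow> real list \<Rightarrow> complex" where
  "divdiff f [] = 0"
| "divdiff f [x] = f x"
| "divdiff f (x # y # zs) =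
     (divdiff f (y # zs) - divdiff f (butlast (x # y # zs))) / of_real (last (y # zs) - x)"

definition divdiff_seq :: "(int \<Rightarrow> real) \<Rightarrow> (real \<Rightarrow> complex) \<Rightarrow> int \<Rightarrow> nat \<Rightarrow> complex" where
  "divdiff_seq lam f n j = divdiff f (map lam [n..n + int j])"

definition eqL_pow :: "nat \<Rightarrow> real \<Rightarrow> (int \<Rightarrow> real) \<Rightarrow> (real \<Rightarrow> complex) \<Rightarrow> ennreal" where
  "eqL_pow r p lam f =
     (\<Sum>\<^sub>\<infinity>n. ennreal ((lam (n + int r) - lam n) * norm (divdiff_seq lam f n r) powr p))"

definition eqW_pow :: "nat \<Rightarrow> real \<Rightarrow> (int \<Rightarrow> real) \<Rightarrow> (real \<Rightarrow> complex) \<Rightarrow> ennreal" where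
  "eqW_pow r p lam f = eqL_pow r p lam f +
     (\<Sum>j<r. \<Sum>\<^sub>\<infinity>n. ennreal ((lam (n + int r) - lam n) powr (real j * p + 1)
                          * norm (divdiff_seq lam f n j) powr p))"

definition eqL_norm :: "nat \<Rightarrow> real \<Rightarrow> (int \<Rightarrow> real) \<Rightarrow> (real \<Rightarrow> complex) \<Rightarrow> ennreal" where
  "eqL_norm r p lam f = ennroot p (eqL_pow r p lam f)"

definition eqW_norm :: "nat \<Rightarrow> real \<Rightarrow> (int \<Rightarrow> real) \<Rightarrow> (real \<Rightarrow> complex) \<Rightarrow> ennreal" where
  "eqW_norm r p lam f = ennroot p (eqW_pow r p lam f)"


section \<open>Node sequences\<close>

definition admissible_nodes :: "real \<Rightarrow> (int \<Rightarrow> real) \<Rightarrow> bool" where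
  "admissible_nodes K lam \<longleftrightarrow> strict_mono lam \<and> (\<forall>n. lam (n + 1) - lam n \<le> K)"

definition node_interval :: "(int \<Rightarrow> real) \<Rightarrow> real set" where
  "node_interval lam = (\<Union>n. {lam n..lam (n + 1)})"

abbreviation L_trace :: "nat \<Rightarrow> real \<Rightarrow> (int \<Rightarrow> real) \<Rightarrow> (real \<Rightarrow> complex) set" where
  "L_trace r p lam \<equiv> trace_space (L_space r p (node_interval lam)) (range lam)"

abbreviation W_trace :: "nat \<Rightarrow> real \<Rightarrow> (int \<Rightarrow> real) \<Rightarrow> (real \<Rightarrow> complex) set" where
  "W_trace r p lam \<equiv> trace_space (W_space r p (node_interval lam)) (range lam)"

abbreviation L_trace_norm :: "nat \<Rightarrow> real \<Rightarrow> (int \<Rightarrow> real) \<Rightarrow> (real \<Rightarrow> complex) \<Rightarrow> ennreal" where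
  "L_trace_norm r p lam \<equiv>
     trace_norm (L_norm r p (node_interval lam)) (L_space r p (node_interval lam)) (range lam)"

abbreviation W_trace_norm :: "nat \<Rightarrow> real \<Rightarrow> (int \<Rightarrow> real) \<Rightarrow> (real \<Rightarrow> complex) \<Rightarrow> ennreal" where
  "W_trace_norm r p lam \<equiv>
     trace_norm (W_norm r p (node_interval lam)) (W_space r p (node_interval lam)) (range lam)"

lemma W_trace_subset_L_trace: "W_trace r p lam \<subseteq> L_trace r p lam"
  by (auto simp: trace_space_def W_space_def L_space_def W_pow_def intro!: imageI)

end

theory Submission
  imports Defs
begin

text \<open>
  On \<open>[lam m, lam (m + 1))\<close> Newton's formula with the nodes \<open>lam m, lam (m - 1), \<dots>, lam (m - r + 1)\<close>
  bounds \<open>F\<close> by its divided differences of order below \<open>r\<close> and a remainder controlled by the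
  integral of the \<open>r\<close>-th derivative. Conversely, on \<open>[lam n, lam (n + r)]\<close> a divided difference of
  order \<open>j < r\<close> is a value of the \<open>j\<close>-th derivative, which is bounded by the local \<open>L\<^sub>p\<close> norms of \<open>F\<close>
  and of its \<open>r\<close>-th derivative. As these intervals have bounded length and overlap at most
  \<open>r + 1\<close> times, summation shows that the terms of order below \<open>r\<close> of the discrete \<open>W\<close> norm are
  bounded by the \<open>W\<close> norm of \<open>F\<close>, and that together with the \<open>L\<close> seminorm they bound the \<open>W\<close> norm of
  every \<open>F\<close> with the given trace.

  The top derivative exists almost everywhere only, so that the fundamental theorem of calculus for
  absolutely continuous functions is needed. A function of bounded variation is differentiable almost
  everywhere because refining a division at oscillating points increases the variation, and the
  integral formula then follows in the Henstock--Kurzweil sense, a gauge forcing the intervals tagged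
  in the exceptional null set to have small total length.
\<close>

section \<open>Absolutely continuous functions\<close>

text \<open>The gaps have an upper bound but no lower one, and neighbouring gaps may differ by any
  factor, so a division by a gap must always be compensated. This is why the weight of a divided
  difference of order \<open>j < r\<close> is built from the whole block of \<open>r\<close> gaps
  beginning at its first node, and why the nodes in Newton's formula run to the left from
  \<open>m\<close>: for every \<open>j < r\<close> the block beginning at \<open>m - j\<close>
  contains the cell of \<open>x\<close>, so its length dominates the cell and the Newton factors.
  The terms of order below \<open>r\<close> depend on the trace only. Functions with a common trace
  share them; this settles the interpolator, and it lets an extension that is good for the seminorm
  serve for the \<open>W\<close> norm. The assumption of (a) enters through the terms of order
  \<open>r\<close>. Mean value theorems fail for complex values and are therefore applied to a real
  functional attaining the modulus of the quantity in question. The constants must not depend on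
  \<open>p\<close>: local estimates carry a factor \<open>C powr p\<close>, into which counting
  factors are absorbed.\<close>

lemma vitali_interval_cover:
  fixes E :: "real set" and P :: "real \<Rightarrow> real \<Rightarrow> bool"
  assumes fine: "\<And>x d. x \<in> E \<Longrightarrow> 0 < d \<Longrightarrow> \<exists>s t. P s t \<and> s \<le> x \<and> x \<le> t \<and> s < t \<and> t - s < d"
    and bound: "\<And>C. finite C \<Longrightarrow> (\<And>s t. (s, t) \<in> C \<Longrightarrow> P s t \<and> s < t) \<Longrightarrow>
                  pairwise (\<lambda>i j. disjnt {fst i..snd i} {fst j..snd j}) C \<Longrightarrow>
                  (\<Sum>(s, t)\<in>C. t - s) \<le> B"
  obtains T where "E \<subseteq> T" "T \<in> lmeasurable" "measure lebesgue T \<le> B"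
proof -
  define K where "K = {(s, t). P s t \<and> s < t}"
  \<comment> \<open>Vitali's theorem speaks of closed balls; an interval is the ball around its
    midpoint.\<close>
  define mid where "mid = (\<lambda>i::real \<times> real. (fst i + snd i) / 2)"
  define rad where "rad = (\<lambda>i::real \<times> real. (snd i - fst i) / 2)"
  have cb: "cball (mid i) (rad i) = {fst i..snd i}" for i
  proof -
    have "mid i - rad i = fst i" "mid i + rad i = snd i"
      by (simp_all add: mid_def rad_def field_simps)
    then show ?thesis by (simp add: cball_eq_atLeastAtMost)
  qed
  have rad: "0 < rad i" if "i \<in> K" for i
    using that by (auto simp: K_def rad_def)
  have cover: "\<exists>i. i \<in> K \<and> x \<in> cball (mid i) (rad i) \<and> rad i < d" if "x \<in> E" "0 < d" for x d
  proof -
    note fine[OF that]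
    then obtain s t where st: "P s t" "s \<le> x" "x \<le> t" "s < t" "t - s < d"
      by blast
    then have "(s, t) \<in> K" "x \<in> cball (mid (s, t)) (rad (s, t))" "rad (s, t) < d"
      using that unfolding cb by (simp_all add: K_def rad_def)
    then show ?thesis by blast
  qed
  obtain C where C: "countable C" "C \<subseteq> K"
     "pairwise (\<lambda>i j. disjnt (cball (mid i) (rad i)) (cball (mid j) (rad j))) C"
     "negligible (E - (\<Union>i \<in> C. cball (mid i) (rad i)))"
    by (rule Vitali_covering_theorem_cballs[where K = K and r = rad and a = mid and S = E, OF rad cover])
  \<comment> \<open>Every finite subfamily of the disjoint family \<open>C\<close> obeys the bound
    on the total length, hence so does the countable union. What it leaves uncovered is null and is
    added without changing the measure.\<close>
  let ?U = "\<Union>i\<in>C. {fst i..snd i}"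
  have sub: "measure lebesgue (\<Union>i\<in>D. {fst i..snd i}) \<le> B" if D: "D \<subseteq> C" "finite D" for D
  proof -
    have "measure lebesgue (\<Union>i\<in>D. {fst i..snd i}) \<le> (\<Sum>i\<in>D. measure lebesgue {fst i..snd i})"
      using D by (intro measure_UNION_le) auto
    also have "\<dots> = (\<Sum>(s,t)\<in>D. t - s)"
      using D C(2) by (intro sum.cong) (auto simp: K_def)
    also have "\<dots> \<le> B"
    proof (rule bound)
      show "pairwise (\<lambda>i j. disjnt {fst i..snd i} {fst j..snd j}) D"
        using C(3) D(1) unfolding cb by (rule pairwise_subset)
    qed (use D C(2) in \<open>auto simp: K_def\<close>)
    finally show ?thesis .
  qed
  have m: "{fst i..snd i} \<in> lmeasurable" for i :: "real \<times> real"
    by simp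
  have U: "?U \<in> lmeasurable" "measure lebesgue ?U \<le> B"
    using fmeasurable_UN_bound[OF C(1) m sub] measure_UN_bound[OF C(1) m sub] by blast+
  let ?N = "E - ?U"
  have N: "negligible ?N" using C(4) unfolding cb .
  then have "?N \<in> null_sets lebesgue" by (simp add: negligible_iff_null_sets)
  then have "measure lebesgue (?U \<union> ?N) = measure lebesgue ?U"
    by (rule measure_Un_null_set[OF fmeasurableD[OF U(1)]])
  moreover have "?U \<union> ?N \<in> lmeasurable"
    using U(1) negligible_imp_measurable[OF N] by (rule fmeasurable.Un)
  ultimately show ?thesis
    using U(2) that[of "?U \<union> ?N"] by auto
qed


section \<open>Differentiability almost everywhere of functions of bounded variation\<close>

lemma division_of_Union_divisions:
  fixes a b :: "'a::euclidean_space"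
  assumes q: "q division_of cbox a b" and R: "\<And>J. J \<in> q \<Longrightarrow> R J division_of J"
  shows "(\<Union>J\<in>q. R J) division_of cbox a b"
proof (rule division_ofI)
  show "finite (\<Union>J\<in>q. R J)"
    using q R by (auto intro: division_of_finite)
  show "\<Union> (\<Union>J\<in>q. R J) = cbox a b"
  proof -
    have "\<Union> (\<Union>J\<in>q. R J) = (\<Union>J\<in>q. \<Union>(R J))" by auto
    also have "\<dots> = (\<Union>J\<in>q. J)" using division_ofD(6)[OF R] by auto
    also have "\<dots> = cbox a b" using division_ofD(6)[OF q] by auto
    finally show ?thesis .
  qed
  fix K assume "K \<in> (\<Union>J\<in>q. R J)"
  then obtain J where J: "J \<in> q" "K \<in> R J" by auto
  show "K \<subseteq> cbox a b" "K \<noteq> {}" "\<exists>a b. K = cbox a b"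
    using division_ofD(2-4)[OF R[OF J(1)] J(2)] division_ofD(2)[OF q J(1)] by auto
  fix K' assume "K' \<in> (\<Union>J\<in>q. R J)" and ne: "K \<noteq> K'"
  then obtain J' where J': "J' \<in> q" "K' \<in> R J'" by auto
  show "interior K \<inter> interior K' = {}"
  proof (cases "J = J'")
    case True
    then show ?thesis using division_ofD(5)[OF R[OF J(1)]] J J' ne by blast
  next
    case False
    have "K \<subseteq> J" "K' \<subseteq> J'"
      using division_ofD(2)[OF R] J J' by blast+
    then show ?thesis
      using division_ofD(5)[OF q J(1) J'(1) False] interior_mono by blast
  qed
qed

text \<open>The increments over \<open>R\<close> add up to \<open>f v - f u\<close>. The intervals
  of \<open>C\<close> move against that sign by at least \<open>c\<close> times their length, and
  the other intervals must make this up in addition to the net increment. The loss thus appears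
  twice in the sum of absolute values, whence \<open>2 * c\<close>.\<close>

lemma variation_refine_interval:
  fixes f :: "real \<Rightarrow> real"
  assumes C: "C division_of \<Union>C" "\<Union>C \<subseteq> {u..v}" and uv: "u \<le> v" and s: "s = 1 \<or> s = -1"
    and sgn: "s * (f v - f u) \<ge> 0"
    and opp: "\<And>J. J \<in> C \<Longrightarrow> s * (f (Sup J) - f (Inf J)) \<le> - c * (Sup J - Inf J)"
  obtains R where "R division_of {u..v}"
    "(\<Sum>J\<in>R. \<bar>f (Sup J) - f (Inf J)\<bar>) \<ge> \<bar>f v - f u\<bar> + 2 * c * (\<Sum>J\<in>C. Sup J - Inf J)"
proof -
  define D where "D = (\<lambda>J. f (Sup J) - f (Inf J))"
  obtain R where R: "C \<subseteq> R" "R division_of {u..v}"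
    using partial_division_extend_interval[OF C(1), of u v] C(2) by (metis box_real(2))
  have fin: "finite R" using R(2) by (rule division_of_finite)
  \<comment> \<open>The tags serve only to reach the telescoping sum over a tagged division.\<close>
  have "(\<lambda>K. (Inf K, K)) ` R tagged_division_of {u..v}"
  proof (rule tagged_division_ofI)
    fix x K assume "(x, K) \<in> (\<lambda>K. (Inf K, K)) ` R"
    then have K: "K \<in> R" "x = Inf K" by auto
    then obtain w z where "K = cbox w z" "K \<noteq> {}"
      using division_ofD[OF R(2)] by metis
    then show "x \<in> K" "\<exists>w z. K = cbox w z" "K \<subseteq> {u..v}"
      using K division_ofD(2)[OF R(2) K(1)] by auto
  next
    fix x1 K1 x2 K2
    assume "(x1, K1) \<in> (\<lambda>K. (Inf K, K)) ` R" "(x2, K2) \<in> (\<lambda>K. (Inf K, K)) ` R" "(x1, K1) \<noteq> (x2, K2)"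
    then show "interior K1 \<inter> interior K2 = {}"
      using division_ofD(5)[OF R(2)] by blast
  next
    show "\<Union> {K. \<exists>x. (x, K) \<in> (\<lambda>K. (Inf K, K)) ` R} = {u..v}"
    proof -
      have "{K. \<exists>x. (x, K) \<in> (\<lambda>K. (Inf K, K)) ` R} = R" by auto
      then show ?thesis using division_ofD(6)[OF R(2)] by simp
    qed
  qed (use fin in auto)
  then have "(\<Sum>(x,K)\<in>(\<lambda>K. (Inf K, K)) ` R. f (Sup K) - f (Inf K)) = f v - f u"
    by (rule additive_tagged_division_1[OF uv])
  then have tel: "sum D R = f v - f u"
    by (subst (asm) sum.reindex) (auto simp: inj_on_def D_def)
  have split: "sum g R = sum g C + sum g (R - C)" for g :: "real set \<Rightarrow> real"
    using fin R(1) by (metis add.commute sum.subset_diff)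
  have 1: "(\<Sum>J\<in>C. \<bar>D J\<bar>) \<ge> - s * sum D C"
  proof -
    have "- s * sum D C \<le> \<bar>sum D C\<bar>" using s by auto
    then show ?thesis using sum_abs[of D C] by linarith
  qed
  have 2: "(\<Sum>J\<in>R - C. \<bar>D J\<bar>) \<ge> s * sum D (R - C)"
  proof -
    have "s * sum D (R - C) \<le> \<bar>sum D (R - C)\<bar>" using s by auto
    then show ?thesis using sum_abs[of D "R - C"] by linarith
  qed
  have 3: "s * sum D C \<le> - c * (\<Sum>J\<in>C. Sup J - Inf J)"
    unfolding sum_distrib_left using opp by (intro sum_mono) (auto simp: D_def)
  have 4: "s * sum D C + s * sum D (R - C) = \<bar>f v - f u\<bar>"
    using split[of D] tel sgn s by (auto simp: algebra_simps)
  have "(\<Sum>J\<in>R. \<bar>D J\<bar>) \<ge> \<bar>f v - f u\<bar> + 2 * c * (\<Sum>J\<in>C. Sup J - Inf J)"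
    using split[of "\<lambda>J. \<bar>D J\<bar>"] 1 2 3 4 by linarith
  then show ?thesis using R that by (simp add: D_def)
qed

text \<open>An interval can belong to \<open>R J\<close> for two different \<open>J\<close> only if
  it is degenerate; its increment is then zero, so counting it once or twice makes no
  difference.\<close>

lemma sum_Union_divisions:
  fixes f :: "real \<Rightarrow> real"
  assumes q: "q division_of {a..b}" and R: "\<And>J. J \<in> q \<Longrightarrow> R J division_of J"
  shows "(\<Sum>K\<in>(\<Union>J\<in>q. R J). \<bar>f (Sup K) - f (Inf K)\<bar>) = (\<Sum>J\<in>q. \<Sum>K\<in>R J. \<bar>f (Sup K) - f (Inf K)\<bar>)"
proof -
  let ?g = "\<lambda>K. \<bar>f (Sup K) - f (Inf K)\<bar>"
  have fin: "finite q" "\<And>J. J \<in> q \<Longrightarrow> finite (R J)"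
    using q R by (auto intro: division_of_finite)
  have eq: "(\<Union>J\<in>q. R J) = snd ` Sigma q R" by force
  have "sum ?g (snd ` Sigma q R) = sum (?g \<circ> snd) (Sigma q R)"
  proof (rule sum.reindex_nontrivial)
    fix x y assume xy: "x \<in> Sigma q R" "y \<in> Sigma q R" "x \<noteq> y" "snd x = snd y"
    let ?K = "snd x"
    have J: "fst x \<in> q" "fst y \<in> q" "fst x \<noteq> fst y" "?K \<in> R (fst x)" "?K \<in> R (fst y)"
      using xy by (auto simp: prod_eq_iff)
    have "?K \<subseteq> fst x" "?K \<subseteq> fst y"
      using division_ofD(2)[OF R] J by blast+
    moreover have "interior (fst x) \<inter> interior (fst y) = {}"
      using division_ofD(5)[OF q] J by blast
    ultimately have "interior ?K = {}"
      using interior_mono[of ?K] by blast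
    moreover obtain w z where K: "?K = {w..z}"
      using division_ofD(4)[OF R[OF J(1)] J(4)] by (metis box_real(2))
    moreover have "?K \<noteq> {}"
      using division_ofD(3)[OF R[OF J(1)] J(4)] .
    ultimately have "w = z" by (auto simp: interior_atLeastAtMost_real)
    then show "?g (snd x) = 0" by (simp add: K)
  qed (use fin in auto)
  also have "\<dots> = (\<Sum>J\<in>q. \<Sum>K\<in>R J. ?g K)"
    using fin by (simp add: sum.Sigma split_beta o_def)
  finally show ?thesis by (simp add: eq)
qed

lemma inj_on_intervals:
  fixes C :: "(real \<times> real) set"
  assumes "\<And>i. i \<in> C \<Longrightarrow> fst i < snd i"
  shows "inj_on (\<lambda>i. {fst i..snd i}) C"
proof (rule inj_onI)
  fix i j assume "i \<in> C" "j \<in> C" "{fst i..snd i} = {fst j..snd j}"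
  then show "i = j"
    using assms[of i] assms[of j] by (simp add: prod_eq_iff Icc_eq_Icc)
qed

lemma disjoint_intervals_division:
  fixes C :: "(real \<times> real) set"
  assumes C: "finite C" "\<And>i. i \<in> C \<Longrightarrow> fst i < snd i"
    "pairwise (\<lambda>i j. disjnt {fst i..snd i} {fst j..snd j}) C"
  shows "(\<lambda>i. {fst i..snd i}) ` C division_of \<Union>((\<lambda>i. {fst i..snd i}) ` C)"
proof (rule division_ofI)
  fix K assume K: "K \<in> (\<lambda>i. {fst i..snd i}) ` C"
  then obtain i where i: "i \<in> C" "K = {fst i..snd i}" by auto
  then show "K \<subseteq> \<Union>((\<lambda>i. {fst i..snd i}) ` C)" "K \<noteq> {}" "\<exists>a b. K = cbox a b"
    using K C(2)[of i] by (blast, simp, metis box_real(2))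
  fix K' assume "K' \<in> (\<lambda>i. {fst i..snd i}) ` C" "K \<noteq> K'"
  then obtain j where "j \<in> C" "K' = {fst j..snd j}" "i \<noteq> j" using i by auto
  then have "disjnt K K'" using C(3) i by (auto simp: pairwise_def)
  then show "interior K \<inter> interior K' = {}"
    using interior_subset unfolding disjnt_def by blast
qed (use C(1) in auto)

text \<open>Around a point of \<open>E\<close> there are, at every scale, intervals of slope at most
  \<open>- c\<close> and others of slope at least \<open>c\<close>. A division \<open>q\<close>
  whose variation is within \<open>2 * c * e\<close> of the supremum leaves little room for
  refinement: intervals around points of \<open>E\<close> that oppose the net increment of their
  member of \<open>q\<close> raise the variation by \<open>2 * c\<close> times their length, so
  disjoint ones have total length at most \<open>e\<close>.\<close>

lemma oscillation_negligible:
  fixes f :: "real \<Rightarrow> real"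
  assumes bv: "\<And>D. D division_of \<Union>D \<Longrightarrow> \<Union>D \<subseteq> {a..b} \<Longrightarrow> (\<Sum>J\<in>D. \<bar>f (Sup J) - f (Inf J)\<bar>) \<le> M"
    and E: "E \<subseteq> {a..b}" and c: "0 < c"
    and osc: "\<And>s x d. s = 1 \<or> s = -1 \<Longrightarrow> x \<in> E \<Longrightarrow> 0 < d \<Longrightarrow>
       \<exists>u v. u \<le> x \<and> x \<le> v \<and> u < v \<and> v - u < d \<and> s * (f v - f u) \<le> - c * (v - u)"
  shows "negligible E"
proof -
  define W where "W = (\<lambda>D. \<Sum>J\<in>D. \<bar>f (Sup J) - f (Inf J)\<bar>)"
  define X where "X = W ` {D. D division_of \<Union>D \<and> \<Union>D \<subseteq> {a..b}}"
  have bdd: "bdd_above X" unfolding X_def W_def using bv by (auto intro!: bdd_aboveI)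
  have WS: "W D \<le> Sup X" if "D division_of {a..b}" for D
    using that bdd division_ofD(6)[OF that] by (intro cSup_upper) (auto simp: X_def)
  have "{} division_of \<Union>({}::real set set)" by simp
  then have ne: "X \<noteq> {}" unfolding X_def by blast
  have cover: "\<exists>F T. finite F \<and> E - F \<subseteq> T \<and> T \<in> lmeasurable \<and> measure lebesgue T \<le> e" if e: "0 < e" for e
  proof -
    have "Sup X - 2 * c * e < Sup X" using c e by simp
    then obtain D where D: "D division_of \<Union>D" "\<Union>D \<subseteq> {a..b}" "Sup X - 2 * c * e < W D"
      using less_cSupD[OF ne] unfolding X_def by blast
    obtain q where q: "D \<subseteq> q" "q division_of {a..b}"
      using partial_division_extend_interval[OF D(1), of a b] D(2) by (metis box_real(2))
    have finq: "finite q" using q(2) by (rule division_of_finite)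
    have Wq: "Sup X - 2 * c * e < W q"
    proof -
      have "W D \<le> W q" unfolding W_def using finq q(1) by (intro sum_mono2) auto
      then show ?thesis using D(3) by linarith
    qed
    have qI: "\<exists>w z. w \<le> z \<and> J = {w..z}" if J: "J \<in> q" for J
      using division_ofD(3,4)[OF q(2) J] by (metis atLeastatMost_empty_iff box_real(2))
    define sg where "sg = (\<lambda>J. if f (Sup J) - f (Inf J) \<ge> 0 then 1 else (-1::real))"
    define P where "P = (\<lambda>u v. \<exists>J\<in>q. {u..v} \<subseteq> J \<and> sg J * (f v - f u) \<le> - c * (v - u))"
    \<comment> \<open>Endpoints of members of \<open>q\<close> are set aside, because small
      intervals around them need not stay inside one member. They form a finite set.\<close>
    define F where "F = Inf ` q \<union> Sup ` q"
    have fineP: "\<exists>u v. P u v \<and> u \<le> x \<and> x \<le> v \<and> u < v \<and> v - u < d" if x: "x \<in> E - F" and d: "0 < d" for x d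
    proof -
      have "x \<in> \<Union>q" using x E division_ofD(6)[OF q(2)] by blast
      then obtain J where J: "J \<in> q" "x \<in> J" by blast
      obtain w z where wz: "w \<le> z" "J = {w..z}" using qI[OF J(1)] by blast
      then have "Inf J = w" "Sup J = z" by auto
      then have "x \<noteq> w" "x \<noteq> z" using x J(1) by (auto simp: F_def)
      then have *: "w < x" "x < z" using J(2) wz by auto
      have "sg J = 1 \<or> sg J = -1" by (simp add: sg_def)
      from osc[OF this, of x "min d (min (x - w) (z - x))"] obtain u v where
        uv: "u \<le> x" "x \<le> v" "u < v" "v - u < min d (min (x - w) (z - x))" "sg J * (f v - f u) \<le> - c * (v - u)"
        using x d * by auto
      then have "{u..v} \<subseteq> J" by (auto simp: wz(2))
      then show ?thesis using uv J(1) unfolding P_def by auto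
    qed
    have bound: "(\<Sum>(u, v)\<in>C. v - u) \<le> e"
      if C: "finite C" "\<And>u v. (u, v) \<in> C \<Longrightarrow> P u v \<and> u < v"
        "pairwise (\<lambda>i j. disjnt {fst i..snd i} {fst j..snd j}) C" for C
    proof -
      define iv where "iv = (\<lambda>i::real \<times> real. {fst i..snd i})"
      have iv: "fst i < snd i" "Inf (iv i) = fst i" "Sup (iv i) = snd i" if "i \<in> C" for i
        using C(2)[of "fst i" "snd i"] that by (auto simp: iv_def)
      have inj: "inj_on iv C"
        unfolding iv_def by (rule inj_on_intervals) (rule iv(1))
      define Cs where "Cs = (\<lambda>J. iv ` {i \<in> C. iv i \<subseteq> J})"
      have Cs_div: "Cs J division_of \<Union>(Cs J)" for J
        unfolding Cs_def iv_def
      proof (rule disjoint_intervals_division)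
        show "pairwise (\<lambda>i j. disjnt {fst i..snd i} {fst j..snd j}) {i \<in> C. {fst i..snd i} \<subseteq> J}"
          using C(3) by (rule pairwise_subset) auto
      qed (use C(1) iv(1) in auto)
      have "\<exists>R. R division_of J \<and> W R \<ge> \<bar>f (Sup J) - f (Inf J)\<bar> + 2 * c * (\<Sum>K\<in>Cs J. Sup K - Inf K)"
        if J: "J \<in> q" for J
      proof -
        obtain w z where wz: "w \<le> z" "J = {w..z}" using qI[OF J] by blast
        have opp: "sg J * (f (Sup K) - f (Inf K)) \<le> - c * (Sup K - Inf K)" if K: "K \<in> Cs J" for K
        proof -
          obtain i where i: "i \<in> C" "K = iv i" "iv i \<subseteq> J" using K by (auto simp: Cs_def)
          obtain J' where J': "J' \<in> q" "iv i \<subseteq> J'" "sg J' * (f (snd i) - f (fst i)) \<le> - c * (snd i - fst i)"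
            using C(2)[of "fst i" "snd i"] i(1) by (auto simp: P_def iv_def)
          \<comment> \<open>\<open>P\<close> only names some member of \<open>q\<close>. As the
            interval is nondegenerate and distinct members have disjoint interiors, that member is
            \<open>J\<close>, so the sign is the one belonging to \<open>J\<close>.\<close>
          have "interior (iv i) \<noteq> {}" using iv(1)[OF i(1)] by (simp add: iv_def interior_atLeastAtMost_real)
          then have "interior J \<inter> interior J' \<noteq> {}"
            using interior_mono[OF i(3)] interior_mono[OF J'(2)] by blast
          then have "J' = J" using division_ofD(5)[OF q(2) J J'(1)] by blast
          then show ?thesis using J'(3) iv[OF i(1)] i(2) by simp
        qed
        have "sg J * (f z - f w) \<ge> 0" using wz by (auto simp: sg_def)
        moreover have "\<Union>(Cs J) \<subseteq> {w..z}" using wz by (auto simp: Cs_def)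
        moreover have "sg J = 1 \<or> sg J = -1" by (simp add: sg_def)
        ultimately obtain R where R: "R division_of {w..z}"
          "(\<Sum>K\<in>R. \<bar>f (Sup K) - f (Inf K)\<bar>) \<ge> \<bar>f z - f w\<bar> + 2 * c * (\<Sum>K\<in>Cs J. Sup K - Inf K)"
          using variation_refine_interval[where f = f and C = "Cs J" and s = "sg J" and c = c, OF Cs_div _ wz(1) _ _ opp]
          by blast
        then show ?thesis using wz by (intro exI[of _ R]) (auto simp: W_def)
      qed
      then obtain R where R: "\<And>J. J \<in> q \<Longrightarrow> R J division_of J"
        "\<And>J. J \<in> q \<Longrightarrow> W (R J) \<ge> \<bar>f (Sup J) - f (Inf J)\<bar> + 2 * c * (\<Sum>K\<in>Cs J. Sup K - Inf K)"
        by metis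
      \<comment> \<open>Each interval of \<open>C\<close> lies in a member of \<open>q\<close> and
        is therefore counted at least once on the right.\<close>
      have "(\<Sum>i\<in>C. snd i - fst i) \<le> (\<Sum>i\<in>C. \<Sum>J\<in>q. if iv i \<subseteq> J then snd i - fst i else 0)"
      proof (rule sum_mono)
        fix i assume i: "i \<in> C"
        obtain J where J: "J \<in> q" "iv i \<subseteq> J"
          using C(2)[of "fst i" "snd i"] i by (auto simp: P_def iv_def)
        have "(\<Sum>J\<in>{J}. if iv i \<subseteq> J then snd i - fst i else 0)
              \<le> (\<Sum>J\<in>q. if iv i \<subseteq> J then snd i - fst i else 0)"
          using finq J iv(1)[OF i] by (intro sum_mono2) auto
        then show "snd i - fst i \<le> (\<Sum>J\<in>q. if iv i \<subseteq> J then snd i - fst i else 0)"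
          using J by simp
      qed
      also have "\<dots> = (\<Sum>J\<in>q. \<Sum>i\<in>C. if iv i \<subseteq> J then snd i - fst i else 0)"
        by (rule sum.swap)
      also have "\<dots> = (\<Sum>J\<in>q. \<Sum>K\<in>Cs J. Sup K - Inf K)"
      proof (rule sum.cong[OF refl])
        fix J
        have "(\<Sum>K\<in>Cs J. Sup K - Inf K) = (\<Sum>i\<in>{i\<in>C. iv i \<subseteq> J}. Sup (iv i) - Inf (iv i))"
          unfolding Cs_def by (subst sum.reindex) (auto intro: inj_on_subset[OF inj])
        also have "\<dots> = (\<Sum>i\<in>{i\<in>C. iv i \<subseteq> J}. snd i - fst i)"
          using iv by (intro sum.cong) auto
        also have "\<dots> = (\<Sum>i\<in>C. if iv i \<subseteq> J then snd i - fst i else 0)"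
          using C(1) by (simp add: sum.If_cases Int_def)
        finally show "(\<Sum>i\<in>C. if iv i \<subseteq> J then snd i - fst i else 0) = (\<Sum>K\<in>Cs J. Sup K - Inf K)" ..
      qed
      finally have 1: "(\<Sum>i\<in>C. snd i - fst i) \<le> (\<Sum>J\<in>q. \<Sum>K\<in>Cs J. Sup K - Inf K)" .
      have "W q + 2 * c * (\<Sum>J\<in>q. \<Sum>K\<in>Cs J. Sup K - Inf K) \<le> (\<Sum>J\<in>q. W (R J))"
      proof -
        have "W q = (\<Sum>J\<in>q. \<bar>f (Sup J) - f (Inf J)\<bar>)" by (simp add: W_def)
        then show ?thesis
          unfolding sum_distrib_left[of _ _ q]
          using R(2) by (simp add: sum.distrib[symmetric]) (intro sum_mono; simp)
      qed
      also have "\<dots> = W (\<Union>J\<in>q. R J)"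
        using sum_Union_divisions[OF q(2) R(1), of f] by (simp add: W_def)
      also have "\<dots> \<le> Sup X"
        using division_of_Union_divisions[of q a b R] q(2) R(1) by (intro WS) auto
      finally have "2 * c * (\<Sum>J\<in>q. \<Sum>K\<in>Cs J. Sup K - Inf K) \<le> 2 * c * e"
        using Wq by linarith
      then have "(\<Sum>J\<in>q. \<Sum>K\<in>Cs J. Sup K - Inf K) \<le> e" using c by simp
      then show ?thesis using 1 by (simp add: split_beta)
    qed
    obtain T where "E - F \<subseteq> T" "T \<in> lmeasurable" "measure lebesgue T \<le> e"
      using vitali_interval_cover[OF fineP bound] by blast
    then show ?thesis using finq by (intro exI[of _ F] exI[of _ T]) (auto simp: F_def)
  qed
  show ?thesis
    unfolding negligible_outer_le
  proof (intro allI impI)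
    fix e :: real assume "0 < e"
    from cover[OF this] obtain F T where FT: "finite F" "E - F \<subseteq> T" "T \<in> lmeasurable" "measure lebesgue T \<le> e"
      by blast
    have "F \<in> null_sets lebesgue" using FT(1) negligible_finite negligible_iff_null_sets by blast
    then have "measure lebesgue (T \<union> F) = measure lebesgue T"
      by (rule measure_Un_null_set[OF fmeasurableD[OF FT(3)]])
    moreover have "T \<union> F \<in> lmeasurable"
      using FT(3) negligible_imp_measurable[OF negligible_finite[OF FT(1)]] by (rule fmeasurable.Un)
    ultimately show "\<exists>T. E \<subseteq> T \<and> T \<in> lmeasurable \<and> measure lebesgue T \<le> e"
      using FT by (intro exI[of _ "T \<union> F"]) auto
  qed
qed

text \<open>Disjoint intervals with slope of modulus at least \<open>n\<close> have total length at
  most \<open>M / n\<close>, because their increments are part of the variation.\<close>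

lemma infinite_quotient_negligible:
  fixes f :: "real \<Rightarrow> real"
  assumes bv: "\<And>D. D division_of \<Union>D \<Longrightarrow> \<Union>D \<subseteq> {a..b} \<Longrightarrow> (\<Sum>J\<in>D. \<bar>f (Sup J) - f (Inf J)\<bar>) \<le> M"
    and unb: "\<And>x n d. x \<in> E \<Longrightarrow> 0 < d \<Longrightarrow>
       \<exists>u v. {u..v} \<subseteq> {a..b} \<and> u \<le> x \<and> x \<le> v \<and> u < v \<and> v - u < d \<and> n * (v - u) \<le> \<bar>f v - f u\<bar>"
  shows "negligible E"
  unfolding negligible_outer_le
proof (intro allI impI)
  fix e :: real assume e: "0 < e"
  \<comment> \<open>\<open>\<bar>M\<bar> + 1\<close> makes \<open>n\<close> positive whatever the
    value of \<open>M\<close>, and yields \<open>M \<le> n * e\<close>.\<close>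
  define n where "n = (\<bar>M\<bar> + 1) / e"
  have n: "0 < n" "n * e = \<bar>M\<bar> + 1" using e by (auto simp: n_def)
  let ?P = "\<lambda>u v. {u..v} \<subseteq> {a..b} \<and> n * (v - u) \<le> \<bar>f v - f u\<bar>"
  have fine: "\<exists>u v. ?P u v \<and> u \<le> x \<and> x \<le> v \<and> u < v \<and> v - u < d" if "x \<in> E" "0 < d" for x d
    using unb[OF that, of n] by blast
  have bound: "(\<Sum>(u, v)\<in>C. v - u) \<le> e"
    if C: "finite C" "\<And>u v. (u, v) \<in> C \<Longrightarrow> ?P u v \<and> u < v"
      "pairwise (\<lambda>i j. disjnt {fst i..snd i} {fst j..snd j}) C" for C
  proof -
    have lt: "fst i < snd i" if "i \<in> C" for i using C(2)[of "fst i" "snd i"] that by simp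
    have P: "?P (fst i) (snd i)" if "i \<in> C" for i using C(2)[of "fst i" "snd i"] that by simp
    have "n * (\<Sum>i\<in>C. snd i - fst i) \<le> (\<Sum>i\<in>C. \<bar>f (snd i) - f (fst i)\<bar>)"
      unfolding sum_distrib_left using P by (intro sum_mono) auto
    also have "\<dots> = (\<Sum>J\<in>(\<lambda>i. {fst i..snd i}) ` C. \<bar>f (Sup J) - f (Inf J)\<bar>)"
      using lt by (subst sum.reindex[OF inj_on_intervals]) (auto intro!: sum.cong simp: less_imp_le)
    also have "\<dots> \<le> M"
    proof (rule bv)
      show "\<Union>((\<lambda>i. {fst i..snd i}) ` C) \<subseteq> {a..b}" using P by (intro UN_least) blast
    qed (rule disjoint_intervals_division[OF C(1) lt C(3)])
    also have "\<dots> \<le> n * e" using n by simp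
    finally show ?thesis using n(1) by (simp add: split_beta)
  qed
  show "\<exists>T. E \<subseteq> T \<and> T \<in> lmeasurable \<and> measure lebesgue T \<le> e"
    using vitali_interval_cover[OF fine bound] by blast
qed

text \<open>The derivative is \<open>L\<close>, the infimum of the set \<open>A\<close> of eventual
  upper bounds of the difference quotients; \<open>bnd\<close> makes \<open>A\<close> nonempty and
  bounded below. A rational \<open>\<beta> < L\<close> is not in \<open>A\<close>, so
  \<open>sep\<close> turns every rational \<open>\<alpha> < \<beta>\<close> into an eventual lower
  bound. Intervals straddling \<open>x\<close> include the one-sided quotients through
  \<open>u = x\<close> and \<open>v = x\<close>.\<close>

lemma differentiable_of_quotient_bounds:
  fixes f :: "real \<Rightarrow> real"
  defines "up \<equiv> \<lambda>x c d. \<forall>u v. u \<le> x \<and> x \<le> v \<and> u < v \<and> v - u < d \<longrightarrow> f v - f u < c * (v - u)"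
    and "lo \<equiv> \<lambda>x c d. \<forall>u v. u \<le> x \<and> x \<le> v \<and> u < v \<and> v - u < d \<longrightarrow> c * (v - u) < f v - f u"
  assumes bnd: "0 < d0" "up x n d0" "lo x (- n) d0"
    and sep: "\<And>\<alpha> \<beta>. \<alpha> \<in> \<rat> \<Longrightarrow> \<beta> \<in> \<rat> \<Longrightarrow> \<alpha> < \<beta> \<Longrightarrow> \<exists>d>0. lo x \<alpha> d \<or> up x \<beta> d"
  shows "f differentiable (at x)"
proof -
  define A where "A = {c. \<exists>d>0. up x c d}"
  have nA: "n \<in> A" using bnd by (auto simp: A_def)
  have lbA: "- n \<le> c" if cA: "c \<in> A" for c
  proof -
    obtain d where d: "0 < d" "up x c d" using cA unfolding A_def by blast
    define h where "h = min d d0 / 2"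
    have h: "0 < h" "h < d" "h < d0" using d bnd(1) by (auto simp: h_def)
    have "f (x + h) - f x < c * h" "- n * h < f (x + h) - f x"
      using d(2)[unfolded up_def, rule_format, of x "x + h"] bnd(3)[unfolded lo_def, rule_format, of x "x + h"] h
      by auto
    then have "- n * h < c * h" by linarith
    then have "- n < c" by (rule mult_right_less_imp_less) (use h(1) in simp)
    then show ?thesis by simp
  qed
  have bdd: "bdd_below A" using lbA by (auto intro!: bdd_belowI)
  define L where "L = Inf A"
  have near: "\<exists>d>0. up x (L + e) d \<and> lo x (L - e) d" if e: "0 < e" for e
  proof -
    have "Inf A < L + e" using e by (simp add: L_def)
    then obtain c where c: "c \<in> A" "c < L + e" using cInf_lessD[of A] nA by blast
    then obtain d1 where d1: "0 < d1" "up x c d1" unfolding A_def by blast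
    obtain \<beta> where b: "\<beta> \<in> \<rat>" "L - e < \<beta>" "\<beta> < L" using Rats_dense_in_real[of "L - e" L] e by auto
    obtain \<alpha> where a: "\<alpha> \<in> \<rat>" "L - e < \<alpha>" "\<alpha> < \<beta>" using Rats_dense_in_real[of "L - e" \<beta>] b by auto
    have "\<beta> \<notin> A" using cInf_lower[OF _ bdd, of \<beta>] b by (auto simp: L_def)
    then obtain d2 where d2: "0 < d2" "lo x \<alpha> d2" using sep[OF a(1) b(1) a(3)] by (auto simp: A_def)
    have "up x (L + e) (min d1 d2)"
      unfolding up_def
    proof (intro allI impI)
      fix u v assume uv: "u \<le> x \<and> x \<le> v \<and> u < v \<and> v - u < min d1 d2"
      then have "f v - f u < c * (v - u)" using d1(2) by (auto simp: up_def)
      also have "\<dots> \<le> (L + e) * (v - u)" using c uv by (intro mult_right_mono) auto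
      finally show "f v - f u < (L + e) * (v - u)" .
    qed
    moreover have "lo x (L - e) (min d1 d2)"
      unfolding lo_def
    proof (intro allI impI)
      fix u v assume uv: "u \<le> x \<and> x \<le> v \<and> u < v \<and> v - u < min d1 d2"
      have "(L - e) * (v - u) \<le> \<alpha> * (v - u)" using a uv by (intro mult_right_mono) auto
      also have "\<dots> < f v - f u" using d2(2) uv by (auto simp: lo_def)
      finally show "(L - e) * (v - u) < f v - f u" .
    qed
    ultimately show ?thesis using d1(1) d2(1) by (intro exI[of _ "min d1 d2"]) simp
  qed
  have "(f has_derivative (\<lambda>h. L * h)) (at x)"
    unfolding has_derivative_at_alt
  proof (intro conjI allI impI)
    show "bounded_linear ((*) L)" by (rule bounded_linear_mult_right)
    fix e :: real assume e: "0 < e"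
    from near[OF this] obtain d where d: "0 < d" "up x (L + e) d" "lo x (L - e) d" by blast
    have "norm (f y - f x - L * (y - x)) \<le> e * norm (y - x)" if y: "norm (y - x) < d" for y
    proof (cases x y rule: linorder_cases)
      case less
      then have "f y - f x < (L + e) * (y - x)" "(L - e) * (y - x) < f y - f x"
        using d y unfolding up_def lo_def by auto
      then show ?thesis using less by (auto simp: abs_if algebra_simps)
    next
      case greater
      then have "f x - f y < (L + e) * (x - y)" "(L - e) * (x - y) < f x - f y"
        using d y unfolding up_def lo_def by auto
      then show ?thesis using greater by (auto simp: abs_if algebra_simps)
    qed simp
    then show "\<exists>d>0. \<forall>y. norm (y - x) < d \<longrightarrow> norm (f y - f x - L * (y - x)) \<le> e * norm (y - x)"
      using d(1) by blast
  qed
  then show ?thesis by (auto simp: differentiable_def)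
qed

text \<open>A point without a derivative either has unbounded quotients at every scale (the set
  \<open>U\<close>) or, for some rational \<open>\<alpha> < \<beta>\<close>, has at every scale both
  quotients at most \<open>\<alpha>\<close> and quotients at least \<open>\<beta>\<close> (the sets
  \<open>E\<close>). Only countably many pairs occur.\<close>

lemma bounded_variation_differentiable_ae:
  fixes f :: "real \<Rightarrow> real"
  assumes bv: "\<And>D. D division_of \<Union>D \<Longrightarrow> \<Union>D \<subseteq> {a..b} \<Longrightarrow> (\<Sum>J\<in>D. \<bar>f (Sup J) - f (Inf J)\<bar>) \<le> M"
  shows "negligible {x \<in> {a<..<b}. \<not> f differentiable (at x)}"
proof -
  define near where "near = (\<lambda>x d u v. u \<le> x \<and> x \<le> v \<and> u < v \<and> v - u < (d::real))"
  define U where "U = {x \<in> {a<..<b}. \<forall>n. \<forall>d>0. \<exists>u v. near x d u v \<and> n * (v - u) \<le> \<bar>f v - f u\<bar>}"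
  define E where "E = (\<lambda>(\<alpha>, \<beta>). {x \<in> {a<..<b}. (\<forall>d>0. \<exists>u v. near x d u v \<and> f v - f u \<le> \<alpha> * (v - u))
     \<and> (\<forall>d>0. \<exists>u v. near x d u v \<and> \<beta> * (v - u) \<le> f v - f u)})"
  define I where "I = {(\<alpha>, \<beta>). \<alpha> \<in> \<rat> \<and> \<beta> \<in> \<rat> \<and> \<alpha> < (\<beta>::real)}"
  have "negligible U"
  proof (rule infinite_quotient_negligible[OF bv])
    fix x n d :: real assume x: "x \<in> U" and d: "0 < d"
    then have "0 < min d (min (x - a) (b - x))" by (auto simp: U_def)
    then obtain u v where uv: "near x (min d (min (x - a) (b - x))) u v" "n * (v - u) \<le> \<bar>f v - f u\<bar>"
      using x unfolding U_def by blast
    then show "\<exists>u v. {u..v} \<subseteq> {a..b} \<and> u \<le> x \<and> x \<le> v \<and> u < v \<and> v - u < d \<and> n * (v - u) \<le> \<bar>f v - f u\<bar>"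
      by (intro exI[of _ u] exI[of _ v]) (auto simp: near_def)
  qed
  moreover have "negligible (E i)" if i: "i \<in> I" for i
  proof -
    obtain \<alpha> \<beta> where ab: "i = (\<alpha>, \<beta>)" "\<alpha> < \<beta>" using i by (auto simp: I_def)
    \<comment> \<open>Subtracting the line of slope \<open>m\<close> moves the thresholds
      \<open>\<alpha>\<close> and \<open>\<beta>\<close> to \<open>- c\<close> and \<open>c\<close>,
      the symmetric form that \<open>oscillation_negligible\<close> expects. The variation grows by
      at most \<open>\<bar>m\<bar>\<close> times the length of the interval.\<close>
    define m where "m = (\<alpha> + \<beta>) / 2"
    define c where "c = (\<beta> - \<alpha>) / 2"
    define g where "g = (\<lambda>x. f x - m * x)"
    have am: "\<alpha> = m - c" "\<beta> = m + c" by (auto simp: m_def c_def field_simps)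
    show ?thesis
    proof (rule oscillation_negligible[where f = g and c = c and a = a and b = b and M = "M + \<bar>m\<bar> * measure lborel {a..b}"])
      show "E i \<subseteq> {a..b}" "0 < c" using ab by (auto simp: E_def c_def)
      fix D assume D: "D division_of \<Union>D" "\<Union>D \<subseteq> {a..b}"
      have len: "Sup J - Inf J = measure lborel J" if "J \<in> D" for J
        using division_ofD(3,4)[OF D(1) that] by auto
      have "(\<Sum>J\<in>D. \<bar>g (Sup J) - g (Inf J)\<bar>) \<le> (\<Sum>J\<in>D. \<bar>f (Sup J) - f (Inf J)\<bar> + \<bar>m\<bar> * measure lborel J)"
      proof (rule sum_mono)
        fix J assume J: "J \<in> D"
        have "g (Sup J) - g (Inf J) = (f (Sup J) - f (Inf J)) - m * measure lborel J"
          by (simp add: g_def len[OF J, symmetric] algebra_simps)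
        then show "\<bar>g (Sup J) - g (Inf J)\<bar> \<le> \<bar>f (Sup J) - f (Inf J)\<bar> + \<bar>m\<bar> * measure lborel J"
          using abs_triangle_ineq4[of "f (Sup J) - f (Inf J)" "m * measure lborel J"] by (simp add: abs_mult)
      qed
      also have "\<dots> \<le> M + \<bar>m\<bar> * measure lborel {a..b}"
        unfolding sum.distrib sum_distrib_left[symmetric]
        using bv[OF D] subadditive_content_division[OF D(1), of a b] D(2)
        by (intro add_mono mult_left_mono) (auto simp: box_real)
      finally show "(\<Sum>J\<in>D. \<bar>g (Sup J) - g (Inf J)\<bar>) \<le> M + \<bar>m\<bar> * measure lborel {a..b}" .
    next
      fix s x d :: real assume s: "s = 1 \<or> s = -1" and x: "x \<in> E i" and d: "0 < d"
      have "\<exists>u v. near x d u v \<and> s * (g v - g u) \<le> - c * (v - u)"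
        using s
      proof
        assume s: "s = 1"
        obtain u v where uv: "near x d u v" "f v - f u \<le> \<alpha> * (v - u)" using x d by (auto simp: E_def ab)
        then have "g v - g u \<le> - c * (v - u)" unfolding g_def am by (simp add: algebra_simps)
        then show ?thesis using uv s by auto
      next
        assume s: "s = -1"
        obtain u v where uv: "near x d u v" "\<beta> * (v - u) \<le> f v - f u" using x d by (auto simp: E_def ab)
        then have "- (g v - g u) \<le> - c * (v - u)" unfolding g_def am by (simp add: algebra_simps)
        then show ?thesis using uv s by auto
      qed
      then show "\<exists>u v. u \<le> x \<and> x \<le> v \<and> u < v \<and> v - u < d \<and> s * (g v - g u) \<le> - c * (v - u)"
        by (auto simp: near_def)
    qed
  qed
  moreover have "countable I"
    by (rule countable_subset[of _ "\<rat> \<times> \<rat>"]) (auto simp: I_def countable_rat)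
  ultimately have "negligible (U \<union> (\<Union>i\<in>I. E i))"
    by (intro negligible_Un negligible_countable_Union) auto
  moreover have "{x \<in> {a<..<b}. \<not> f differentiable (at x)} \<subseteq> U \<union> (\<Union>i\<in>I. E i)"
  proof
    fix x assume x: "x \<in> {x \<in> {a<..<b}. \<not> f differentiable (at x)}"
    show "x \<in> U \<union> (\<Union>i\<in>I. E i)"
    proof (rule ccontr)
      assume nx: "x \<notin> U \<union> (\<Union>i\<in>I. E i)"
      then obtain n d where nd: "0 < d" "\<And>u v. near x d u v \<Longrightarrow> \<bar>f v - f u\<bar> < n * (v - u)"
        using x unfolding U_def by (auto simp: not_le)
      have "f differentiable (at x)"
      proof (rule differentiable_of_quotient_bounds[OF nd(1), of x f n])
        fix \<alpha> \<beta> :: real assume "\<alpha> \<in> \<rat>" "\<beta> \<in> \<rat>" "\<alpha> < \<beta>"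
        then have "x \<notin> E (\<alpha>, \<beta>)" using nx by (auto simp: I_def)
        then obtain d where "0 < d" "(\<forall>u v. near x d u v \<longrightarrow> \<alpha> * (v - u) < f v - f u)
            \<or> (\<forall>u v. near x d u v \<longrightarrow> f v - f u < \<beta> * (v - u))"
          using x unfolding E_def by (auto simp: not_le)
        then show "\<exists>d>0. (\<forall>u v. u \<le> x \<and> x \<le> v \<and> u < v \<and> v - u < d \<longrightarrow> \<alpha> * (v - u) < f v - f u)
            \<or> (\<forall>u v. u \<le> x \<and> x \<le> v \<and> u < v \<and> v - u < d \<longrightarrow> f v - f u < \<beta> * (v - u))"
          unfolding near_def by blast
      qed (use nd(2) in \<open>force simp: near_def abs_less_iff\<close>)+
      then show False using x by simp
    qed
  qed
  ultimately show ?thesis by (rule negligible_subset)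
qed

section \<open>Fundamental theorem of calculus for absolutely continuous functions\<close>

lemma absolutely_continuous_onE:
  assumes "absolutely_continuous_on S G" "0 < e"
  obtains d where "0 < d" "\<And>D. D division_of \<Union>D \<Longrightarrow> \<Union>D \<subseteq> S \<Longrightarrow>
      (\<Sum>J\<in>D. Sup J - Inf J) < d \<Longrightarrow> (\<Sum>J\<in>D. norm (G (Sup J) - G (Inf J))) < e"
proof -
  have "\<exists>d>0. \<forall>D. D division_of \<Union>D \<and> \<Union>D \<subseteq> S \<and> (\<Sum>J\<in>D. Sup J - Inf J) < d
      \<longrightarrow> (\<Sum>J\<in>D. norm (G (Sup J) - G (Inf J))) < e"
    using assms unfolding absolutely_continuous_on_def by blast
  then show ?thesis using that by blast
qed

text \<open>Absolute continuity with \<open>e = 1\<close> bounds the variation by 1 on every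
  subinterval shorter than \<open>d\<close>, and countably many such intervals with rational
  endpoints cover the open interval. The result on bounded variation is applied on each of them to
  the two real components.\<close>

lemma absolutely_continuous_differentiable_ae:
  assumes ac: "absolutely_continuous_on {a..b} G"
  shows "negligible {x \<in> {a<..<b}. \<not> G differentiable (at x)}"
proof -
  obtain d where d: "0 < d" and ac1: "\<And>D. D division_of \<Union>D \<Longrightarrow> \<Union>D \<subseteq> {a..b} \<Longrightarrow>
      (\<Sum>J\<in>D. Sup J - Inf J) < d \<Longrightarrow> (\<Sum>J\<in>D. norm (G (Sup J) - G (Inf J))) < 1"
    by (rule absolutely_continuous_onE[OF ac zero_less_one]) blast
  define I where "I = {(u, v). u \<in> \<rat> \<and> v \<in> \<rat> \<and> {u..v} \<subseteq> {a..b} \<and> v - u < d}"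
  have comp: "negligible {x \<in> {u<..<v}. \<not> (\<lambda>x. G x \<bullet> i) differentiable (at x)}"
    if uv: "(u, v) \<in> I" and i: "i \<in> Basis" for u v and i :: complex
  proof (rule bounded_variation_differentiable_ae[where M = 1 and f = "\<lambda>x. G x \<bullet> i" and a = u and b = v])
    fix D assume D: "D division_of \<Union>D" "\<Union>D \<subseteq> {u..v}"
    have len: "Sup J - Inf J = measure lborel J" if "J \<in> D" for J
      using division_ofD(3,4)[OF D(1) that] by auto
    have "(\<Sum>J\<in>D. Sup J - Inf J) \<le> measure lborel (cbox u v)"
      using subadditive_content_division[OF D(1), of u v] D(2) by (simp add: len)
    also have "\<dots> < d"
      using uv d by (cases "u \<le> v") (auto simp: I_def)
    finally have "(\<Sum>J\<in>D. Sup J - Inf J) < d" .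
    moreover have "\<Union>D \<subseteq> {a..b}" using D(2) uv unfolding I_def by blast
    ultimately have "(\<Sum>J\<in>D. norm (G (Sup J) - G (Inf J))) < 1"
      using ac1[OF D(1)] by blast
    moreover have "(\<Sum>J\<in>D. \<bar>G (Sup J) \<bullet> i - G (Inf J) \<bullet> i\<bar>) \<le> (\<Sum>J\<in>D. norm (G (Sup J) - G (Inf J)))"
    proof (rule sum_mono)
      fix J
      show "\<bar>G (Sup J) \<bullet> i - G (Inf J) \<bullet> i\<bar> \<le> norm (G (Sup J) - G (Inf J))"
        using Basis_le_norm[OF i, of "G (Sup J) - G (Inf J)"] by (simp only: inner_diff_left)
    qed
    ultimately show "(\<Sum>J\<in>D. \<bar>G (Sup J) \<bullet> i - G (Inf J) \<bullet> i\<bar>) \<le> 1" by linarith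
  qed
  let ?N = "\<lambda>i p. {x \<in> {fst p<..<snd p}. \<not> (\<lambda>x. G x \<bullet> i) differentiable (at x)}"
  have "countable I"
    by (rule countable_subset[of _ "\<rat> \<times> \<rat>"]) (auto simp: I_def countable_rat)
  then have "negligible (\<Union>p\<in>I. \<Union>i\<in>Basis. ?N i p)"
  proof (rule negligible_countable_Union[OF countable_image], clarify)
    fix u v assume "(u, v) \<in> I"
    then have "negligible (?N i (u, v))" if "i \<in> Basis" for i
      using comp that by simp
    then show "negligible (\<Union>i\<in>Basis. ?N i (u, v))"
      by (intro negligible_Union finite_imageI finite_Basis) blast
  qed
  moreover have "{x \<in> {a<..<b}. \<not> G differentiable (at x)} \<subseteq> (\<Union>p\<in>I. \<Union>i\<in>Basis. ?N i p)"
  proof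
    fix x assume x: "x \<in> {x \<in> {a<..<b}. \<not> G differentiable (at x)}"
    obtain u where u: "u \<in> \<rat>" "max a (x - d / 2) < u" "u < x"
      using Rats_dense_in_real[of "max a (x - d / 2)" x] x d by auto
    obtain v where v: "v \<in> \<rat>" "x < v" "v < min b (x + d / 2)"
      using Rats_dense_in_real[of x "min b (x + d / 2)"] x d by auto
    have "(u, v) \<in> I" using u v by (auto simp: I_def)
    moreover obtain i where "i \<in> Basis" "\<not> (\<lambda>x. G x \<bullet> i) differentiable (at x)"
      using x differentiable_componentwise_within[of G x UNIV] by auto
    moreover have "x \<in> {fst (u, v)<..<snd (u, v)}" using u v by simp
    ultimately show "x \<in> (\<Union>p\<in>I. \<Union>i\<in>Basis. ?N i p)" by blast
  qed
  ultimately show ?thesis by (rule negligible_subset)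
qed

lemma absolutely_continuous_has_integral:
  assumes ab: "a \<le> b" and ac: "absolutely_continuous_on {a..b} G" and N: "negligible N"
    and der: "\<And>x. x \<in> {a..b} - N \<Longrightarrow> (G has_vector_derivative g x) (at x within {a..b})"
  shows "(g has_integral (G b - G a)) {a..b}"
proof -
  \<comment> \<open>With the integrand set to zero on \<open>N\<close>, a tag in \<open>N\<close>
    contributes only the increment of \<open>G\<close> over its interval.\<close>
  define g' where "g' = (\<lambda>x. if x \<in> N then 0 else g x)"
  have "(g' has_integral (G b - G a)) (cbox a b)"
    unfolding has_integral
  proof (intro allI impI)
    fix e :: real assume e: "0 < e"
    \<comment> \<open>The summand 1 keeps the denominator positive when
      \<open>a = b\<close>.\<close>
    define e' where "e' = e / (2 * (b - a + 1))"
    have e': "0 < e'" "e' * (b - a) \<le> e / 2"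
      using e ab by (auto simp: e'_def field_simps)
    obtain \<delta> where \<delta>: "0 < \<delta>" and acD: "\<And>D. D division_of \<Union>D \<Longrightarrow> \<Union>D \<subseteq> {a..b} \<Longrightarrow>
        (\<Sum>J\<in>D. Sup J - Inf J) < \<delta> \<Longrightarrow> (\<Sum>J\<in>D. norm (G (Sup J) - G (Inf J))) < e / 2"
      by (rule absolutely_continuous_onE[OF ac half_gt_zero[OF e]]) blast
    obtain O' where O': "open O'" "N \<subseteq> O'" "O' - N \<in> lmeasurable" "emeasure lebesgue (O' - N) < ennreal \<delta>"
      using sets_lebesgue_outer_open[OF negligible_imp_sets[OF N] \<delta>] by metis
    have nullN: "N \<in> null_sets lebesgue" using N by (simp add: negligible_iff_null_sets)
    have "(O' - N) \<union> N = O'" using O'(2) by blast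
    then have O'm: "O' \<in> lmeasurable" "measure lebesgue O' = measure lebesgue (O' - N)"
      using fmeasurable.Un[OF O'(3) negligible_imp_measurable[OF N]]
        measure_Un_null_set[OF fmeasurableD[OF O'(3)] nullN] by auto
    have O'd: "measure lebesgue O' < \<delta>"
      using O'(3,4) \<delta> by (simp add: O'm(2) emeasure_eq_measure2 ennreal_less_iff)
    have "\<forall>x. \<exists>d>0. x \<in> {a..b} - N \<longrightarrow>
         (\<forall>y\<in>{a..b}. norm (y-x) < d \<longrightarrow> norm (G y - G x - (y-x) *\<^sub>R g x) \<le> e' * norm (y-x))"
      using der[unfolded has_vector_derivative_def has_derivative_within_alt] e'(1) zero_less_one by meson
    then obtain d where d: "\<And>x. 0 < d x"
      "\<And>x y. \<lbrakk>x \<in> {a..b} - N; y \<in> {a..b}; norm (y-x) < d x\<rbrakk> \<Longrightarrow> norm (G y - G x - (y-x) *\<^sub>R g x) \<le> e' * norm (y-x)"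
      by metis
    define \<gamma> where "\<gamma> = (\<lambda>x. if x \<in> N then O' else ball x (d x))"
    have gauge: "gauge \<gamma>" using O' d(1) by (auto simp: gauge_def \<gamma>_def)
    have fine: "norm ((\<Sum>(x,K)\<in>p. measure lborel K *\<^sub>R g' x) - (G b - G a)) < e"
      if p: "p tagged_division_of cbox a b" "\<gamma> fine p" for p
    proof -
      define h where "h = (\<lambda>(x,K). measure lborel K *\<^sub>R g' x - (G (Sup K) - G (Inf K)))"
      have finp: "finite p" using p(1) by (rule tagged_division_of_finite)
      have K: "\<exists>u v. K = {u..v} \<and> u \<le> v \<and> u \<in> {a..b} \<and> v \<in> {a..b} \<and> x \<in> {u..v}" if xK: "(x, K) \<in> p" for x K
      proof -
        obtain u v where "K = cbox u v" "x \<in> K" "K \<subseteq> cbox a b"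
          using tagged_division_ofD(2-4)[OF p(1) xK] by blast
        then show ?thesis by (intro exI[of _ u] exI[of _ v]) auto
      qed
      have tel: "(\<Sum>(x,K)\<in>p. F (Sup K) - F (Inf K)) = F b - F a" for F :: "real \<Rightarrow> 'z::real_normed_vector"
        using additive_tagged_division_1[OF ab, of p F] p(1) by simp
      have eq: "(\<Sum>(x,K)\<in>p. measure lborel K *\<^sub>R g' x) - (G b - G a) = sum h p"
        unfolding tel[of G, symmetric] h_def by (simp add: sum_subtractf split_beta)
      define q where "q = {t \<in> p. fst t \<in> N}"
      have q: "q \<subseteq> p" "finite q" using finp by (auto simp: q_def)
      have 1: "norm (sum h (p - q)) \<le> e / 2"
      proof -
        have "norm (sum h (p - q)) \<le> (\<Sum>(x,K)\<in>p - q. e' * (Sup K - Inf K))"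
        proof (rule sum_norm_le, clarify)
          fix x K assume xK: "(x, K) \<in> p" "(x, K) \<notin> q"
          then have xN: "x \<notin> N" by (auto simp: q_def)
          obtain u v where uv: "K = {u..v}" "u \<le> v" "u \<in> {a..b}" "v \<in> {a..b}" "x \<in> {u..v}"
            using K[OF xK(1)] by blast
          have "K \<subseteq> ball x (d x)" using p(2) xK(1) xN unfolding fine_def \<gamma>_def by fastforce
          then have "u \<in> ball x (d x)" "v \<in> ball x (d x)" using uv(1,2) by (auto simp del: mem_ball)
          then have uvx: "norm (G u - G x - (u - x) *\<^sub>R g x) \<le> e' * norm (u - x)"
               "norm (G v - G x - (v - x) *\<^sub>R g x) \<le> e' * norm (v - x)"
            using uv xN by (intro d(2); auto simp: dist_real_def)+
          \<comment> \<open>Both endpoints are compared with the tag. As \<open>x\<close> lies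
            between them, the two error bounds add up to \<open>e'\<close> times the length of
            \<open>K\<close>.\<close>
          have hx: "h (x, K) = (G u - G x - (u - x) *\<^sub>R g x) - (G v - G x - (v - x) *\<^sub>R g x)"
            using uv xN by (simp add: h_def g'_def algebra_simps)
          have "norm (h (x, K)) \<le> e' * norm (u - x) + e' * norm (v - x)"
            unfolding hx by (rule order_trans[OF norm_triangle_ineq4 add_mono[OF uvx]])
          also have "\<dots> = e' * (v - u)" using uv by (simp add: algebra_simps)
          finally show "norm (h (x, K)) \<le> e' * (Sup K - Inf K)" using uv by simp
        qed
        also have "\<dots> \<le> (\<Sum>(x,K)\<in>p. e' * (Sup K - Inf K))"
        proof (rule sum_mono2[OF finp])
          fix t assume "t \<in> p - (p - q)"
          then obtain x L where t: "t = (x, L)" "(x, L) \<in> p" by (cases t) auto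
          obtain u v where "L = {u..v}" "u \<le> v" using K[OF t(2)] by blast
          then show "0 \<le> (case t of (x, K) \<Rightarrow> e' * (Sup K - Inf K))"
            using e'(1) t(1) by simp
        qed blast
        also have "\<dots> = e' * (b - a)"
          using tel[of "\<lambda>x. x"] by (simp add: sum_distrib_left[symmetric] split_beta)
        finally show ?thesis using e'(2) by linarith
      qed
      have 2: "norm (sum h q) < e / 2"
      proof -
        define D where "D = snd ` q"
        have "q tagged_partial_division_of cbox a b"
          using p(1) q(1) unfolding tagged_division_of_def by (blast intro: tagged_partial_division_subset)
        then have tq: "q tagged_division_of (\<Union>(snd ` q))"
          by (rule tagged_partial_division_of_Union_self)
        then have D: "D division_of \<Union>D" unfolding D_def by (rule division_of_tagged_division)
        have DI: "\<exists>u v. J = {u..v} \<and> u \<le> v \<and> u \<in> {a..b} \<and> v \<in> {a..b} \<and> J \<subseteq> O'" if J: "J \<in> D" for J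
        proof -
          obtain x where x: "(x, J) \<in> p" "x \<in> N" using J by (auto simp: D_def q_def)
          then have "J \<subseteq> O'" using p(2) unfolding fine_def \<gamma>_def by fastforce
          then show ?thesis using K[OF x(1)] by blast
        qed
        have DJ: "Sup J - Inf J = measure lebesgue J" "J \<noteq> {}" "J \<subseteq> {a..b}" "J \<subseteq> O'" if J: "J \<in> D" for J
          using DI[OF J] by auto
        have "(\<Sum>J\<in>D. Sup J - Inf J) = (\<Sum>J\<in>D. measure lebesgue J)"
          using DJ(1) by (rule sum.cong[OF refl])
        also have "\<dots> = measure lebesgue (\<Union>D)" by (rule content_division[OF D])
        also have "\<dots> \<le> measure lebesgue O'"
          using DJ(4) lmeasurable_division[OF D] O'm(1)
          by (intro measure_mono_fmeasurable[OF Union_least]) (auto simp: fmeasurableD)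
        also have "\<dots> < \<delta>" by (rule O'd)
        finally have "(\<Sum>J\<in>D. norm (G (Sup J) - G (Inf J))) < e / 2"
          using acD[OF D Union_least] DJ(3) by blast
        \<comment> \<open>Passing from tagged pairs to intervals requires a summand that vanishes on
          every box with empty interior, the empty box included; \<open>Sup\<close> and
          \<open>Inf\<close> say nothing useful there, hence the explicit 0.\<close>
        moreover have "norm (sum h q) \<le> (\<Sum>(x,K)\<in>q. if K = {} then 0 else norm (G (Sup K) - G (Inf K)))"
        proof (rule sum_norm_le, clarify)
          fix x K assume xK: "(x, K) \<in> q"
          then have "K \<noteq> {}" using DJ(2)[of K] by (force simp: D_def)
          then show "norm (h (x, K)) \<le> (if K = {} then 0 else norm (G (Sup K) - G (Inf K)))"
            using xK by (simp add: h_def g'_def q_def norm_minus_commute)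
        qed
        moreover have "\<dots> = (\<Sum>K\<in>D. if K = {} then 0 else norm (G (Sup K) - G (Inf K)))"
          unfolding D_def by (rule sum.over_tagged_division_lemma[OF tq]) (auto split: if_splits)
        moreover have "\<dots> = (\<Sum>J\<in>D. norm (G (Sup J) - G (Inf J)))"
          using DJ(2) by (intro sum.cong refl) simp
        ultimately show ?thesis by linarith
      qed
      have "sum h p = sum h q + sum h (p - q)"
        using finp q(1) by (metis add.commute sum.subset_diff)
      then have "norm (sum h p) \<le> norm (sum h q) + norm (sum h (p - q))"
        by (simp only: norm_triangle_ineq)
      then have "norm (sum h p) < e"
        using 1 2 by linarith
      then show ?thesis by (simp add: eq)
    qed
    show "\<exists>\<gamma>. gauge \<gamma> \<and> (\<forall>\<D>. \<D> tagged_division_of cbox a b \<and> \<gamma> fine \<D> \<longrightarrow>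
        norm ((\<Sum>(x,k)\<in>\<D>. measure lborel k *\<^sub>R g' x) - (G b - G a)) < e)"
      by (intro exI[of _ \<gamma>] conjI gauge allI impI) (elim conjE, rule fine)
  qed
  then have "(g has_integral (G b - G a)) (cbox a b)"
    by (rule has_integral_spike[OF N, rotated]) (auto simp: g'_def)
  then show ?thesis by simp
qed

text \<open>The gauge integral yields measurability and the value \<open>G b - G a\<close> before
  absolute integrability is known. If the integral of the norm is infinite, the inequality is
  trivial; otherwise \<open>g\<close> is Lebesgue integrable, the two integrals agree, and the usual
  norm bound applies.\<close>

lemma absolutely_continuous_deriv:
  fixes G :: "real \<Rightarrow> complex"
  assumes ab: "a \<le> b" and I: "open I" "{a..b} \<subseteq> I" and ac: "absolutely_continuous_on {a..b} G"
  defines "g \<equiv> \<lambda>x. vector_derivative G (at x within I)"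
  shows "g \<in> borel_measurable (lebesgue_on {a..b})"
    and "ennreal (norm (G b - G a)) \<le> (\<integral>\<^sup>+x\<in>{a..b}. ennreal (norm (g x)) \<partial>lebesgue)"
proof -
  \<comment> \<open>The endpoints join the exceptional set because differentiability is known inside
    the interval only.\<close>
  let ?N = "{x \<in> {a<..<b}. \<not> G differentiable (at x)} \<union> {a, b}"
  have "(g has_integral (G b - G a)) {a..b}"
  proof (rule absolutely_continuous_has_integral[OF ab ac])
    show "negligible ?N"
      using absolutely_continuous_differentiable_ae[OF ac] by (intro negligible_Un) auto
    fix x assume x: "x \<in> {a..b} - ?N"
    then have "G differentiable (at x)" by auto
    then have "(G has_vector_derivative vector_derivative G (at x)) (at x)"
      by (rule vector_derivative_works[THEN iffD1])
    moreover have "at x within I = at x" using I x by (intro at_within_open) auto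
    ultimately show "(G has_vector_derivative g x) (at x within {a..b})"
      by (simp add: g_def has_vector_derivative_at_within)
  qed
  then have gi: "g integrable_on {a..b}" "integral {a..b} g = G b - G a"
    by (auto simp: has_integral_integrable integral_unique)
  show gm: "g \<in> borel_measurable (lebesgue_on {a..b})"
    using gi(1) by (rule integrable_imp_measurable)
  define h where "h = (\<lambda>x. indicat_real {a..b} x *\<^sub>R g x)"
  have hm: "h \<in> borel_measurable lebesgue"
    unfolding h_def using borel_measurable_restrict_space_iff[THEN iffD1, OF _ gm] by simp
  have eq: "(\<integral>\<^sup>+x\<in>{a..b}. ennreal (norm (g x)) \<partial>lebesgue) = (\<integral>\<^sup>+x. ennreal (norm (h x)) \<partial>lebesgue)"
    by (intro nn_integral_cong) (auto simp: h_def indicator_def)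
  show "ennreal (norm (G b - G a)) \<le> (\<integral>\<^sup>+x\<in>{a..b}. ennreal (norm (g x)) \<partial>lebesgue)"
  proof (cases "(\<integral>\<^sup>+x. ennreal (norm (h x)) \<partial>lebesgue) = \<infinity>")
    case False
    then have hi: "integrable lebesgue h"
      using hm by (intro integrableI_bounded) (auto simp: less_top)
    then have "set_integrable lebesgue {a..b} g" by (simp add: set_integrable_def h_def)
    from set_lebesgue_integral_eq_integral(2)[OF this] have "integral\<^sup>L lebesgue h = G b - G a"
      unfolding set_lebesgue_integral_def h_def[symmetric] gi(2) .
    then show ?thesis using integral_norm_bound_ennreal[OF hi] by (simp add: eq)
  qed (simp add: eq)
qed

section \<open>Derivatives relative to an open interval\<close>

lemma deriv_on_Suc: "deriv_on I (Suc j) F = (\<lambda>x. vector_derivative (deriv_on I j F) (at x within I))"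
  by (simp add: deriv_on_def)

lemma deriv_on_0 [simp]: "deriv_on I 0 F = F"
  by (simp add: deriv_on_def)

lemma sobolev_has_deriv:
  assumes "sobolev_regular r I F" "open I" "Suc j < r" "x \<in> I"
  shows "(deriv_on I j F has_vector_derivative deriv_on I (Suc j) F x) (at x)"
proof -
  have "j < r - 1" using assms(3) by simp
  then have "deriv_on I j F differentiable (at x within I)"
    using assms(1,4) unfolding sobolev_regular_def by blast
  then have "(deriv_on I j F has_vector_derivative deriv_on I (Suc j) F x) (at x within I)"
    unfolding deriv_on_Suc by (rule vector_derivative_works[THEN iffD1])
  then show ?thesis
    using at_within_open[OF assms(4,2)] by simp
qed

lemma sobolev_top_deriv:
  assumes "sobolev_regular r I F" "open I" "1 \<le> r" "a \<le> b" "{a..b} \<subseteq> I"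
  shows "deriv_on I r F \<in> borel_measurable (lebesgue_on {a..b})"
    and "ennreal (norm (deriv_on I (r - 1) F b - deriv_on I (r - 1) F a))
           \<le> (\<integral>\<^sup>+x\<in>{a..b}. ennreal (norm (deriv_on I r F x)) \<partial>lebesgue)"
proof -
  have ac: "absolutely_continuous_on {a..b} (deriv_on I (r - 1) F)"
    using assms(1,5) unfolding sobolev_regular_def locally_absolutely_continuous_on_def by blast
  have "Suc (r - 1) = r" using assms(3) by simp
  then have eq: "deriv_on I r F = (\<lambda>x. vector_derivative (deriv_on I (r - 1) F) (at x within I))"
    using deriv_on_Suc[of I "r - 1" F] by simp
  show "deriv_on I r F \<in> borel_measurable (lebesgue_on {a..b})"
    "ennreal (norm (deriv_on I (r - 1) F b - deriv_on I (r - 1) F a))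
           \<le> (\<integral>\<^sup>+x\<in>{a..b}. ennreal (norm (deriv_on I r F x)) \<partial>lebesgue)"
    unfolding eq by (rule absolutely_continuous_deriv[OF assms(4,2,5) ac])+
qed

section \<open>Divided differences\<close>

lemma divdiff_Cons_snoc:
  "divdiff f (x # ys @ [z]) = (divdiff f (ys @ [z]) - divdiff f (x # ys)) / of_real (z - x)"
proof (cases ys)
  case (Cons y zs)
  then show ?thesis by (simp add: butlast_append)
qed simp

text \<open>The recursion drops the last node in one term and the first in the other, so the
  induction step has to expose both ends of the list.\<close>

lemma divdiff_induct [consumes 1, case_names single Cons_snoc]:
  assumes "xs \<noteq> []" and single: "\<And>x. P [x]"
    and step: "\<And>x ys z. P (ys @ [z]) \<Longrightarrow> P (x # ys) \<Longrightarrow> P (x # ys @ [z])"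
  shows "P xs"
  using assms(1)
proof (induction "length xs" arbitrary: xs rule: less_induct)
  case less
  then obtain x ws where xs: "xs = x # ws" by (cases xs) auto
  show ?case
  proof (cases ws rule: rev_cases)
    case Nil
    then show ?thesis using xs single by simp
  next
    case (snoc ys z)
    then show ?thesis using xs less.hyps step by simp
  qed
qed

lemma divdiff_cong:
  assumes "\<And>x. x \<in> set xs \<Longrightarrow> f x = g x"
  shows "divdiff f xs = divdiff g xs"
proof (cases "xs = []")
  case False
  then show ?thesis using assms
  proof (induction xs rule: divdiff_induct)
    case (Cons_snoc x ys z)
    have "divdiff f (ys @ [z]) = divdiff g (ys @ [z])"
      by (rule Cons_snoc.IH(1)) (use Cons_snoc.prems in auto)
    moreover have "divdiff f (x # ys) = divdiff g (x # ys)"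
      by (rule Cons_snoc.IH(2)) (use Cons_snoc.prems in auto)
    ultimately show ?case by (simp only: divdiff_Cons_snoc)
  qed simp
qed simp

text \<open>Each level of the recursion at most doubles the numerator and divides by a distance of
  at least \<open>\<delta>\<close>; there are \<open>length xs - 1\<close> levels.\<close>

lemma divdiff_bound:
  assumes "xs \<noteq> []" "0 < \<delta>"
    and "sorted_wrt (\<lambda>x y. x + \<delta> \<le> y) xs" and "\<And>x. x \<in> set xs \<Longrightarrow> norm (f x) \<le> m"
  shows "norm (divdiff f xs) \<le> (2 / \<delta>) ^ (length xs - 1) * m"
  using assms(1,3,4)
proof (induction xs rule: divdiff_induct)
  case (Cons_snoc x ys z)
  let ?B = "(2 / \<delta>) ^ length ys * m"
  have d: "\<delta> \<le> z - x" using Cons_snoc.prems(1) by (auto simp: sorted_wrt_append)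
  have "norm (divdiff f (ys @ [z])) \<le> ?B" "norm (divdiff f (x # ys)) \<le> ?B"
    using Cons_snoc by (auto simp: sorted_wrt_append)
  then have le: "norm (divdiff f (ys @ [z]) - divdiff f (x # ys)) \<le> 2 * ?B"
    using norm_triangle_ineq4[of "divdiff f (ys @ [z])" "divdiff f (x # ys)"] by linarith
  have "norm (complex_of_real (z - x)) = z - x"
    using d \<open>0 < \<delta>\<close> by (simp only: norm_of_real)
  then have "norm (divdiff f (x # ys @ [z])) \<le> 2 * ?B / \<delta>"
    unfolding divdiff_Cons_snoc norm_divide using d \<open>0 < \<delta>\<close> le order_trans[OF norm_ge_zero le]
    by (simp only: frac_le)
  then show ?case by simp
qed simp

text \<open>Neville's recursion runs parallel to that of the divided differences, which therefore are the
  leading coefficients of the interpolation polynomials.\<close>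

lemma interpolation_poly:
  assumes \<phi>: "bounded_linear (\<phi> :: complex \<Rightarrow> real)"
    and "xs \<noteq> []" "sorted_wrt (<) xs"
  shows "\<exists>p. degree p \<le> length xs - 1 \<and> coeff p (length xs - 1) = \<phi> (divdiff f xs) \<and>
             (\<forall>x\<in>set xs. poly p x = \<phi> (f x))"
  using assms(2,3)
proof (induction xs rule: divdiff_induct)
  case (single x)
  show ?case by (intro exI[of _ "[:\<phi> (f x):]"]) simp
next
  case (Cons_snoc x ys z)
  let ?n = "length ys"
  have xz: "x < z" using Cons_snoc.prems by (auto simp: sorted_wrt_append)
  obtain p where p: "degree p \<le> ?n" "coeff p ?n = \<phi> (divdiff f (ys @ [z]))"
      "\<forall>w\<in>set (ys @ [z]). poly p w = \<phi> (f w)"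
    using Cons_snoc by (auto simp: sorted_wrt_append)
  obtain q where q: "degree q \<le> ?n" "coeff q ?n = \<phi> (divdiff f (x # ys))"
      "\<forall>w\<in>set (x # ys). poly q w = \<phi> (f w)"
    using Cons_snoc by (auto simp: sorted_wrt_append)
  let ?c = "1 / (z - x)"
  \<comment> \<open>At a node common to both interpolants the two factors combine to
    \<open>z - x\<close>; at \<open>x\<close> or \<open>z\<close> the interpolant that misses this
    node is multiplied by zero.\<close>
  define s where "s = smult ?c ([:- x, 1:] * p - [:- z, 1:] * q)"
  have deg: "degree ([:- w, 1:] * u) \<le> Suc ?n" if "degree u \<le> ?n" for w and u :: "real poly"
    using degree_mult_le[of "[:- w, 1:]" u] that by simp
  have "degree s \<le> Suc ?n"
    unfolding s_def using deg p(1) q(1) by (meson degree_diff_le degree_smult_le le_trans)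
  moreover have "coeff s (Suc ?n) = \<phi> (divdiff f (x # ys @ [z]))"
  proof -
    have "coeff p (Suc ?n) = 0" "coeff q (Suc ?n) = 0"
      using p(1) q(1) by (auto intro: coeff_eq_0)
    then have "coeff s (Suc ?n) = ?c * (\<phi> (divdiff f (ys @ [z])) - \<phi> (divdiff f (x # ys)))"
      by (simp add: s_def p(2) q(2))
    also have "\<dots> = \<phi> (?c *\<^sub>R (divdiff f (ys @ [z]) - divdiff f (x # ys)))"
      by (simp only: linear_cmul[OF bounded_linear.linear[OF \<phi>]] linear_diff[OF bounded_linear.linear[OF \<phi>]] real_scaleR_def)
    also have "?c *\<^sub>R (divdiff f (ys @ [z]) - divdiff f (x # ys)) = divdiff f (x # ys @ [z])"
      unfolding divdiff_Cons_snoc by (simp add: scaleR_conv_of_real divide_inverse mult.commute)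
    finally show ?thesis .
  qed
  moreover have "poly s w = \<phi> (f w)" if w: "w \<in> set (x # ys @ [z])" for w
  proof -
    have *: "poly s w = ?c * ((w - x) * poly p w - (w - z) * poly q w)"
      by (simp add: s_def algebra_simps)
    consider "w = x" | "w = z" | "w \<in> set ys" using w by auto
    then show ?thesis
    proof cases
      case 3
      then have "poly s w = ?c * ((w - x) * \<phi> (f w) - (w - z) * \<phi> (f w))"
        using p(3) q(3) by (simp add: *)
      also have "\<dots> = ?c * ((z - x) * \<phi> (f w))" by (simp add: algebra_simps)
      finally show ?thesis using xz by simp
    next
      case 1
      then show ?thesis unfolding * using q(3) xz by (simp add: divide_simps) (simp add: algebra_simps)
    next
      case 2
      then show ?thesis unfolding * using p(3) xz by (simp add: divide_simps)
    qed
  qed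
  ultimately show ?case by (intro exI[of _ s]) simp
qed

text \<open>Rolle's theorem puts a zero of \<open>g 1\<close> strictly between neighbouring zeros of
  \<open>g 0\<close>. The shifted family together with these new points is the same situation for
  one order less.\<close>

lemma iterated_Rolle:
  fixes g :: "nat \<Rightarrow> real \<Rightarrow> real"
  assumes der: "\<And>i x. i < j \<Longrightarrow> z 0 \<le> x \<Longrightarrow> x \<le> z j \<Longrightarrow> (g i has_real_derivative g (Suc i) x) (at x)"
    and z: "\<And>i. i < j \<Longrightarrow> z i < z (Suc i)" and zero: "\<And>i. i \<le> j \<Longrightarrow> g 0 (z i) = 0"
  shows "\<exists>\<xi>. z 0 \<le> \<xi> \<and> \<xi> \<le> z j \<and> g j \<xi> = 0"
  using assms
proof (induction j arbitrary: g z)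
  case 0
  then show ?case by auto
next
  case (Suc j)
  have mono: "z i \<le> z k" if "i \<le> k" "k \<le> Suc j" for i k
    using that
  proof (induction k rule: dec_induct)
    case (step n)
    then show ?case using Suc.prems(2)[of n] by simp
  qed simp
  have "\<exists>y. z i < y \<and> y < z (Suc i) \<and> g 1 y = 0" if i: "i \<le> j" for i
  proof -
    have range: "z 0 \<le> x \<and> x \<le> z (Suc j)" if "z i \<le> x" "x \<le> z (Suc i)" for x
      using that mono[of 0 i] mono[of "Suc i" "Suc j"] i by auto
    have d: "(g 0 has_real_derivative g 1 x) (at x)" if "z i \<le> x" "x \<le> z (Suc i)" for x
      using Suc.prems(1)[of 0 x] range[OF that] by simp
    have "\<exists>y. z i < y \<and> y < z (Suc i) \<and> (\<lambda>v. g 1 y * v) = (\<lambda>v. 0)"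
    proof (rule Rolle_deriv)
      show "z i < z (Suc i)" using Suc.prems(2) i by simp
      show "g 0 (z i) = g 0 (z (Suc i))" using Suc.prems(3) i by simp
      show "continuous_on {z i..z (Suc i)} (g 0)"
        by (intro continuous_at_imp_continuous_on ballI DERIV_isCont[OF d]) auto
      show "(g 0 has_derivative (\<lambda>v. g 1 x * v)) (at x)" if "z i < x" "x < z (Suc i)" for x
        using d[of x] that by (simp add: has_field_derivative_def)
    qed
    then obtain y where "z i < y" "y < z (Suc i)" "(\<lambda>v. g 1 y * v) = (\<lambda>v. 0)" by blast
    moreover from fun_cong[OF this(3), of 1] have "g 1 y = 0" by simp
    ultimately show ?thesis by blast
  qed
  then obtain y where y: "\<And>i. i \<le> j \<Longrightarrow> z i < y i \<and> y i < z (Suc i) \<and> g 1 (y i) = 0"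
    by metis
  have "\<exists>\<xi>. y 0 \<le> \<xi> \<and> \<xi> \<le> y j \<and> g (Suc j) \<xi> = 0"
  proof (rule Suc.IH[of y "\<lambda>i. g (Suc i)"])
    show "(g (Suc i) has_real_derivative g (Suc (Suc i)) x) (at x)" if "i < j" "y 0 \<le> x" "x \<le> y j" for i x
      using Suc.prems(1)[of "Suc i" x] that y[of 0] y[of j] by auto
    show "y i < y (Suc i)" if "i < j" for i
      using y[of i] y[of "Suc i"] that by auto
  qed (use y in auto)
  moreover have "z 0 \<le> y 0" "y j \<le> z (Suc j)" using y[of 0] y[of j] by auto
  ultimately show ?case by (meson order_trans)
qed

text \<open>The difference between \<open>\<phi> (D 0 x)\<close> and its interpolation polynomial
  vanishes at all \<open>j + 1\<close> nodes, so its \<open>j\<close>-th derivative has a zero. The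
  \<open>j\<close>-th derivative of the polynomial is constant, equal to \<open>fact j\<close> times
  the leading coefficient. The point obtained depends on \<open>\<phi>\<close>: real and imaginary
  part need not share a mean value point.\<close>

lemma divdiff_mean_value:
  fixes D :: "nat \<Rightarrow> real \<Rightarrow> complex"
  assumes \<phi>: "bounded_linear (\<phi> :: complex \<Rightarrow> real)"
    and xs: "length xs = Suc j" "sorted_wrt (<) xs" "set xs \<subseteq> {a..b}"
    and der: "\<And>i x. i < j \<Longrightarrow> a \<le> x \<Longrightarrow> x \<le> b \<Longrightarrow> (D i has_vector_derivative D (Suc i) x) (at x)"
  shows "\<exists>\<xi>. a \<le> \<xi> \<and> \<xi> \<le> b \<and> \<phi> (D j \<xi>) = fact j * \<phi> (divdiff (D 0) xs)"
proof -
  have "xs \<noteq> []" using xs(1) by auto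
  from interpolation_poly[OF \<phi> this xs(2), of "D 0"]
  obtain p where p: "degree p \<le> j" "coeff p j = \<phi> (divdiff (D 0) xs)" "\<forall>x\<in>set xs. poly p x = \<phi> (D 0 x)"
    using xs(1) by auto
  define g where "g = (\<lambda>i x. \<phi> (D i x) - poly ((pderiv ^^ i) p) x)"
  have in_ab: "a \<le> xs ! i" "xs ! i \<le> b" if "i \<le> j" for i
  proof -
    have "xs ! i \<in> {a..b}" using xs(1,3) that by (intro subsetD[OF xs(3)] nth_mem) simp
    then show "a \<le> xs ! i" "xs ! i \<le> b" by auto
  qed
  have "\<exists>\<xi>. xs ! 0 \<le> \<xi> \<and> \<xi> \<le> xs ! j \<and> g j \<xi> = 0"
  proof (rule iterated_Rolle)
    fix i x assume i: "i < j" and x: "xs ! 0 \<le> x" "x \<le> xs ! j"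
    have "((\<lambda>x. \<phi> (D i x)) has_real_derivative \<phi> (D (Suc i) x)) (at x)"
      unfolding has_real_derivative_iff_has_vector_derivative
      by (rule bounded_linear.has_vector_derivative[OF \<phi>])
         (use der i x in_ab[of 0] in_ab[of j] in auto)
    then show "(g i has_real_derivative g (Suc i) x) (at x)"
      unfolding g_def by (auto intro!: derivative_eq_intros)
  next
    show "xs ! i < xs ! Suc i" if "i < j" for i
      using xs(1,2) that by (simp add: sorted_wrt_nth_less)
    show "g 0 (xs ! i) = 0" if "i \<le> j" for i
      using p(3) xs(1) that by (simp add: g_def)
  qed
  then obtain \<xi> where \<xi>: "xs ! 0 \<le> \<xi>" "\<xi> \<le> xs ! j" "g j \<xi> = 0" by blast
  have "degree ((pderiv ^^ j) p) = 0" using p(1) by (simp add: degree_higher_pderiv)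
  then have "poly ((pderiv ^^ j) p) \<xi> = coeff ((pderiv ^^ j) p) 0"
    by (auto elim!: degree_eq_zeroE)
  also have "\<dots> = fact j * coeff p j"
    by (simp add: coeff_higher_pderiv pochhammer_fact)
  finally have "\<phi> (D j \<xi>) = fact j * \<phi> (divdiff (D 0) xs)"
    using \<xi>(3) by (simp add: g_def p(2))
  then show ?thesis using \<xi> in_ab[of 0] in_ab[of j] by (meson order_trans le0 order_refl)
qed

section \<open>Local estimates\<close>

text \<open>Multiplication by the conjugate phase of \<open>w\<close> turns \<open>w\<close> into
  \<open>norm w\<close>; taking the real part gives a functional of norm at most 1. With
  \<open>w\<close> chosen as the quantity to be estimated, real mean value theorems yield bounds for
  complex functions without loss in the constant.\<close>

lemma phase_functional:
  obtains \<phi> :: "complex \<Rightarrow> real" where "bounded_linear \<phi>" "\<And>z. \<bar>\<phi> z\<bar> \<le> norm z" "\<phi> w = norm w"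
proof -
  define \<phi> where "\<phi> = (\<lambda>z. Re (cnj (sgn w) * z))"
  have "bounded_linear \<phi>"
    unfolding \<phi>_def by (intro bounded_linear_compose[OF bounded_linear_Re] bounded_linear_mult_right)
  moreover have "\<bar>\<phi> z\<bar> \<le> norm z" for z
  proof -
    have "\<bar>\<phi> z\<bar> \<le> norm (cnj (sgn w)) * norm z"
      unfolding \<phi>_def using abs_Re_le_cmod[of "cnj (sgn w) * z"] by (simp add: norm_mult)
    also have "\<dots> \<le> 1 * norm z"
      by (intro mult_right_mono) (simp_all add: norm_sgn)
    finally show ?thesis by simp
  qed
  moreover have "\<phi> w = norm w"
  proof (cases "w = 0")
    case False
    have "cnj (sgn w) * w = w * cnj w / of_real (norm w)"
      by (simp add: sgn_eq mult.commute)
    also have "\<dots> = of_real (norm w ^ 2) / of_real (norm w)"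
      by (simp only: complex_norm_square)
    finally have "cnj (sgn w) * w = of_real (norm w ^ 2 / norm w)" by simp
    then have "\<phi> w = Re (of_real (norm w ^ 2 / norm w))" unfolding \<phi>_def by (simp only:)
    then show ?thesis using False by (simp add: power2_eq_square)
  qed (simp add: \<phi>_def)
  ultimately show ?thesis by (rule that)
qed

lemma sobolev_top_osc:
  assumes F: "sobolev_regular r I F" "open I" "1 \<le> r" "{a..b} \<subseteq> I"
    and X: "(\<integral>\<^sup>+x\<in>{a..b}. ennreal (norm (deriv_on I r F x)) \<partial>lebesgue) \<le> ennreal X" "0 \<le> X"
    and st: "s \<in> {a..b}" "t \<in> {a..b}"
  shows "norm (deriv_on I (r - 1) F s - deriv_on I (r - 1) F t) \<le> X"
proof -
  have *: "norm (deriv_on I (r - 1) F v - deriv_on I (r - 1) F u) \<le> X"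
    if uv: "u \<in> {a..b}" "v \<in> {a..b}" "u \<le> v" for u v
  proof -
    have sub: "{u..v} \<subseteq> {a..b}" using uv by auto
    have "ennreal (norm (deriv_on I (r - 1) F v - deriv_on I (r - 1) F u))
        \<le> (\<integral>\<^sup>+x\<in>{u..v}. ennreal (norm (deriv_on I r F x)) \<partial>lebesgue)"
      using sub F(4) by (intro sobolev_top_deriv(2)[OF F(1-3) uv(3)]) blast
    also have "\<dots> \<le> (\<integral>\<^sup>+x\<in>{a..b}. ennreal (norm (deriv_on I r F x)) \<partial>lebesgue)"
      using sub by (intro nn_integral_mono mult_left_mono) (auto simp: indicator_def)
    also note X(1)
    finally show ?thesis using X(2) by (simp add: ennreal_le_iff)
  qed
  show ?thesis
    using *[of s t] *[of t s] st by (cases "s \<le> t") (auto simp: norm_minus_commute)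
qed

text \<open>The factor \<open>z - x\<close> cancels the last denominator and leaves a difference of
  two divided differences of order \<open>r - 1\<close>. Under \<open>\<phi>\<close> and up to a
  factorial both are values of the derivative of order \<open>r - 1\<close>, so an oscillation
  remains. Stopping at order \<open>r - 1\<close> avoids point values of the top derivative, which
  exists almost everywhere only.\<close>

lemma divdiff_top_bound:
  assumes F: "sobolev_regular r I F" "open I" "1 \<le> r" "{a..b} \<subseteq> I"
    and X: "(\<integral>\<^sup>+x\<in>{a..b}. ennreal (norm (deriv_on I r F x)) \<partial>lebesgue) \<le> ennreal X" "0 \<le> X"
    and xs: "length ys = r - 1" "sorted_wrt (<) (x # ys @ [z])" "set (x # ys @ [z]) \<subseteq> {a..b}"
  shows "norm (divdiff F (x # ys @ [z])) * (z - x) \<le> X"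
proof -
  let ?A = "divdiff F (ys @ [z])" and ?B = "divdiff F (x # ys)" and ?D = "deriv_on I (r - 1) F"
  obtain \<phi> :: "complex \<Rightarrow> real" where \<phi>: "bounded_linear \<phi>" "\<And>z. \<bar>\<phi> z\<bar> \<le> norm z" "\<phi> (?A - ?B) = norm (?A - ?B)"
    using phase_functional[of "?A - ?B"] by metis
  have der: "(deriv_on I i F has_vector_derivative deriv_on I (Suc i) F x) (at x)"
    if "i < r - 1" "a \<le> x" "x \<le> b" for i x
    by (rule sobolev_has_deriv[OF F(1,2)]) (use that F(4) in auto)
  obtain \<xi> where \<xi>: "a \<le> \<xi>" "\<xi> \<le> b" "\<phi> (?D \<xi>) = fact (r - 1) * \<phi> ?A"
    using divdiff_mean_value[OF \<phi>(1), of "ys @ [z]" "r - 1" a b "\<lambda>i. deriv_on I i F"] xs der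
    by (auto simp: sorted_wrt_append)
  obtain \<eta> where \<eta>: "a \<le> \<eta>" "\<eta> \<le> b" "\<phi> (?D \<eta>) = fact (r - 1) * \<phi> ?B"
    using divdiff_mean_value[OF \<phi>(1), of "x # ys" "r - 1" a b "\<lambda>i. deriv_on I i F"] xs der
    by (auto simp: sorted_wrt_append)
  note lin = linear_diff[OF bounded_linear.linear[OF \<phi>(1)]]
  have "norm (?A - ?B) = \<phi> ?A - \<phi> ?B" using \<phi>(3) by (simp add: lin)
  also have "\<dots> = (\<phi> (?D \<xi>) - \<phi> (?D \<eta>)) / fact (r - 1)"
    unfolding \<xi>(3) \<eta>(3) by (simp add: field_simps)
  also have "\<phi> (?D \<xi>) - \<phi> (?D \<eta>) = \<phi> (?D \<xi> - ?D \<eta>)" by (simp add: lin)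
  also have "\<phi> (?D \<xi> - ?D \<eta>) / fact (r - 1) \<le> X / fact (r - 1)"
  proof (rule divide_right_mono)
    have "norm (?D \<xi> - ?D \<eta>) \<le> X"
      by (rule sobolev_top_osc[OF F X]) (use \<xi>(1,2) \<eta>(1,2) in auto)
    with \<phi>(2)[of "?D \<xi> - ?D \<eta>"] show "\<phi> (?D \<xi> - ?D \<eta>) \<le> X" by linarith
  qed simp
  also have "\<dots> \<le> X / 1" using X(2) by (intro divide_left_mono) auto
  finally have le: "norm (?A - ?B) \<le> X" by simp
  have xz: "x < z" using xs(2) by auto
  then have "norm (complex_of_real (z - x)) = z - x" by (simp only: norm_of_real)
  then have "norm (divdiff F (x # ys @ [z])) * (z - x) = norm (?A - ?B)"
    unfolding divdiff_Cons_snoc norm_divide using xz by simp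
  then show ?thesis using le by simp
qed

text \<open>Downward induction on the order of the derivative: the mean value theorem for divided
  differences at well separated points produces one point where the derivative is under control.\<close>

lemma sobolev_deriv_bound:
  assumes F: "sobolev_regular r I F" "open I" "1 \<le> r" "{a..b} \<subseteq> I" "a < b"
    and X: "(\<integral>\<^sup>+x\<in>{a..b}. ennreal (norm (deriv_on I r F x)) \<partial>lebesgue) \<le> ennreal X" "0 \<le> X"
    and ts: "length ts = r" "sorted_wrt (\<lambda>x y. x + (b - a) / (2 * real r) \<le> y) ts" "set ts \<subseteq> {a..b}"
    and m: "\<And>t. t \<in> set ts \<Longrightarrow> norm (F t) \<le> m" "0 \<le> m"
    and k: "k < r" and \<xi>: "\<xi> \<in> {a..b}"
  shows "(b - a) ^ (r - 1 - k) * norm (deriv_on I (r - 1 - k) F \<xi>)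
          \<le> real (Suc k) * (fact r * (4 * real r) ^ r * m + (b - a) ^ (r - 1) * X)"
  using k \<xi>
proof (induction k arbitrary: \<xi>)
  define d where "d = b - a"
  have d: "0 < d" using F(5) by (simp add: d_def)
  \<comment> \<open>\<open>Q\<close> bounds the derivative of order \<open>r - 1\<close>, scaled by
    \<open>d ^ (r - 1)\<close>: one part from the values at \<open>ts\<close>, one from the
    oscillation. Going down one order, moving by at most \<open>d\<close> costs the previous scaled
    bound and reaching a controlled point costs at most another \<open>Q\<close>; hence the factor
    \<open>Suc k\<close>.\<close>
  define Q where "Q = fact r * (4 * real r) ^ r * m + d ^ (r - 1) * X"
  \<comment> \<open>The mean value theorem for the first \<open>j + 1\<close> points of
    \<open>ts\<close> provides \<open>\<eta>\<close>, where the functional of the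
    \<open>j\<close>-th derivative is \<open>fact j\<close> times that of a divided difference. The
    points being separated by \<open>d / (2 * real r)\<close>, scaling by \<open>d ^ j\<close>
    leaves powers of \<open>4 * real r\<close>.\<close>
  have near: "\<exists>\<phi> \<eta>. bounded_linear \<phi> \<and> (\<forall>z. \<bar>\<phi> z\<bar> \<le> norm z) \<and> \<eta> \<in> {a..b} \<and>
      d ^ j * norm (deriv_on I j F \<xi>) \<le> d ^ j * \<bar>\<phi> (deriv_on I j F \<xi> - deriv_on I j F \<eta>)\<bar>
         + fact r * (4 * real r) ^ r * m"
    if j: "j < r" for j \<xi>
  proof -
    let ?xs = "take (Suc j) ts" and ?\<delta> = "(b - a) / (2 * real r)"
    obtain \<phi> :: "complex \<Rightarrow> real" where \<phi>: "bounded_linear \<phi>" "\<And>z. \<bar>\<phi> z\<bar> \<le> norm z"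
      "\<phi> (deriv_on I j F \<xi>) = norm (deriv_on I j F \<xi>)"
      using phase_functional[of "deriv_on I j F \<xi>"] by metis
    have \<delta>: "0 < ?\<delta>" using F(3,5) by simp
    have len: "length ?xs = Suc j" using j ts(1) by simp
    have sub: "set ?xs \<subseteq> set ts" by (rule set_take_subset)
    have sor: "sorted_wrt (\<lambda>x y. x + ?\<delta> \<le> y) ?xs" using ts(2) by (rule sorted_wrt_take)
    have der: "(deriv_on I i F has_vector_derivative deriv_on I (Suc i) F x) (at x)"
      if "i < j" "a \<le> x" "x \<le> b" for i x
      by (rule sobolev_has_deriv[OF F(1,2)]) (use that F(4) j in auto)
    have "sorted_wrt (<) ?xs"
      by (rule sorted_wrt_mono_rel[OF _ sor]) (use \<delta> in linarith)
    from divdiff_mean_value[OF \<phi>(1) len this order_trans[OF sub ts(3)], of "\<lambda>i. deriv_on I i F"] der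
    obtain \<eta> where \<eta>: "a \<le> \<eta>" "\<eta> \<le> b" "\<phi> (deriv_on I j F \<eta>) = fact j * \<phi> (divdiff F ?xs)"
      by auto
    have "norm (divdiff F ?xs) \<le> (2 / ?\<delta>) ^ (length ?xs - 1) * m"
      by (rule divdiff_bound[OF _ \<delta> sor]) (use len sub m(1) in auto)
    then have dd: "norm (divdiff F ?xs) \<le> (2 / ?\<delta>) ^ j * m" using len by simp
    have "d ^ j * (fact j * ((2 / ?\<delta>) ^ j * m)) = fact j * (d * (2 / ?\<delta>)) ^ j * m"
      by (simp only: power_mult_distrib mult_ac)
    also have "d * (2 / ?\<delta>) = 4 * real r" using d by (simp add: d_def field_simps)
    also have "fact j * (4 * real r) ^ j * m \<le> fact r * (4 * real r) ^ r * m"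
      using j F(3) m(2) by (intro mult_right_mono mult_mono fact_mono power_increasing) auto
    finally have fin: "d ^ j * (fact j * ((2 / ?\<delta>) ^ j * m)) \<le> fact r * (4 * real r) ^ r * m" .
    have "norm (deriv_on I j F \<xi>) = \<phi> (deriv_on I j F \<xi> - deriv_on I j F \<eta>) + \<phi> (deriv_on I j F \<eta>)"
      using \<phi>(3) by (simp add: linear_diff[OF bounded_linear.linear[OF \<phi>(1)]])
    also have "\<phi> (deriv_on I j F \<eta>) \<le> fact j * ((2 / ?\<delta>) ^ j * m)"
      unfolding \<eta>(3) using \<phi>(2)[of "divdiff F ?xs"] dd by (intro mult_left_mono) auto
    finally have "norm (deriv_on I j F \<xi>) \<le> \<bar>\<phi> (deriv_on I j F \<xi> - deriv_on I j F \<eta>)\<bar> + fact j * ((2 / ?\<delta>) ^ j * m)"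
      by linarith
    then have "d ^ j * norm (deriv_on I j F \<xi>)
        \<le> d ^ j * (\<bar>\<phi> (deriv_on I j F \<xi> - deriv_on I j F \<eta>)\<bar> + fact j * ((2 / ?\<delta>) ^ j * m))"
      using d by (intro mult_left_mono) auto
    also have "\<dots> \<le> d ^ j * \<bar>\<phi> (deriv_on I j F \<xi> - deriv_on I j F \<eta>)\<bar> + fact r * (4 * real r) ^ r * m"
      using fin by (simp add: distrib_left)
    finally show ?thesis
      using \<phi>(1,2) \<eta>(1,2) by (intro exI[of _ \<phi>] exI[of _ \<eta>]) simp
  qed
  have Q0: "0 \<le> d ^ (r - 1) * X" "0 \<le> fact r * (4 * real r) ^ r * m" using d X(2) m(2) by auto
  {
    case 0
    obtain \<phi> :: "complex \<Rightarrow> real" and \<eta> where *: "\<forall>z. \<bar>\<phi> z\<bar> \<le> norm z" "\<eta> \<in> {a..b}"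
      "d ^ (r - 1) * norm (deriv_on I (r - 1) F \<xi>)
         \<le> d ^ (r - 1) * \<bar>\<phi> (deriv_on I (r - 1) F \<xi> - deriv_on I (r - 1) F \<eta>)\<bar> + fact r * (4 * real r) ^ r * m"
      using near[of "r - 1" \<xi>] F(3) by auto
    have "\<bar>\<phi> (deriv_on I (r - 1) F \<xi> - deriv_on I (r - 1) F \<eta>)\<bar> \<le> X"
      using *(1) sobolev_top_osc[OF F(1-4) X 0(2) *(2)] by (meson order_trans)
    then have "d ^ (r - 1) * \<bar>\<phi> (deriv_on I (r - 1) F \<xi> - deriv_on I (r - 1) F \<eta>)\<bar> \<le> d ^ (r - 1) * X"
      using d by (intro mult_left_mono) auto
    then show ?case using *(3) by (simp add: d_def)
  next
    case (Suc k)
    define j where "j = r - 1 - Suc k"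
    have j: "Suc j = r - 1 - k" "Suc j < r" using Suc.prems(1) by (auto simp: j_def)
    obtain \<phi> :: "complex \<Rightarrow> real" and \<eta> where *: "bounded_linear \<phi>" "\<And>z. \<bar>\<phi> z\<bar> \<le> norm z" "\<eta> \<in> {a..b}"
      "d ^ j * norm (deriv_on I j F \<xi>)
         \<le> d ^ j * \<bar>\<phi> (deriv_on I j F \<xi> - deriv_on I j F \<eta>)\<bar> + fact r * (4 * real r) ^ r * m"
      using near[of j \<xi>] j(2) by (metis Suc_lessD)
    let ?B = "real (Suc k) * Q / d ^ Suc j"
    have bnd: "norm (deriv_on I (Suc j) F x) \<le> ?B" if "x \<in> {a..b}" for x
    proof -
      have "d ^ Suc j * norm (deriv_on I (Suc j) F x) \<le> real (Suc k) * Q"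
        using Suc.IH[of x] Suc.prems(1) that by (simp add: j(1) d_def Q_def)
      then show ?thesis using d by (simp add: field_simps)
    qed
    have "norm (\<phi> (deriv_on I j F \<xi>) - \<phi> (deriv_on I j F \<eta>)) \<le> ?B * norm (\<xi> - \<eta>)"
    proof (rule field_differentiable_bound[where S = "{a..b}"])
      fix x assume x: "x \<in> {a..b}"
      have "((\<lambda>x. \<phi> (deriv_on I j F x)) has_real_derivative \<phi> (deriv_on I (Suc j) F x)) (at x)"
        unfolding has_real_derivative_iff_has_vector_derivative
        by (rule bounded_linear.has_vector_derivative[OF *(1)], rule sobolev_has_deriv[OF F(1,2) j(2)])
           (use x F(4) in auto)
      then show "((\<lambda>x. \<phi> (deriv_on I j F x)) has_field_derivative \<phi> (deriv_on I (Suc j) F x)) (at x within {a..b})"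
        by (rule has_field_derivative_at_within)
      show "norm (\<phi> (deriv_on I (Suc j) F x)) \<le> ?B"
        using *(2)[of "deriv_on I (Suc j) F x"] bnd[OF x] by simp
    qed (use Suc.prems(2) *(3) in auto)
    also have "\<dots> \<le> ?B * d"
    proof (rule mult_left_mono)
      show "norm (\<xi> - \<eta>) \<le> d" using Suc.prems(2) *(3) by (auto simp: d_def)
      show "0 \<le> ?B" using Q0 d by (simp add: Q_def)
    qed
    finally have "\<bar>\<phi> (deriv_on I j F \<xi> - deriv_on I j F \<eta>)\<bar> \<le> ?B * d"
      by (simp add: linear_diff[OF bounded_linear.linear[OF *(1)]])
    then have "d ^ j * \<bar>\<phi> (deriv_on I j F \<xi> - deriv_on I j F \<eta>)\<bar> \<le> d ^ j * (?B * d)"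
      using d by (intro mult_left_mono) auto
    also have "\<dots> = real (Suc k) * Q" using d by (simp add: field_simps)
    finally have "d ^ j * norm (deriv_on I j F \<xi>) \<le> real (Suc k) * Q + Q"
      using *(4) Q0 unfolding Q_def by linarith
    then show ?case by (simp add: j_def d_def Q_def algebra_simps)
  }
qed

text \<open>For \<open>t > s\<close> the negative or zero exponent gives
  \<open>t powr (1 - p) \<le> s powr (1 - p)\<close>. After integration the free parameter
  \<open>s\<close> makes this a substitute for Hoelder's inequality.\<close>

lemma young_pointwise:
  fixes t s p :: real
  assumes "0 \<le> t" "0 < s" "1 \<le> p"
  shows "t \<le> s + s powr (1 - p) * t powr p"
proof (cases "t \<le> s")
  case False
  then have t: "0 < t" "s \<le> t" using assms(2) by auto
  have "t = t powr (1 - p) * t powr p" using t(1) by (simp add: powr_add[symmetric])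
  also have "\<dots> \<le> s powr (1 - p) * t powr p"
    using t assms by (intro mult_right_mono powr_mono2') auto
  finally show ?thesis using assms(2) by linarith
qed (use assms in \<open>simp add: add_increasing2\<close>)

lemma nn_integral_norm_le_powr:
  fixes g :: "real \<Rightarrow> complex"
  assumes g: "g \<in> borel_measurable (lebesgue_on {a..b})" and ab: "a < b" and p: "1 \<le> p"
    and Z: "(\<integral>\<^sup>+x\<in>{a..b}. ennreal (norm (g x) powr p) \<partial>lebesgue) \<le> ennreal Z" "0 \<le> Z"
  shows "(\<integral>\<^sup>+x\<in>{a..b}. ennreal (norm (g x)) \<partial>lebesgue) \<le> ennreal (2 * (b - a) * (Z / (b - a)) powr (1 / p))"
proof -
  have meas: "(\<lambda>x. ennreal (norm (g x) powr p) * indicator {a..b} x) \<in> borel_measurable lebesgue"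
  proof -
    have "(\<lambda>x. ennreal (norm (g x) powr p)) \<in> borel_measurable (lebesgue_on {a..b})"
      using g by measurable
    then show ?thesis by (subst (asm) borel_measurable_restrict_space_iff_ennreal) auto
  qed
  have main: "(\<integral>\<^sup>+x\<in>{a..b}. ennreal (norm (g x)) \<partial>lebesgue) \<le> ennreal (s * (b - a) + s powr (1 - p) * Z)"
    if s: "0 < s" for s
  proof -
    have "(\<integral>\<^sup>+x\<in>{a..b}. ennreal (norm (g x)) \<partial>lebesgue)
        \<le> (\<integral>\<^sup>+x. ennreal s * indicator {a..b} x
              + ennreal (s powr (1 - p)) * (ennreal (norm (g x) powr p) * indicator {a..b} x) \<partial>lebesgue)"
    proof (rule nn_integral_mono)
      fix x
      have "ennreal (norm (g x)) \<le> ennreal (s + s powr (1 - p) * norm (g x) powr p)"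
        using young_pointwise[of "norm (g x)" s p] s p by (intro ennreal_leI) auto
      also have "\<dots> = ennreal s + ennreal (s powr (1 - p)) * ennreal (norm (g x) powr p)"
        using s by (simp add: ennreal_mult)
      finally show "ennreal (norm (g x)) * indicator {a..b} x \<le> ennreal s * indicator {a..b} x
              + ennreal (s powr (1 - p)) * (ennreal (norm (g x) powr p) * indicator {a..b} x)"
        by (simp add: indicator_def)
    qed
    also have "\<dots> = ennreal s * emeasure lebesgue {a..b}
        + ennreal (s powr (1 - p)) * (\<integral>\<^sup>+x\<in>{a..b}. ennreal (norm (g x) powr p) \<partial>lebesgue)"
    proof (subst nn_integral_add)
      show "(\<lambda>x. ennreal s * indicator {a..b} x) \<in> borel_measurable lebesgue"
        by (intro borel_measurable_times_ennreal borel_measurable_const borel_measurable_indicator) simp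
      show "(\<lambda>x. ennreal (s powr (1 - p)) * (ennreal (norm (g x) powr p) * indicator {a..b} x))
          \<in> borel_measurable lebesgue"
        by (intro borel_measurable_times_ennreal[OF borel_measurable_const meas])
      have "{a..b} \<in> sets lebesgue" by simp
      from nn_integral_cmult_indicator[OF this, of "ennreal s"]
      show "(\<integral>\<^sup>+x. ennreal s * indicator {a..b} x \<partial>lebesgue)
          + (\<integral>\<^sup>+x. ennreal (s powr (1 - p)) * (ennreal (norm (g x) powr p) * indicator {a..b} x) \<partial>lebesgue)
        = ennreal s * emeasure lebesgue {a..b}
          + ennreal (s powr (1 - p)) * (\<integral>\<^sup>+x\<in>{a..b}. ennreal (norm (g x) powr p) \<partial>lebesgue)"
        by (simp only: nn_integral_cmult[OF meas])
    qed
    also have "\<dots> \<le> ennreal s * ennreal (b - a) + ennreal (s powr (1 - p)) * ennreal Z"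
      using Z(1) ab by (intro add_mono mult_left_mono) auto
    also have "\<dots> = ennreal (s * (b - a) + s powr (1 - p) * Z)"
      using s ab Z(2) by (simp add: ennreal_mult)
    finally show ?thesis .
  qed
  show ?thesis
  proof (cases "Z = 0")
    case True
    have "(\<integral>\<^sup>+x\<in>{a..b}. ennreal (norm (g x)) \<partial>lebesgue) \<le> 0"
    proof (rule ennreal_le_epsilon)
      fix e :: real assume e: "0 < e"
      show "(\<integral>\<^sup>+x\<in>{a..b}. ennreal (norm (g x)) \<partial>lebesgue) \<le> 0 + ennreal e"
        using main[of "e / (b - a)"] e ab True by simp
    qed
    then show ?thesis by simp
  next
    case False
    then have Zp: "0 < Z / (b - a)" using Z(2) ab by simp
    \<comment> \<open>This value makes the two terms of \<open>main\<close> equal, which explains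
      the factor 2 in the conclusion. The case \<open>Z = 0\<close> is separate because
      \<open>s\<close> must be positive; there \<open>s\<close> is taken arbitrarily small.\<close>
    define s where "s = (Z / (b - a)) powr (1 / p)"
    have s: "0 < s" using Zp unfolding s_def powr_gt_zero by (rule less_imp_neq[symmetric])
    have "s powr p = (Z / (b - a)) powr 1" using p by (simp only: s_def powr_powr) simp
    also have "\<dots> = Z / (b - a)" using Zp by (intro powr_one) simp
    finally have "s powr p = Z / (b - a)" .
    then have "s powr (1 - p) = s / (Z / (b - a))" using s by (simp add: powr_diff)
    then have "s powr (1 - p) * Z = s * (b - a)" using ab False by simp
    then have "s * (b - a) + s powr (1 - p) * Z = 2 * (b - a) * s" by simp
    then show ?thesis using main[OF s] by (simp add: s_def)
  qed
qed

lemma powr_inverse_le: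
  fixes x y p :: real
  assumes "0 \<le> x" "0 < p" "x powr p \<le> y"
  shows "x \<le> y powr (1 / p)"
proof -
  have "x = (x powr p) powr (1 / p)" using assms by (simp add: powr_powr)
  also have "\<dots> \<le> y powr (1 / p)" using assms by (intro powr_mono2) auto
  finally show ?thesis .
qed

text \<open>The witness is a minimum point of \<open>norm (F x)\<close>: the \<open>p\<close>-th
  power of the minimum cannot exceed the mean of the \<open>p\<close>-th powers.\<close>

lemma exists_value_le_mean:
  fixes F :: "real \<Rightarrow> complex"
  assumes F: "continuous_on {s..t} F" and st: "s < t" and p: "1 \<le> p"
    and Y: "(\<integral>\<^sup>+x\<in>{s..t}. ennreal (norm (F x) powr p) \<partial>lebesgue) \<le> ennreal Y" "0 \<le> Y"
  shows "\<exists>x\<in>{s..t}. norm (F x) \<le> (Y / (t - s)) powr (1 / p)"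
proof -
  have "\<exists>x\<in>{s..t}. \<forall>y\<in>{s..t}. norm (F x) \<le> norm (F y)"
    using st by (intro continuous_attains_inf continuous_on_norm F) auto
  then obtain x where x: "x \<in> {s..t}" "\<And>y. y \<in> {s..t} \<Longrightarrow> norm (F x) \<le> norm (F y)" by blast
  have "ennreal (norm (F x) powr p * (t - s)) = (\<integral>\<^sup>+y. ennreal (norm (F x) powr p) * indicator {s..t} y \<partial>lebesgue)"
    using st by (subst nn_integral_cmult_indicator) (auto simp: ennreal_mult)
  also have "\<dots> \<le> (\<integral>\<^sup>+x\<in>{s..t}. ennreal (norm (F x) powr p) \<partial>lebesgue)"
    using x(2) p by (intro nn_integral_mono) (auto simp: indicator_def intro!: ennreal_leI powr_mono2)
  also note Y(1)
  finally have "norm (F x) powr p * (t - s) \<le> Y" using Y(2) by (simp add: ennreal_le_iff)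
  then have "norm (F x) powr p \<le> Y / (t - s)" using st by (simp add: field_simps)
  then show ?thesis using x(1) p by (intro bexI[of _ x] powr_inverse_le) auto
qed

text \<open>The powers of \<open>b - a\<close> on the left compensate short intervals, so that only
  the upper bound \<open>L\<close> of the length enters the constant. There,
  \<open>2 * real r * fact r * (4 * real r) ^ r\<close> stems from the values of \<open>F\<close> at
  chosen points, \<open>2 * L ^ r\<close> from the top derivative, and the outer
  \<open>real r\<close> bounds the factor \<open>Suc k\<close> of
  \<open>sobolev_deriv_bound\<close>.\<close>

lemma divdiff_sobolev_bound:
  assumes F: "sobolev_regular r I F" "open I" "1 \<le> r" "{a..b} \<subseteq> I" "a < b" and p: "1 \<le> p"
    and L: "b - a \<le> L"
    and xs: "length xs = Suc j" "j < r" "sorted_wrt (<) xs" "set xs \<subseteq> {a..b}"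
  shows "ennreal ((b - a) * ((b - a) ^ j * norm (divdiff F xs)) powr p)
     \<le> ennreal ((real r * (2 * real r * fact r * (4 * real r) ^ r + 2 * L ^ r)) powr p)
        * ((\<integral>\<^sup>+x\<in>{a..b}. ennreal (norm (F x) powr p) \<partial>lebesgue)
           + (\<integral>\<^sup>+x\<in>{a..b}. ennreal (norm (deriv_on I r F x) powr p) \<partial>lebesgue))"
    (is "?lhs \<le> ennreal (?C powr p) * (?IF + ?ID)")
proof (cases "?IF + ?ID = \<infinity>")
  case True
  \<comment> \<open>Positivity matters because zero times infinity is zero in
    \<open>ennreal\<close>.\<close>
  have "0 < ?C" using F(3,5) L by (intro mult_pos_pos add_pos_pos) auto
  then have "0 < ?C powr p" unfolding powr_gt_zero by (rule less_imp_neq[symmetric])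
  then have "ennreal (?C powr p) \<noteq> 0" by (simp only: ennreal_eq_0_iff not_le)
  then have "ennreal (?C powr p) * \<infinity> = \<infinity>" by (simp only: ennreal_mult_top infinity_ennreal_def if_False)
  then show ?thesis unfolding True by simp
next
  case False
  define d where "d = b - a"
  have d: "0 < d" "d \<le> L" using F(5) L by (auto simp: d_def)
  have rp: "0 < real r" "1 \<le> real r" using F(3) by auto
  define Y where "Y = enn2real ?IF"
  define Z where "Z = enn2real ?ID"
  have YZ: "?IF = ennreal Y" "?ID = ennreal Z" "0 \<le> Y" "0 \<le> Z"
    using False by (auto simp: Y_def Z_def less_top)
  define W where "W = (Y + Z) / d"
  have W: "0 \<le> W" "Y / d \<le> W" "Z / d \<le> W" using YZ d by (auto simp: W_def divide_right_mono)
  define X where "X = 2 * d * (Z / d) powr (1 / p)"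
  have X0: "0 \<le> X" using d by (simp add: X_def)
  have "(\<integral>\<^sup>+x\<in>{a..b}. ennreal (norm (deriv_on I r F x)) \<partial>lebesgue) \<le> ennreal X"
    unfolding X_def d_def
    using nn_integral_norm_le_powr[OF sobolev_top_deriv(1)[OF F(1-3) _ F(4)] F(5) p, of Z] F(5) YZ(2,4) by simp
  note X = this X0
  \<comment> \<open>The interval splits into \<open>r\<close> pieces of length
    \<open>2 * \<delta>\<close>. A point with \<open>norm (F x) \<le> m\<close> is chosen in the
    left half of each, so points from different pieces are at least \<open>\<delta>\<close>
    apart.\<close>
  define \<delta> where "\<delta> = d / (2 * real r)"
  have \<delta>: "0 < \<delta>" "2 * real r * \<delta> = d" using d rp by (auto simp: \<delta>_def)
  define m where "m = (Y / \<delta>) powr (1 / p)"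
  have cell: "{a + 2 * real i * \<delta>..a + 2 * real i * \<delta> + \<delta>} \<subseteq> {a..b}" if i: "i < r" for i
  proof -
    have "(2 * real i + 1) * \<delta> \<le> 2 * real r * \<delta>" using i \<delta>(1) by (intro mult_right_mono) auto
    moreover have "0 \<le> 2 * real i * \<delta>" using \<delta>(1) by simp
    moreover have "a + 2 * real i * \<delta> + \<delta> = a + (2 * real i + 1) * \<delta>" by (simp add: algebra_simps)
    ultimately have "a \<le> a + 2 * real i * \<delta>" "a + 2 * real i * \<delta> + \<delta> \<le> b"
      using \<delta>(2) unfolding d_def by linarith+
    then show ?thesis by (subst atLeastatMost_subset_iff) blast
  qed
  have "\<exists>x\<in>{a + 2 * real i * \<delta>..a + 2 * real i * \<delta> + \<delta>}. norm (F x) \<le> m" if i: "i < r" for i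
  proof -
    note sub = cell[OF i]
    have "continuous_on I F" using F(1,3) unfolding sobolev_regular_def by (metis deriv_on_0 less_le_trans zero_less_one)
    then have "continuous_on {a + 2 * real i * \<delta>..a + 2 * real i * \<delta> + \<delta>} F"
      using sub F(4) by (meson continuous_on_subset order_trans)
    moreover have "(\<integral>\<^sup>+x\<in>{a + 2 * real i * \<delta>..a + 2 * real i * \<delta> + \<delta>}. ennreal (norm (F x) powr p) \<partial>lebesgue) \<le> ennreal Y"
      unfolding YZ(1)[symmetric] by (rule nn_set_integral_set_mono[OF sub])
    ultimately show ?thesis
      using exists_value_le_mean[of "a + 2 * real i * \<delta>" "a + 2 * real i * \<delta> + \<delta>" F p Y] \<delta>(1) p YZ(3)
      by (simp add: m_def)
  qed
  then obtain t where t: "\<And>i. i < r \<Longrightarrow> t i \<in> {a + 2 * real i * \<delta>..a + 2 * real i * \<delta> + \<delta>} \<and> norm (F (t i)) \<le> m"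
    by metis
  define ts where "ts = map t [0..<r]"
  have ts: "length ts = r" "sorted_wrt (\<lambda>x y. x + (b - a) / (2 * real r) \<le> y) ts" "set ts \<subseteq> {a..b}"
  proof -
    show "length ts = r" by (simp add: ts_def)
    show "sorted_wrt (\<lambda>x y. x + (b - a) / (2 * real r) \<le> y) ts"
      unfolding sorted_wrt_iff_nth_less
    proof (intro allI impI)
      fix i k assume ik: "i < k" "k < length ts"
      then have le: "(2 * real i + 2) * \<delta> \<le> 2 * real k * \<delta>" using \<delta>(1) by (intro mult_right_mono) auto
      show "ts ! i + (b - a) / (2 * real r) \<le> ts ! k"
      proof -
        have "(b - a) / (2 * real r) = \<delta>" by (simp only: \<delta>_def d_def)
        moreover have "t i \<le> a + 2 * real i * \<delta> + \<delta>" "a + 2 * real k * \<delta> \<le> t k"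
          using t[of i] t[of k] ik by (simp_all add: ts_def)
        moreover have "(2 * real i + 2) * \<delta> = 2 * real i * \<delta> + \<delta> + \<delta>" by (simp add: algebra_simps)
        ultimately show ?thesis using le ik by (simp add: ts_def)
      qed
    qed
    show "set ts \<subseteq> {a..b}"
    proof
      fix x assume "x \<in> set ts"
      then obtain i where i: "i < r" "x = t i" by (auto simp: ts_def)
      then show "x \<in> {a..b}" using t[OF i(1)] cell[OF i(1)] by blast
    qed
  qed
  have mt: "norm (F x) \<le> m" if "x \<in> set ts" for x using that t by (auto simp: ts_def)
  have m0: "0 \<le> m" by (simp add: m_def)
  define Q where "Q = fact r * (4 * real r) ^ r * m + d ^ (r - 1) * X"
  have Q0: "0 \<le> Q" using m0 X0 d by (simp add: Q_def)
  obtain \<phi> :: "complex \<Rightarrow> real" where \<phi>: "bounded_linear \<phi>" "\<And>z. \<bar>\<phi> z\<bar> \<le> norm z" "\<phi> (divdiff F xs) = norm (divdiff F xs)"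
    using phase_functional[of "divdiff F xs"] by metis
  have der: "(deriv_on I i F has_vector_derivative deriv_on I (Suc i) F x) (at x)"
    if "i < j" "a \<le> x" "x \<le> b" for i x
    by (rule sobolev_has_deriv[OF F(1,2)]) (use that F(4) xs(2) in auto)
  obtain \<xi> where \<xi>: "a \<le> \<xi>" "\<xi> \<le> b" "\<phi> (deriv_on I j F \<xi>) = fact j * \<phi> (divdiff F xs)"
    using divdiff_mean_value[OF \<phi>(1) xs(1,3,4), of "\<lambda>i. deriv_on I i F"] der by auto
  have "norm (divdiff F xs) = 1 * norm (divdiff F xs)" by simp
  also have "\<dots> \<le> fact j * norm (divdiff F xs)" by (intro mult_right_mono) auto
  also have "\<dots> \<le> norm (deriv_on I j F \<xi>)"
    using \<xi>(3) \<phi>(2)[of "deriv_on I j F \<xi>"] \<phi>(3) by simp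
  finally have "d ^ j * norm (divdiff F xs) \<le> d ^ j * norm (deriv_on I j F \<xi>)"
    using d by (intro mult_left_mono) auto
  also have "\<dots> \<le> real (Suc (r - 1 - j)) * Q"
  proof -
    have "r - 1 - (r - 1 - j) = j" "r - 1 - j < r" using xs(2) by auto
    then show ?thesis
      using sobolev_deriv_bound[OF F X ts mt m0, of "r - 1 - j" \<xi>] \<xi>(1,2) by (simp add: Q_def d_def)
  qed
  also have "\<dots> \<le> real r * Q" using xs(2) Q0 by (intro mult_right_mono) auto
  also have "Q \<le> (2 * real r * fact r * (4 * real r) ^ r + 2 * L ^ r) * W powr (1 / p)"
  proof -
    have "Y / \<delta> = 2 * real r * (Y / d)" using \<delta> rp d by (simp add: \<delta>_def field_simps)
    then have "m = (2 * real r) powr (1 / p) * (Y / d) powr (1 / p)"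
      using rp YZ(3) d by (simp only: m_def) (intro powr_mult; simp)
    \<comment> \<open>As \<open>2 * real r\<close> is at least 1, the exponent \<open>1 / p\<close>
      may be raised to 1, which frees the constant from \<open>p\<close>.\<close>
    also have "\<dots> \<le> (2 * real r) powr 1 * W powr (1 / p)"
      using W YZ(3) d p rp by (intro mult_mono powr_mono powr_mono2) auto
    also have "(2 * real r) powr 1 = 2 * real r" using rp by simp
    finally have "fact r * (4 * real r) ^ r * m \<le> fact r * (4 * real r) ^ r * (2 * real r * W powr (1 / p))"
      using rp by (intro mult_left_mono) auto
    moreover have "d ^ (r - 1) * X \<le> 2 * L ^ r * W powr (1 / p)"
    proof -
      have "d ^ (r - 1) * X = 2 * d ^ r * (Z / d) powr (1 / p)"
        using F(3) by (cases r) (auto simp: X_def)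
      also have "\<dots> \<le> 2 * L ^ r * W powr (1 / p)"
        using W YZ(4) d p by (intro mult_mono powr_mono2 power_mono) auto
      finally show ?thesis .
    qed
    moreover have "(2 * real r * fact r * (4 * real r) ^ r + 2 * L ^ r) * W powr (1 / p)
        = fact r * (4 * real r) ^ r * (2 * real r * W powr (1 / p)) + 2 * L ^ r * W powr (1 / p)"
      by (simp only: distrib_right) (simp only: mult_ac)
    ultimately show ?thesis unfolding Q_def by linarith
  qed
  finally have "d ^ j * norm (divdiff F xs) \<le> ?C * W powr (1 / p)"
    using rp by (simp add: mult_left_mono mult.assoc)
  then have "(d ^ j * norm (divdiff F xs)) powr p \<le> (?C * W powr (1 / p)) powr p"
    using d p by (intro powr_mono2) auto
  also have "\<dots> = ?C powr p * W"
    using W p rp d by (simp add: powr_mult powr_powr)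
  finally have "d * (d ^ j * norm (divdiff F xs)) powr p \<le> d * (?C powr p * W)"
    using d by (intro mult_left_mono) auto
  also have "\<dots> = ?C powr p * (Y + Z)" using d by (simp add: W_def)
  finally have "?lhs \<le> ennreal (?C powr p * (Y + Z))"
    unfolding d_def by (rule ennreal_leI)
  also have "\<dots> = ennreal (?C powr p) * (?IF + ?ID)"
    using YZ by (simp add: ennreal_mult)
  finally show ?thesis .
qed

text \<open>Nodes are added at the left end while \<open>x\<close> remains the rightmost one, so
  every step is one use of the recursion with both ends exposed. The strict inequality keeps
  \<open>x\<close>, a node of the remainder, distinct from the others.\<close>

lemma newton_expansion_backward:
  assumes lam: "strict_mono lam" and x: "lam m < x"
  shows "F x = (\<Sum>j<k. divdiff_seq lam F (m - int j) j * of_real (\<Prod>i<j. x - lam (m - int i)))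
     + divdiff F (map lam [m - int k + 1..m] @ [x]) * of_real (\<Prod>i<k. x - lam (m - int i))"
proof (induction k)
  case 0
  then show ?case by simp
next
  case (Suc k)
  let ?y = "lam (m - int k)" and ?ws = "map lam [m - int k + 1..m]"
  let ?P = "of_real (\<Prod>i<k. x - lam (m - int i)) :: complex"
  have "?y \<le> lam m" using strict_mono_mono[OF lam] by (auto simp: mono_def)
  then have xy: "complex_of_real (x - ?y) \<noteq> 0" using x by (simp only: of_real_eq_0_iff)
  have l: "map lam [m - int k..m] = ?y # ?ws" by (simp add: upto_rec1)
  have "divdiff F (?y # ?ws @ [x]) * of_real (x - ?y) = divdiff F (?ws @ [x]) - divdiff F (?y # ?ws)"
    unfolding divdiff_Cons_snoc by (rule nonzero_eq_divide_eq[OF xy, THEN iffD1]) (rule refl)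
  then have e: "divdiff F (?ws @ [x]) = divdiff F (?y # ?ws) + divdiff F (?y # ?ws @ [x]) * of_real (x - ?y)"
    by simp
  have s: "divdiff_seq lam F (m - int k) k = divdiff F (?y # ?ws)"
    by (simp add: divdiff_seq_def l)
  have m1: "divdiff F (?ws @ [x]) * ?P = divdiff_seq lam F (m - int k) k * ?P
      + divdiff F (?y # ?ws @ [x]) * (?P * of_real (x - ?y))"
    unfolding s by (subst e, simp only: distrib_right, simp only: mult_ac)
  have m2: "of_real (\<Prod>i<Suc k. x - lam (m - int i)) = ?P * of_real (x - ?y)"
    by (simp only: prod.lessThan_Suc of_real_mult)
  have m3: "map lam [m - int (Suc k) + 1..m] @ [x] = ?y # ?ws @ [x]" using l by simp
  show ?case
    using Suc.IH unfolding m1 m2 m3 by (simp only: sum.lessThan_Suc add.assoc)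
qed

lemma weight_powr:
  assumes "0 < d" "1 \<le> p"
  shows "d powr (real j * p + 1) * norm z powr p = d * (d ^ j * norm z) powr p"
proof -
  have "d powr (real j * p + 1) = d * (d ^ j) powr p"
    using assms by (simp add: powr_add powr_powr powr_realpow[symmetric])
  then show ?thesis using assms by (simp add: powr_mult)
qed

text \<open>For \<open>j < r\<close> the block from \<open>lam (m - int j)\<close> to
  \<open>lam (m - int j + int r)\<close> contains the cell of \<open>x\<close>. Its length
  \<open>dd j\<close> is thus at least \<open>h\<close>, so that the weighted term bounds
  \<open>h * A j powr p\<close>; and it is at least each factor \<open>x - lam (m - int i)\<close>
  with \<open>i \<le> j\<close>, so that the Newton product is at most \<open>dd j ^ j\<close>. The
  constant collects \<open>r\<close> terms and the remainder.\<close>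

lemma sobolev_pointwise_bound:
  fixes m :: int
  assumes F: "sobolev_regular r I F" "open I" "1 \<le> r" and p: "1 \<le> p"
    and lam: "strict_mono lam"
  defines "a \<equiv> lam (m - int r + 1)" and "b \<equiv> lam (m + 1)" and "h \<equiv> lam (m + 1) - lam m"
  assumes I: "{a..b} \<subseteq> I" and L: "b - a \<le> L" and x: "lam m \<le> x" "x < b"
  shows "ennreal (h * norm (F x) powr p)
     \<le> ennreal ((real r + 2 * L ^ r) powr p)
        * ((\<Sum>j<r. ennreal ((lam (m - int j + int r) - lam (m - int j)) powr (real j * p + 1)
                  * norm (divdiff_seq lam F (m - int j) j) powr p))
           + (\<integral>\<^sup>+x\<in>{a..b}. ennreal (norm (deriv_on I r F x) powr p) \<partial>lebesgue))"
    (is "?lhs \<le> ennreal (?C powr p) * (?S + ?ID)")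
proof (cases "?ID = \<infinity>")
  case True
  have mono: "lam i < lam k" if "i < k" for i k using strict_monoD[OF lam that] .
  have "0 \<le> L" using mono[of "m - int r + 1" "m + 1"] F(3) L by (simp add: a_def b_def)
  then have "0 < ?C" using F(3) by (intro add_pos_nonneg) auto
  then have "0 < ?C powr p" unfolding powr_gt_zero by (rule less_imp_neq[symmetric])
  then have "ennreal (?C powr p) \<noteq> 0" by (simp only: ennreal_eq_0_iff not_le)
  then have "ennreal (?C powr p) * \<infinity> = \<infinity>" by (simp only: ennreal_mult_top infinity_ennreal_def if_False)
  then show ?thesis unfolding True by simp
next
  case False
  have mono: "lam i < lam k" if "i < k" for i k using strict_monoD[OF lam that] .
  have mono': "lam i \<le> lam k" if "i \<le> k" for i k using that mono[of i k] by (cases "i = k") auto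
  define dd where "dd = (\<lambda>j. lam (m - int j + int r) - lam (m - int j))"
  define A where "A = (\<lambda>j. dd j ^ j * norm (divdiff_seq lam F (m - int j) j))"
  define d where "d = b - a"
  have h: "0 < h" unfolding h_def using mono[of m "m + 1"] by simp
  have hd: "h \<le> d" using mono'[of "m - int r + 1" m] F(3) by (simp add: h_def d_def a_def b_def)
  have d: "0 < d" "d \<le> L" using h hd L by (auto simp: d_def)
  have dh: "h \<le> dd j" if "j < r" for j
    using mono'[of "m + 1" "m - int j + int r"] mono'[of "m - int j" m] that by (simp add: h_def dd_def)
  have fac: "0 \<le> x - lam (m - int i)" "x - lam (m - int i) \<le> dd j" if "i \<le> j" "j < r" for i j
  proof -
    show "0 \<le> x - lam (m - int i)" using mono'[of "m - int i" m] x by simp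
    show "x - lam (m - int i) \<le> dd j"
      using mono'[of "m - int j" "m - int i"] mono'[of "m + 1" "m - int j + int r"] that x
      by (simp add: dd_def b_def)
  qed
  define Z where "Z = enn2real ?ID"
  have Z: "?ID = ennreal Z" "0 \<le> Z" using False by (auto simp: Z_def less_top)
  \<comment> \<open>\<open>U\<close> is the right-hand side without its constant, divided by the
    length of the cell. Its \<open>p\<close>-th root \<open>B\<close> bounds every
    \<open>A j\<close>.\<close>
  define U where "U = ((\<Sum>j<r. dd j * A j powr p) + Z) / h"
  have ddp: "0 < dd j" if "j < r" for j using dh[OF that] h by linarith
  have A0: "0 \<le> A j" if "j < r" for j using ddp[OF that] by (simp add: A_def)
  have S0: "0 \<le> (\<Sum>j<r. dd j * A j powr p)"
    using ddp by (intro sum_nonneg mult_nonneg_nonneg) (auto simp: less_imp_le)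
  have U0: "0 \<le> U" "Z / h \<le> U" using S0 Z(2) h by (auto simp: U_def divide_right_mono)
  define B where "B = U powr (1 / p)"
  have B0: "0 \<le> B" by (simp add: B_def)
  have AB: "A j \<le> B" if j: "j < r" for j
  proof -
    have "h * A j powr p \<le> dd j * A j powr p" using dh[OF j] by (intro mult_right_mono) auto
    also have "\<dots> \<le> (\<Sum>j<r. dd j * A j powr p)"
      using j ddp by (intro member_le_sum) (auto intro!: mult_nonneg_nonneg simp: less_imp_le)
    also have "\<dots> \<le> (\<Sum>j<r. dd j * A j powr p) + Z" using Z(2) by simp
    finally have "A j powr p \<le> U" using h by (simp add: U_def field_simps)
    then show ?thesis unfolding B_def using A0[OF j] p by (intro powr_inverse_le) auto
  qed
  have CB: "norm (F x) \<le> ?C * B"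
  proof (cases "x = lam m")
    \<comment> \<open>At the node itself Newton's formula would use a repeated node;
      \<open>F x\<close> then is the divided difference of order 0.\<close>
    case True
    have "norm (F x) = A 0" by (simp add: A_def divdiff_seq_def True)
    also have "\<dots> \<le> B" using AB F(3) by simp
    also have "\<dots> \<le> ?C * B"
    proof -
      have "1 \<le> ?C" using F(3) d by (intro order_trans[OF _ add_increasing2[of "2 * L ^ r" "real r"]]) auto
      then show ?thesis using mult_right_mono[OF _ B0, of 1 ?C] by simp
    qed
    finally show ?thesis .
  next
    case False
    then have xm: "lam m < x" using x by simp
    define X where "X = 2 * d * (Z / d) powr (1 / p)"
    have X0: "0 \<le> X" using d by (simp add: X_def)
    have ab: "a < b" using d by (simp add: d_def)
    have X: "(\<integral>\<^sup>+x\<in>{a..b}. ennreal (norm (deriv_on I r F x)) \<partial>lebesgue) \<le> ennreal X"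
      unfolding X_def d_def
      using nn_integral_norm_le_powr[OF sobolev_top_deriv(1)[OF F(1-3) _ I] ab p, of Z] ab Z by simp
    let ?ws = "map lam [m - int r + 1..m]"
    have l: "?ws = a # map lam [m - int r + 2..m]" using F(3) by (simp add: upto_rec1 a_def add.commute)
    have top: "norm (divdiff F (?ws @ [x])) * (x - a) \<le> X"
      unfolding l append_Cons
    proof (rule divdiff_top_bound[OF F I X X0])
      show "length (map lam [m - int r + 2..m]) = r - 1" using F(3) by simp
      have "sorted_wrt (<) ?ws"
        unfolding sorted_wrt_map by (rule sorted_wrt_mono_rel[OF _ sorted_wrt_upto]) (use mono in auto)
      moreover have "y \<le> lam m" "a \<le> y" if "y \<in> set ?ws" for y
        using that mono' by (auto simp: a_def)
      ultimately have "sorted_wrt (<) (?ws @ [x])" "set (?ws @ [x]) \<subseteq> {a..b}"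
        using xm x(2) mono'[of "m - int r + 1" m] F(3)
        by (fastforce simp: sorted_wrt_append, fastforce simp: a_def)
      then show "sorted_wrt (<) (a # map lam [m - int r + 2..m] @ [x])"
          "set (a # map lam [m - int r + 2..m] @ [x]) \<subseteq> {a..b}"
        unfolding l by simp_all
    qed
    let ?P = "\<lambda>j. \<Prod>i<j. x - lam (m - int i)"
    have summand: "norm (divdiff_seq lam F (m - int j) j * of_real (?P j)) \<le> B" if j: "j < r" for j
    proof -
      have P: "0 \<le> ?P j" "?P j \<le> dd j ^ j"
      proof -
        show "0 \<le> ?P j" using fac(1)[OF _ j] by (intro prod_nonneg) auto
        have "?P j \<le> (\<Prod>i<j. dd j)" using fac[OF _ j] by (intro prod_mono) auto
        then show "?P j \<le> dd j ^ j" by simp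
      qed
      have "norm (divdiff_seq lam F (m - int j) j * of_real (?P j)) = norm (divdiff_seq lam F (m - int j) j) * ?P j"
        using P(1) by (simp only: norm_mult norm_of_real abs_of_nonneg)
      also have "\<dots> \<le> norm (divdiff_seq lam F (m - int j) j) * dd j ^ j"
        using P(2) by (intro mult_left_mono) auto
      also have "\<dots> = A j" by (simp add: A_def)
      finally show ?thesis using AB[OF j] by simp
    qed
    have rem: "norm (divdiff F (?ws @ [x]) * of_real (?P r)) \<le> 2 * L ^ r * B"
    proof -
      \<comment> \<open>Of the \<open>r\<close> factors in the remainder, \<open>r - 1\<close> are
        bounded by \<open>d\<close>. The last one is \<open>x - a\<close> and is left to
        \<open>top\<close>, which controls the divided difference only in product with the distance
        of its extreme nodes.\<close>
      have dr: "dd (r - 1) = d" using F(3) by (simp add: dd_def d_def a_def b_def of_nat_diff algebra_simps)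
      have r: "r = Suc (r - 1)" using F(3) by simp
      have P: "0 \<le> ?P (r - 1)" "?P (r - 1) \<le> d ^ (r - 1)"
      proof -
        show "0 \<le> ?P (r - 1)" using fac(1)[of _ "r - 1"] F(3) by (intro prod_nonneg) auto
        have "?P (r - 1) \<le> (\<Prod>i<r - 1. d)" using fac[of _ "r - 1"] F(3) dr by (intro prod_mono) auto
        then show "?P (r - 1) \<le> d ^ (r - 1)" by simp
      qed
      have "x - lam (m - int (r - 1)) = x - a" using F(3) by (simp add: a_def of_nat_diff algebra_simps)
      then have Pr: "?P r = ?P (r - 1) * (x - a)" by (subst r) (simp del: Suc_pred)
      have xa: "0 \<le> x - a" using fac(1)[of "r - 1" "r - 1"] F(3) by (simp add: a_def of_nat_diff algebra_simps)
      have Pr0: "0 \<le> ?P r" unfolding Pr using P(1) xa by (rule mult_nonneg_nonneg)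
      have "norm (divdiff F (?ws @ [x]) * of_real (?P r)) = norm (divdiff F (?ws @ [x])) * ?P r"
        using Pr0 by (simp only: norm_mult norm_of_real abs_of_nonneg)
      also have "\<dots> = ?P (r - 1) * (norm (divdiff F (?ws @ [x])) * (x - a))"
        unfolding Pr by (simp only: mult_ac)
      also have "\<dots> \<le> d ^ (r - 1) * X"
        using P top xa d by (intro mult_mono) auto
      also have "\<dots> = 2 * d ^ r * (Z / d) powr (1 / p)"
        using F(3) by (cases r) (auto simp: X_def)
      also have "\<dots> \<le> 2 * L ^ r * B"
      proof (intro mult_mono)
        have "Z / d \<le> Z / h" using Z(2) h hd by (intro divide_left_mono) auto
        then have "Z / d \<le> U" using U0(2) by linarith
        then show "(Z / d) powr (1 / p) \<le> B" unfolding B_def using Z(2) d p by (intro powr_mono2) auto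
      qed (use d in \<open>auto intro: power_mono\<close>)
      finally show ?thesis .
    qed
    have "norm (F x) \<le> (\<Sum>j<r. norm (divdiff_seq lam F (m - int j) j * of_real (?P j)))
        + norm (divdiff F (?ws @ [x]) * of_real (?P r))"
      by (subst newton_expansion_backward[OF lam xm, of F r]) (rule norm_triangle_mono[OF norm_sum order_refl])
    also have "\<dots> \<le> (\<Sum>j<r. B) + 2 * L ^ r * B"
      using summand rem by (intro add_mono sum_mono) auto
    also have "\<dots> = ?C * B" by (simp add: algebra_simps)
    finally show ?thesis .
  qed
  have "norm (F x) powr p \<le> (?C * B) powr p" using CB p by (intro powr_mono2) auto
  also have "\<dots> = ?C powr p * U"
    using U0 p d by (simp add: B_def powr_mult powr_powr)
  finally have "h * norm (F x) powr p \<le> h * (?C powr p * U)"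
    using h by (intro mult_left_mono) auto
  also have "\<dots> = ?C powr p * ((\<Sum>j<r. dd j * A j powr p) + Z)" using h by (simp add: U_def)
  finally have "?lhs \<le> ennreal (?C powr p * ((\<Sum>j<r. dd j * A j powr p) + Z))" by (rule ennreal_leI)
  also have "\<dots> = ennreal (?C powr p) * (ennreal (\<Sum>j<r. dd j * A j powr p) + ennreal Z)"
    using S0 Z(2) by (simp add: ennreal_mult)
  also have "ennreal (\<Sum>j<r. dd j * A j powr p) = ?S"
  proof (subst sum_ennreal[symmetric])
    show "(\<Sum>j<r. ennreal (dd j * A j powr p)) = ?S"
    proof (intro sum.cong refl arg_cong[where f = ennreal])
      fix j assume "j \<in> {..<r}"
      then show "dd j * A j powr p = (lam (m - int j + int r) - lam (m - int j)) powr (real j * p + 1)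
                  * norm (divdiff_seq lam F (m - int j) j) powr p"
        using weight_powr[OF ddp p, of j j "divdiff_seq lam F (m - int j) j"] by (simp add: A_def dd_def)
    qed
  qed (use ddp in \<open>auto intro!: mult_nonneg_nonneg simp: less_imp_le\<close>)
  finally show ?thesis by (simp add: Z(1))
qed

section \<open>Summation over the nodes\<close>

text \<open>Counting measure gives access to Tonelli's theorem for exchanging sums over the nodes
  with integrals. The bijection \<open>int_decode\<close> carries the unordered sum to a series over
  the naturals.\<close>

lemma infsum_int_eq_nn_integral:
  fixes g :: "int \<Rightarrow> ennreal"
  shows "(\<Sum>\<^sub>\<infinity>n. g n) = (\<integral>\<^sup>+n. g n \<partial>count_space UNIV)"
proof -
  have bij: "bij_betw int_decode UNIV UNIV" by (rule bij_int_decode)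
  have "(\<lambda>n. g (int_decode n)) summable_on UNIV" by (rule nonneg_summable_on_complete) simp
  then have "((\<lambda>n. g (int_decode n)) has_sum (\<Sum>\<^sub>\<infinity>n. g (int_decode n))) UNIV" by (rule has_sum_infsum)
  then have "(\<lambda>n. g (int_decode n)) sums (\<Sum>\<^sub>\<infinity>n. g (int_decode n))" by (rule has_sum_imp_sums)
  then have "(\<Sum>\<^sub>\<infinity>n. g (int_decode n)) = (\<Sum>n. g (int_decode n))" by (rule sums_unique)
  also have "\<dots> = (\<integral>\<^sup>+n. g (int_decode n) \<partial>count_space UNIV)" by (simp add: nn_integral_count_space_nat)
  also have "\<dots> = (\<integral>\<^sup>+n. g n \<partial>count_space UNIV)" by (rule nn_integral_bij_count_space[OF bij])
  finally show ?thesis using infsum_reindex_bij_betw[OF bij, of g] by simp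
qed

lemma nn_integral_int_shift:
  fixes g :: "int \<Rightarrow> ennreal"
  shows "(\<integral>\<^sup>+n. g (n + k) \<partial>count_space UNIV) = (\<integral>\<^sup>+n. g n \<partial>count_space UNIV)"
proof (rule nn_integral_bij_count_space)
  show "bij_betw (\<lambda>n. n + k) UNIV UNIV"
    by (rule bij_betwI[where g = "\<lambda>n. n - k"]) auto
qed

lemma admissible_nodesD:
  assumes "admissible_nodes K lam"
  shows "strict_mono lam" "i < k \<Longrightarrow> lam i < lam k" "i \<le> k \<Longrightarrow> lam i \<le> lam k"
    "lam (n + int r) - lam n \<le> real r * K"
proof -
  show sm: "strict_mono lam" using assms by (simp add: admissible_nodes_def)
  show "i < k \<Longrightarrow> lam i < lam k" by (rule strict_monoD[OF sm])
  show "i \<le> k \<Longrightarrow> lam i \<le> lam k" by (rule monoD[OF strict_mono_mono[OF sm]])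
  have gap: "lam (n + 1) - lam n \<le> K" for n using assms by (simp add: admissible_nodes_def)
  show "lam (n + int r) - lam n \<le> real r * K"
  proof (induction r)
    case (Suc r)
    have "n + int (Suc r) = n + int r + 1" by simp
    then have "lam (n + int (Suc r)) - lam (n + int r) \<le> K" using gap[of "n + int r"] by (simp only:)
    moreover have "real (Suc r) * K = real r * K + K" by (simp add: algebra_simps)
    ultimately show ?case using Suc by linarith
  qed simp
qed

lemma node_interval_cell:
  assumes lam: "admissible_nodes K lam" and x: "x \<in> node_interval lam"
  obtains m where "lam m \<le> x" "x < lam (m + 1)"
proof -
  obtain n where n: "lam n \<le> x" "x \<le> lam (n + 1)" using x by (auto simp: node_interval_def)
  show ?thesis
  proof (cases "x = lam (n + 1)")
    case True
    then show ?thesis using that[of "n + 1"] admissible_nodesD(2)[OF lam, of "n + 1" "n + 1 + 1"] by simp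
  next
    case False
    then show ?thesis using that[of n] n by simp
  qed
qed

lemma Icc_subset_node_interval:
  assumes lam: "admissible_nodes K lam"
  shows "{lam n..lam k} \<subseteq> node_interval lam"
proof (cases "n \<le> k")
  case True
  then show ?thesis
  proof (induction k rule: int_ge_induct)
    case base
    have "lam n \<in> {lam n..lam (n + 1)}" using admissible_nodesD(3)[OF lam, of n "n + 1"] by simp
    then show ?case by (auto simp: node_interval_def)
  next
    case (step k)
    have "{lam n..lam (k + 1)} \<subseteq> {lam n..lam k} \<union> {lam k..lam (k + 1)}" by auto
    then show ?case using step.IH by (auto simp: node_interval_def)
  qed
next
  case False
  then have "lam k < lam n" using admissible_nodesD(2)[OF lam, of k n] by simp
  then show ?thesis by simp
qed

text \<open>The index runs through all integers, so no node is an end of the interval: every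
  half-open cell lies inside an open double cell. Derivatives relative to the interval are therefore
  ordinary two-sided ones.\<close>

lemma open_node_interval:
  assumes lam: "admissible_nodes K lam"
  shows "open (node_interval lam)"
proof -
  have "node_interval lam = (\<Union>n. {lam n<..<lam (n + 2)})"
  proof (intro equalityI subsetI)
    fix x assume "x \<in> node_interval lam"
    then obtain m where m: "lam m \<le> x" "x < lam (m + 1)" by (rule node_interval_cell[OF lam])
    have lt: "lam (m - 1) < lam m" by (rule admissible_nodesD(2)[OF lam]) simp
    have e: "m - 1 + 2 = m + 1" by simp
    have "x \<in> {lam (m - 1)<..<lam (m - 1 + 2)}" unfolding e using m lt by auto
    then show "x \<in> (\<Union>n. {lam n<..<lam (n + 2)})" by blast
  next
    fix x assume "x \<in> (\<Union>n. {lam n<..<lam (n + 2)})"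
    then obtain n where "x \<in> {lam n<..<lam (n + 2)}" by blast
    then have "x \<in> {lam n..lam (n + 2)}" by simp
    then show "x \<in> node_interval lam" using Icc_subset_node_interval[OF lam] by blast
  qed
  then show ?thesis by auto
qed

text \<open>A point with \<open>lam m \<le> x\<close> and \<open>x < lam (m + 1)\<close> can lie in
  the block beginning at \<open>n\<close> only if \<open>m - r \<le> n \<le> m\<close>. These are
  \<open>r + 1\<close> indices: the blocks are closed, and \<open>n = m - r\<close> occurs when
  \<open>x\<close> is the node \<open>lam m\<close>.\<close>

lemma nn_integral_overlap:
  assumes lam: "admissible_nodes K lam" and r: "1 \<le> r"
    and h: "\<And>n. (\<lambda>x. h x * indicator {lam n..lam (n + int r)} x) \<in> borel_measurable lebesgue"
  shows "(\<integral>\<^sup>+n. (\<integral>\<^sup>+x\<in>{lam n..lam (n + int r)}. h x \<partial>lebesgue) \<partial>count_space UNIV)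
    \<le> of_nat (r + 1) * (\<integral>\<^sup>+x\<in>node_interval lam. h x \<partial>lebesgue)"
proof -
  let ?J = "\<lambda>n. {lam n..lam (n + int r)}"
  \<comment> \<open>\<open>h\<close> is known to be measurable on the blocks only. On the whole
    interval it is the countable supremum of its restrictions to them.\<close>
  have I: "(\<lambda>x. h x * indicator (node_interval lam) x) \<in> borel_measurable lebesgue"
  proof -
    have "h x * indicator (node_interval lam) x = (SUP n. h x * indicator (?J n) x)" for x
    proof (cases "x \<in> node_interval lam")
      case True
      then obtain m where m: "lam m \<le> x" "x < lam (m + 1)" by (rule node_interval_cell[OF lam])
      have "lam (m + 1) \<le> lam (m + int r)" by (rule admissible_nodesD(3)[OF lam]) (use r in simp)
      then have "x \<in> ?J m" using m by simp
      then have "h x = h x * indicator (?J m) x" by simp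
      also have "\<dots> \<le> (SUP n. h x * indicator (?J n) x)" by (rule SUP_upper) (rule UNIV_I)
      finally have "h x \<le> (SUP n. h x * indicator (?J n) x)" .
      moreover have "(SUP n. h x * indicator (?J n) x) \<le> h x"
        by (rule SUP_least) (simp add: indicator_def)
      ultimately show ?thesis using True by (simp add: antisym)
    next
      case False
      then have "x \<notin> ?J n" for n using Icc_subset_node_interval[OF lam] by blast
      then have "h x * indicator (?J n) x = 0" for n by (simp add: indicator_def)
      then show ?thesis using False by (simp only:) simp
    qed
    then have "(\<lambda>x. h x * indicator (node_interval lam) x) = (\<lambda>x. SUP n. h x * indicator (?J n) x)"
      by (rule ext)
    moreover have "(\<lambda>x. SUP n. h x * indicator (?J n) x) \<in> borel_measurable lebesgue"
      by (rule borel_measurable_SUP) (simp, rule h)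
    ultimately show ?thesis by (simp only:)
  qed
  have "(\<integral>\<^sup>+n. (\<integral>\<^sup>+x\<in>?J n. h x \<partial>lebesgue) \<partial>count_space UNIV)
      = (\<integral>\<^sup>+x. (\<integral>\<^sup>+n. h x * indicator (?J n) x \<partial>count_space UNIV) \<partial>lebesgue)"
    by (rule nn_integral_count_space_nn_integral[symmetric]) (use h in auto)
  also have "\<dots> \<le> (\<integral>\<^sup>+x. of_nat (r + 1) * (h x * indicator (node_interval lam) x) \<partial>lebesgue)"
  proof (rule nn_integral_mono)
    fix x
    show "(\<integral>\<^sup>+n. h x * indicator (?J n) x \<partial>count_space UNIV) \<le> of_nat (r + 1) * (h x * indicator (node_interval lam) x)"
    proof (cases "x \<in> node_interval lam")
      case True
      then obtain m where m: "lam m \<le> x" "x < lam (m + 1)" by (rule node_interval_cell[OF lam])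
      have "indicator (?J n) x \<le> (indicator {m - int r..m} n :: ennreal)" for n
      proof (cases "x \<in> ?J n")
        case J: True
        have "n \<le> m"
        proof (rule ccontr)
          assume "\<not> n \<le> m"
          then have "lam (m + 1) \<le> lam n" by (intro admissible_nodesD(3)[OF lam]) simp
          then show False using m J by simp
        qed
        moreover have "m \<le> n + int r"
        proof (rule ccontr)
          assume "\<not> m \<le> n + int r"
          then have "lam (n + int r) < lam m" by (intro admissible_nodesD(2)[OF lam]) simp
          then show False using m J by simp
        qed
        ultimately show ?thesis by (simp add: indicator_def)
      qed simp
      then have "(\<integral>\<^sup>+n. h x * indicator (?J n) x \<partial>count_space UNIV)
          \<le> (\<integral>\<^sup>+n. h x * indicator {m - int r..m} n \<partial>count_space UNIV)"
        by (intro nn_integral_mono mult_left_mono) auto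
      also have "\<dots> = h x * emeasure (count_space UNIV) {m - int r..m}"
        by (rule nn_integral_cmult_indicator) simp
      also have "\<dots> = of_nat (r + 1) * h x"
      proof -
        have "card {m - int r..m} = r + 1" by simp
        then have "emeasure (count_space UNIV) {m - int r..m} = of_nat (r + 1)"
          by (subst emeasure_count_space_finite) (simp, simp, simp only: of_nat_id)
        then show ?thesis by (simp only: mult.commute)
      qed
      finally show ?thesis using True by simp
    next
      case False
      then have "x \<notin> ?J n" for n using Icc_subset_node_interval[OF lam] by blast
      then have "h x * indicator (?J n) x = 0" for n by (simp add: indicator_def)
      then show ?thesis by (simp only:) simp
    qed
  qed
  also have "\<dots> = of_nat (r + 1) * (\<integral>\<^sup>+x\<in>node_interval lam. h x \<partial>lebesgue)"
    by (rule nn_integral_cmult[OF I])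
  finally show ?thesis .
qed

lemma measurable_norm_powr_indicator:
  fixes F :: "real \<Rightarrow> complex"
  assumes "F \<in> borel_measurable (lebesgue_on S)" "S \<in> sets lebesgue"
  shows "(\<lambda>x. ennreal (norm (F x) powr p) * indicator S x) \<in> borel_measurable lebesgue"
proof -
  have "(\<lambda>x. ennreal (norm (F x) powr p)) \<in> borel_measurable (lebesgue_on S)"
    using assms(1) by measurable
  then show ?thesis
    by (rule borel_measurable_restrict_space_iff_ennreal[THEN iffD1, rotated]) (use assms(2) in simp)
qed

text \<open>The part of \<open>eqW_pow\<close> with orders below \<open>r\<close>. It sees values at
  the nodes only, so functions with equal trace share it; the estimates in both directions are
  stated in terms of it.\<close>

definition low_order_pow :: "nat \<Rightarrow> real \<Rightarrow> (int \<Rightarrow> real) \<Rightarrow> (real \<Rightarrow> complex) \<Rightarrow> ennreal" where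
  "low_order_pow r p lam f = (\<Sum>j<r. \<Sum>\<^sub>\<infinity>n. ennreal ((lam (n + int r) - lam n) powr (real j * p + 1)
                          * norm (divdiff_seq lam f n j) powr p))"

text \<open>On every block, of length at most \<open>real r * K\<close>, the local bound applies.
  The counting factor consists of \<open>r\<close> orders and the overlap
  \<open>r + 1\<close>.\<close>

lemma low_order_pow_le:
  assumes F: "sobolev_regular r (node_interval lam) F" and r: "1 \<le> r" and p: "1 \<le> p"
    and lam: "admissible_nodes K lam" and K: "0 < K"
  defines "C \<equiv> real r * (2 * real r * fact r * (4 * real r) ^ r + 2 * (real r * K) ^ r)"
  shows "low_order_pow r p lam F \<le> of_nat (r * (r + 1)) * ennreal (C powr p) * W_pow r p (node_interval lam) F"
proof -
  let ?I = "node_interval lam" and ?J = "\<lambda>n. {lam n..lam (n + int r)}"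
  let ?f = "\<lambda>x. ennreal (norm (F x) powr p)" and ?g = "\<lambda>x. ennreal (norm (deriv_on ?I r F x) powr p)"
  note op = open_node_interval[OF lam]
  have J: "?J n \<subseteq> ?I" for n by (rule Icc_subset_node_interval[OF lam])
  have lt: "lam n < lam (n + int r)" for n by (rule admissible_nodesD(2)[OF lam]) (use r in simp)
  have fm: "(\<lambda>x. ?f x * indicator (?J n) x) \<in> borel_measurable lebesgue" for n
  proof (rule measurable_norm_powr_indicator)
    have "continuous_on ?I F"
      using F r unfolding sobolev_regular_def by (metis deriv_on_0 less_le_trans zero_less_one)
    then have "continuous_on (?J n) F" using J by (rule continuous_on_subset)
    then show "F \<in> borel_measurable (lebesgue_on (?J n))"
      by (rule continuous_imp_measurable_on_sets_lebesgue) simp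
  qed simp
  have gm: "(\<lambda>x. ?g x * indicator (?J n) x) \<in> borel_measurable lebesgue" for n
    by (rule measurable_norm_powr_indicator[OF sobolev_top_deriv(1)[OF F op r less_imp_le[OF lt] J]]) simp
  have term_le: "(\<Sum>\<^sub>\<infinity>n. ennreal ((lam (n + int r) - lam n) powr (real j * p + 1) * norm (divdiff_seq lam F n j) powr p))
      \<le> of_nat (r + 1) * ennreal (C powr p) * W_pow r p ?I F" if j: "j < r" for j
  proof -
    have "(\<Sum>\<^sub>\<infinity>n. ennreal ((lam (n + int r) - lam n) powr (real j * p + 1) * norm (divdiff_seq lam F n j) powr p))
      \<le> (\<integral>\<^sup>+n. ennreal (C powr p) * ((\<integral>\<^sup>+x\<in>?J n. ?f x \<partial>lebesgue) + (\<integral>\<^sup>+x\<in>?J n. ?g x \<partial>lebesgue)) \<partial>count_space UNIV)"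
      unfolding infsum_int_eq_nn_integral
    proof (rule nn_integral_mono)
      fix n :: int
      let ?d = "lam (n + int r) - lam n"
      have "ennreal (?d powr (real j * p + 1) * norm (divdiff_seq lam F n j) powr p)
          = ennreal (?d * (?d ^ j * norm (divdiff F (map lam [n..n + int j]))) powr p)"
        using lt[of n] p by (simp only: divdiff_seq_def weight_powr diff_gt_0_iff_gt)
      also have "\<dots> \<le> ennreal (C powr p) * ((\<integral>\<^sup>+x\<in>?J n. ?f x \<partial>lebesgue) + (\<integral>\<^sup>+x\<in>?J n. ?g x \<partial>lebesgue))"
        unfolding C_def
      proof (rule divdiff_sobolev_bound[OF F op r J lt p admissible_nodesD(4)[OF lam]])
        show "length (map lam [n..n + int j]) = Suc j" by simp
        show "sorted_wrt (<) (map lam [n..n + int j])"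
          unfolding sorted_wrt_map
          by (rule sorted_wrt_mono_rel[OF _ sorted_wrt_upto]) (use admissible_nodesD(2)[OF lam] in auto)
        show "set (map lam [n..n + int j]) \<subseteq> ?J n"
          using admissible_nodesD(3)[OF lam] j by auto
      qed (rule j)
      finally show "ennreal (?d powr (real j * p + 1) * norm (divdiff_seq lam F n j) powr p)
        \<le> ennreal (C powr p) * ((\<integral>\<^sup>+x\<in>?J n. ?f x \<partial>lebesgue) + (\<integral>\<^sup>+x\<in>?J n. ?g x \<partial>lebesgue))" .
    qed
    also have "\<dots> = ennreal (C powr p) * ((\<integral>\<^sup>+n. (\<integral>\<^sup>+x\<in>?J n. ?f x \<partial>lebesgue) \<partial>count_space UNIV)
        + (\<integral>\<^sup>+n. (\<integral>\<^sup>+x\<in>?J n. ?g x \<partial>lebesgue) \<partial>count_space UNIV))"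
      by (simp add: nn_integral_cmult nn_integral_add)
    also have "\<dots> \<le> ennreal (C powr p) * (of_nat (r + 1) * (\<integral>\<^sup>+x\<in>?I. ?f x \<partial>lebesgue)
        + of_nat (r + 1) * (\<integral>\<^sup>+x\<in>?I. ?g x \<partial>lebesgue))"
      by (intro mult_left_mono add_mono nn_integral_overlap[OF lam r] fm gm) simp
    also have "\<dots> = of_nat (r + 1) * ennreal (C powr p) * W_pow r p ?I F"
      unfolding W_pow_def L_pow_def by (simp only: distrib_left mult_ac)
    finally show ?thesis .
  qed
  have "low_order_pow r p lam F \<le> (\<Sum>j<r. of_nat (r + 1) * ennreal (C powr p) * W_pow r p ?I F)"
    unfolding low_order_pow_def by (intro sum_mono term_le) simp
  also have "\<dots> = of_nat (r * (r + 1)) * ennreal (C powr p) * W_pow r p ?I F"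
    by (simp only: sum_constant card_lessThan of_nat_mult mult_ac)
  finally show ?thesis .
qed

text \<open>The half-open cells cover the interval, and on each the pointwise bound
  \<open>?R m / ennreal h\<close> integrates to \<open>?R m\<close>, the length of the cell
  cancelling. In the sum over \<open>m\<close>, index shifts turn the terms beginning at
  \<open>m - j\<close> into the full discrete sums and the blocks ending at \<open>m + 1\<close>
  into all blocks.\<close>

lemma nn_integral_powr_le:
  assumes F: "sobolev_regular r (node_interval lam) F" and r: "1 \<le> r" and p: "1 \<le> p"
    and lam: "admissible_nodes K lam" and K: "0 < K"
  defines "C \<equiv> real r + 2 * (real r * K) ^ r"
  shows "(\<integral>\<^sup>+x\<in>node_interval lam. ennreal (norm (F x) powr p) \<partial>lebesgue)
    \<le> of_nat (r + 1) * ennreal (C powr p) * (low_order_pow r p lam F + L_pow r p (node_interval lam) F)"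
proof -
  let ?I = "node_interval lam" and ?J = "\<lambda>n. {lam n..lam (n + int r)}" and ?P = "\<lambda>m. {lam m..<lam (m + 1)}"
  let ?f = "\<lambda>x. ennreal (norm (F x) powr p)" and ?g = "\<lambda>x. ennreal (norm (deriv_on ?I r F x) powr p)"
  let ?T = "\<lambda>j n. ennreal ((lam (n + int r) - lam n) powr (real j * p + 1) * norm (divdiff_seq lam F n j) powr p)"
  note op = open_node_interval[OF lam]
  have J: "?J n \<subseteq> ?I" for n by (rule Icc_subset_node_interval[OF lam])
  have lt: "lam n < lam (n + int r)" for n by (rule admissible_nodesD(2)[OF lam]) (use r in simp)
  have lt1: "lam n < lam (n + 1)" for n by (rule admissible_nodesD(2)[OF lam]) simp
  have gm: "(\<lambda>x. ?g x * indicator (?J n) x) \<in> borel_measurable lebesgue" for n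
    by (rule measurable_norm_powr_indicator[OF sobolev_top_deriv(1)[OF F op r less_imp_le[OF lt] J]]) simp
  have fm: "(\<lambda>x. ?f x * indicator (?P n) x) \<in> borel_measurable lebesgue" for n
  proof (rule measurable_norm_powr_indicator)
    have "continuous_on ?I F"
      using F r unfolding sobolev_regular_def by (metis deriv_on_0 less_le_trans zero_less_one)
    moreover have "?P n \<subseteq> ?I" using Icc_subset_node_interval[OF lam, of n "n + 1"] by auto
    ultimately have "continuous_on (?P n) F" by (rule continuous_on_subset)
    then show "F \<in> borel_measurable (lebesgue_on (?P n))"
      by (rule continuous_imp_measurable_on_sets_lebesgue) simp
  qed simp
  let ?R = "\<lambda>m. ennreal (C powr p) * ((\<Sum>j<r. ?T j (m - int j)) + (\<integral>\<^sup>+x\<in>?J (m - int r + 1). ?g x \<partial>lebesgue))"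
  have cell: "(\<integral>\<^sup>+x\<in>?P m. ?f x \<partial>lebesgue) \<le> ?R m" for m
  proof -
    define h where "h = lam (m + 1) - lam m"
    have h: "0 < h" using lt1[of m] by (simp add: h_def)
    have e: "m - int r + 1 + int r = m + 1" by simp
    have "(\<integral>\<^sup>+x\<in>?P m. ?f x \<partial>lebesgue) \<le> (\<integral>\<^sup>+x. (?R m / ennreal h) * indicator (?P m) x \<partial>lebesgue)"
    proof (rule nn_integral_mono)
      fix x
      show "?f x * indicator (?P m) x \<le> (?R m / ennreal h) * indicator (?P m) x"
      proof (cases "x \<in> ?P m")
        case True
        have "ennreal (h * norm (F x) powr p) \<le> ?R m"
          using sobolev_pointwise_bound[OF F op r p admissible_nodesD(1)[OF lam], where m = m and L = "real r * K" and x = x]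
            J[of "m - int r + 1"] admissible_nodesD(4)[OF lam, of "m - int r + 1" r] True
          unfolding C_def h_def e by simp
        then have "ennreal (h * norm (F x) powr p) / ennreal h \<le> ?R m / ennreal h"
          by (rule divide_right_mono_ennreal)
        also have "ennreal (h * norm (F x) powr p) / ennreal h = ?f x"
          using h by (simp add: divide_ennreal)
        finally show ?thesis using True by simp
      qed simp
    qed
    also have "\<dots> = (?R m / ennreal h) * emeasure lebesgue (?P m)"
      by (rule nn_integral_cmult_indicator) simp
    also have "emeasure lebesgue (?P m) = ennreal h" using lt1[of m] by (simp add: h_def)
    also have "(?R m / ennreal h) * ennreal h = ?R m"
    proof -
      have "ennreal h / ennreal h = 1" using h by (simp add: divide_ennreal)
      then show ?thesis unfolding ennreal_divide_times by (simp only: mult_1_right)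
    qed
    finally show ?thesis .
  qed
  have "(\<integral>\<^sup>+x\<in>?I. ?f x \<partial>lebesgue) \<le> (\<integral>\<^sup>+x. (\<integral>\<^sup>+m. ?f x * indicator (?P m) x \<partial>count_space UNIV) \<partial>lebesgue)"
  proof (rule nn_integral_mono)
    fix x
    show "?f x * indicator ?I x \<le> (\<integral>\<^sup>+m. ?f x * indicator (?P m) x \<partial>count_space UNIV)"
    proof (cases "x \<in> ?I")
      case True
      then obtain m where m: "lam m \<le> x" "x < lam (m + 1)" by (rule node_interval_cell[OF lam])
      then have "?f x * indicator ?I x = ?f x * indicator (?P m) x" using True by simp
      also have "\<dots> \<le> (\<integral>\<^sup>+m. ?f x * indicator (?P m) x \<partial>count_space UNIV)"
        by (rule nn_integral_ge_point) simp
      finally show ?thesis .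
    qed simp
  qed
  also have "\<dots> = (\<integral>\<^sup>+m. (\<integral>\<^sup>+x\<in>?P m. ?f x \<partial>lebesgue) \<partial>count_space UNIV)"
    by (rule nn_integral_count_space_nn_integral) (use fm in auto)
  also have "\<dots> \<le> (\<integral>\<^sup>+m. ?R m \<partial>count_space UNIV)"
    by (rule nn_integral_mono) (rule cell)
  also have "\<dots> = ennreal (C powr p) * ((\<Sum>j<r. (\<integral>\<^sup>+m. ?T j (m - int j) \<partial>count_space UNIV))
      + (\<integral>\<^sup>+m. (\<integral>\<^sup>+x\<in>?J (m - int r + 1). ?g x \<partial>lebesgue) \<partial>count_space UNIV))"
    by (simp add: nn_integral_cmult nn_integral_add nn_integral_sum del: sum_ennreal)
  also have "(\<Sum>j<r. (\<integral>\<^sup>+m. ?T j (m - int j) \<partial>count_space UNIV)) = low_order_pow r p lam F"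
    unfolding low_order_pow_def infsum_int_eq_nn_integral
  proof (rule sum.cong[OF refl])
    fix j
    show "(\<integral>\<^sup>+m. ?T j (m - int j) \<partial>count_space UNIV) = (\<integral>\<^sup>+m. ?T j m \<partial>count_space UNIV)"
      using nn_integral_int_shift[of "?T j" "- int j"] by simp
  qed
  also have "(\<integral>\<^sup>+m. (\<integral>\<^sup>+x\<in>?J (m - int r + 1). ?g x \<partial>lebesgue) \<partial>count_space UNIV)
      = (\<integral>\<^sup>+m. (\<integral>\<^sup>+x\<in>?J m. ?g x \<partial>lebesgue) \<partial>count_space UNIV)"
    using nn_integral_int_shift[of "\<lambda>m. \<integral>\<^sup>+x\<in>?J m. ?g x \<partial>lebesgue" "1 - int r"] by (simp add: algebra_simps)
  also have "\<dots> \<le> of_nat (r + 1) * L_pow r p ?I F"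
    unfolding L_pow_def by (rule nn_integral_overlap[OF lam r gm])
  finally have "(\<integral>\<^sup>+x\<in>?I. ?f x \<partial>lebesgue)
      \<le> ennreal (C powr p) * (low_order_pow r p lam F + of_nat (r + 1) * L_pow r p ?I F)"
    by (simp add: add_left_mono mult_left_mono)
  \<comment> \<open>The overlap factor is put on the discrete term as well, in order to have one
    common constant.\<close>
  also have "\<dots> \<le> ennreal (C powr p) * (of_nat (r + 1) * low_order_pow r p lam F + of_nat (r + 1) * L_pow r p ?I F)"
  proof (intro mult_left_mono add_right_mono)
    have "1 * low_order_pow r p lam F \<le> of_nat (r + 1) * low_order_pow r p lam F"
      by (intro mult_right_mono) auto
    then show "low_order_pow r p lam F \<le> of_nat (r + 1) * low_order_pow r p lam F" by simp
  qed simp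
  also have "\<dots> = of_nat (r + 1) * ennreal (C powr p) * (low_order_pow r p lam F + L_pow r p ?I F)"
    by (simp only: distrib_left mult_ac)
  finally show ?thesis .
qed

section \<open>Roots of extended nonnegative numbers\<close>

lemma ennroot_mono:
  assumes "0 < p" "x \<le> y"
  shows "ennroot p x \<le> ennroot p y"
proof (cases "y = \<infinity>")
  case False
  then have "x \<noteq> \<infinity>" using assms(2) by (auto simp: top_unique)
  moreover have "enn2real x \<le> enn2real y" using assms(2) False by (intro enn2real_mono) (auto simp: less_top)
  ultimately show ?thesis
    using False assms(1) by (auto simp: ennroot_def intro!: ennreal_leI powr_mono2)
qed (simp add: ennroot_def)

lemma ennroot_eq_top_iff: "ennroot p x = \<infinity> \<longleftrightarrow> x = \<infinity>"
  by (simp add: ennroot_def)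

lemma ennroot_cmult:
  assumes "0 < c" "0 < p"
  shows "ennroot p (ennreal (c powr p) * x) = ennreal c * ennroot p x"
proof (cases "x = \<infinity>")
  case True
  have "ennreal (c powr p) * \<infinity> = \<infinity>" "ennreal c * \<infinity> = \<infinity>"
    using assms by (simp_all add: ennreal_mult_eq_top_iff)
  then show ?thesis using True by (simp add: ennroot_def)
next
  case False
  then obtain t where t: "x = ennreal t" "0 \<le> t" by (cases x) auto
  have "ennroot p (ennreal (c powr p) * x) = ennroot p (ennreal (c powr p * t))"
    using t by (simp add: ennreal_mult)
  also have "\<dots> = ennreal ((c powr p * t) powr (1 / p))"
    using t by (simp add: ennroot_def)
  also have "(c powr p * t) powr (1 / p) = c * t powr (1 / p)"
    using t assms by (simp add: powr_mult powr_powr)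
  finally show ?thesis using t assms by (simp add: ennroot_def ennreal_mult)
qed

lemma ennroot_le_cmult:
  assumes "0 < c" "0 < p" "x \<le> ennreal (c powr p) * y"
  shows "ennroot p x \<le> ennreal c * ennroot p y"
  using ennroot_mono[OF assms(2,3)] by (simp only: ennroot_cmult[OF assms(1,2)])

text \<open>A sum is at most twice its larger summand, and \<open>2 \<le> 2 powr p\<close>. The
  resulting factor 2 serves for all \<open>p\<close> at once.\<close>

lemma ennroot_add_le:
  assumes "1 \<le> p"
  shows "ennroot p (x + y) \<le> 2 * (ennroot p x + ennroot p y)"
proof -
  have *: "ennroot p (x + y) \<le> 2 * ennroot p y" if "x \<le> y" for x y
  proof -
    have "(2::real) powr 1 \<le> 2 powr p" using assms by (intro powr_mono) auto
    then have "ennreal 2 \<le> ennreal (2 powr p)" by (intro ennreal_leI) simp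
    then have "2 * y \<le> ennreal (2 powr p) * y" by (intro mult_right_mono) auto
    moreover have "x + y \<le> 2 * y" using add_right_mono[OF that, of y] by (simp add: mult_2)
    ultimately have "ennroot p (x + y) \<le> ennroot p (ennreal (2 powr p) * y)"
      using assms by (intro ennroot_mono) auto
    also have "\<dots> = 2 * ennroot p y" using assms by (subst ennroot_cmult) auto
    finally show ?thesis .
  qed
  show ?thesis
  proof (cases "x \<le> y")
    case True
    from *[OF this] show ?thesis by (rule order_trans) (intro mult_left_mono; simp)
  next
    case False
    then have "ennroot p (y + x) \<le> 2 * ennroot p x" by (intro *) simp
    then have "ennroot p (x + y) \<le> 2 * ennroot p x" by (simp only: add.commute)
    then show ?thesis by (rule order_trans) (intro mult_left_mono; simp)
  qed
qed

lemma ennreal_le_inverse_mult: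
  assumes "0 < A" "ennreal A * x \<le> y"
  shows "x \<le> ennreal (1 / A) * y"
proof -
  have "x = ennreal (1 / A * A) * x" using assms(1) by simp
  also have "\<dots> = ennreal (1 / A) * (ennreal A * x)"
    using assms(1) by (subst ennreal_mult) (auto simp: mult.assoc)
  also have "\<dots> \<le> ennreal (1 / A) * y" using assms(2) by (intro mult_left_mono) auto
  finally show ?thesis .
qed

text \<open>The infimum need not be attained, so an index within \<open>\<epsilon> / c\<close> of it
  is used. If it is infinite, as for empty \<open>S\<close>, the right-hand side is infinite because
  \<open>c\<close> is positive.\<close>

lemma le_INF_cmult_add:
  fixes t e :: ennreal
  assumes c: "0 < c" and le: "\<And>i. i \<in> S \<Longrightarrow> t \<le> ennreal c * (e + l i)"
  shows "t \<le> ennreal c * (e + (INF i\<in>S. l i))"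
proof (cases "(INF i\<in>S. l i) = \<infinity>")
  case True
  then show ?thesis using c by (simp add: ennreal_mult_eq_top_iff)
next
  case False
  show ?thesis
  proof (rule ennreal_le_epsilon)
    fix \<epsilon> :: real assume \<epsilon>: "0 < \<epsilon>"
    have "(INF i\<in>S. l i) < (INF i\<in>S. l i) + ennreal (\<epsilon> / c)"
      using False \<epsilon> c by (simp add: less_top ennreal_add_left_cancel_less[of _ 0, simplified])
    then obtain i where i: "i \<in> S" "l i < (INF i\<in>S. l i) + ennreal (\<epsilon> / c)"
      unfolding INF_less_iff by blast
    have "t \<le> ennreal c * (e + l i)" by (rule le[OF i(1)])
    also have "\<dots> \<le> ennreal c * (e + ((INF i\<in>S. l i) + ennreal (\<epsilon> / c)))"
      using i(2) by (intro mult_left_mono add_left_mono) auto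
    also have "\<dots> = ennreal c * (e + (INF i\<in>S. l i)) + ennreal c * ennreal (\<epsilon> / c)"
      by (simp only: distrib_left add.assoc)
    also have "ennreal c * ennreal (\<epsilon> / c) = ennreal \<epsilon>"
      using c \<epsilon> by (subst ennreal_mult[symmetric]) auto
    finally show "t \<le> ennreal c * (e + (INF i\<in>S. l i)) + ennreal \<epsilon>" .
  qed
qed

text \<open>Since \<open>n \<le> n powr p\<close>, a counting factor can move inside the
  \<open>p\<close>-th power; after the root is taken, the constant is the same for all
  \<open>p\<close>.\<close>

lemma of_nat_mult_powr_le:
  assumes "1 \<le> p" "1 \<le> n" "0 \<le> C"
  shows "of_nat n * ennreal (C powr p) \<le> ennreal ((real n * C) powr p)"
proof -
  have "real n powr 1 \<le> real n powr p" using assms by (intro powr_mono) auto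
  then have "real n * C powr p \<le> (real n * C) powr p"
    using assms by (simp add: powr_mult mult_right_mono)
  then have "ennreal (real n * C powr p) \<le> ennreal ((real n * C) powr p)" by (rule ennreal_leI)
  then show ?thesis by (simp add: ennreal_mult ennreal_of_nat_eq_real_of_nat)
qed

section \<open>Comparison of the trace norms with the discrete norms\<close>

lemma divdiff_seq_restr: "divdiff_seq lam (restr (range lam) F) n j = divdiff_seq lam F n j"
  unfolding divdiff_seq_def by (rule divdiff_cong) (auto simp: restr_def)

lemma low_order_pow_restr: "low_order_pow r p lam (restr (range lam) F) = low_order_pow r p lam F"
  by (simp add: low_order_pow_def divdiff_seq_restr)

lemma eqW_pow_eq: "eqW_pow r p lam f = eqL_pow r p lam f + low_order_pow r p lam f"
  by (simp add: eqW_pow_def low_order_pow_def)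

lemma L_norm_le_W_norm:
  assumes "1 \<le> p"
  shows "L_norm r p I F \<le> W_norm r p I F"
  unfolding L_norm_def W_norm_def W_pow_def using assms by (intro ennroot_mono) auto

text \<open>The root of the integral of \<open>F\<close> is at most \<open>2 * c\<close> times the
  sum on the right, and the seminorm is one of its summands. A second use of
  \<open>ennroot_add_le\<close> gives \<open>2 * (2 * c + 1)\<close>.\<close>

lemma W_norm_le:
  assumes F: "sobolev_regular r (node_interval lam) F" and r: "1 \<le> r" and p: "1 \<le> p"
    and lam: "admissible_nodes K lam" and K: "0 < K"
  defines "c \<equiv> real (r + 1) * (real r + 2 * (real r * K) ^ r)"
  shows "W_norm r p (node_interval lam) F
    \<le> ennreal (4 * c + 2) * (ennroot p (low_order_pow r p lam F) + L_norm r p (node_interval lam) F)"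
proof -
  let ?I = "node_interval lam"
  let ?S = "ennroot p (low_order_pow r p lam F) + L_norm r p ?I F"
  have C: "0 < real r + 2 * (real r * K) ^ r" using r K by (intro add_pos_nonneg) auto
  have c: "0 < c" unfolding c_def using C by (intro mult_pos_pos) auto
  let ?F = "\<integral>\<^sup>+x\<in>?I. ennreal (norm (F x) powr p) \<partial>lebesgue"
  have "?F \<le> of_nat (r + 1) * ennreal ((real r + 2 * (real r * K) ^ r) powr p) * (low_order_pow r p lam F + L_pow r p ?I F)"
    by (rule nn_integral_powr_le[OF F r p lam K])
  also have "\<dots> \<le> ennreal (c powr p) * (low_order_pow r p lam F + L_pow r p ?I F)"
    unfolding c_def using C p by (intro mult_right_mono of_nat_mult_powr_le) auto
  finally have "ennroot p ?F \<le> ennreal c * ennroot p (low_order_pow r p lam F + L_pow r p ?I F)"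
    using p c by (intro ennroot_le_cmult) auto
  also have "\<dots> \<le> ennreal c * (2 * ?S)"
    unfolding L_norm_def by (intro mult_left_mono ennroot_add_le[OF p]) simp
  finally have F': "ennroot p ?F \<le> ennreal c * (2 * ?S)" .
  have "W_norm r p ?I F \<le> 2 * (ennroot p ?F + L_norm r p ?I F)"
    unfolding W_norm_def W_pow_def L_norm_def by (rule ennroot_add_le[OF p])
  also have "\<dots> \<le> 2 * (ennreal c * (2 * ?S) + ?S)"
    using F' by (intro mult_left_mono add_mono) auto
  also have "\<dots> = ennreal (4 * c + 2) * ?S"
  proof -
    have "ennreal (4 * c + 2) = 2 * (ennreal c * 2 + 1)"
      using c by (simp add: ennreal_plus ennreal_mult distrib_left) (simp add: mult.left_commute[of 2] mult.commute[of 4])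
    then show ?thesis by (simp only: distrib_right mult.assoc mult_1)
  qed
  finally show ?thesis .
qed

lemma ennroot_low_order_pow_le:
  assumes F: "sobolev_regular r (node_interval lam) F" and r: "1 \<le> r" and p: "1 \<le> p"
    and lam: "admissible_nodes K lam" and K: "0 < K"
  defines "c \<equiv> real (r * (r + 1)) * (real r * (2 * real r * fact r * (4 * real r) ^ r + 2 * (real r * K) ^ r))"
  shows "ennroot p (low_order_pow r p lam F) \<le> ennreal c * W_norm r p (node_interval lam) F"
proof -
  let ?I = "node_interval lam"
  let ?C = "real r * (2 * real r * fact r * (4 * real r) ^ r + 2 * (real r * K) ^ r)"
  have C: "0 < ?C" using r K by (intro mult_pos_pos add_pos_pos) auto
  have "0 < real (r * (r + 1))" using r by (simp only: of_nat_0_less_iff) simp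
  then have c: "0 < c" unfolding c_def using C by (rule mult_pos_pos)
  have "low_order_pow r p lam F \<le> of_nat (r * (r + 1)) * ennreal (?C powr p) * W_pow r p ?I F"
    by (rule low_order_pow_le[OF F r p lam K])
  also have "\<dots> \<le> ennreal (c powr p) * W_pow r p ?I F"
    unfolding c_def using C p r by (intro mult_right_mono of_nat_mult_powr_le) auto
  finally show ?thesis
    unfolding W_norm_def using p c by (intro ennroot_le_cmult) auto
qed

text \<open>This form shows when an extension from the larger space belongs to the smaller one:
  finiteness of its norm decides.\<close>

lemma W_space_iff:
  "F \<in> W_space r p I \<longleftrightarrow> F \<in> L_space r p I \<and> W_norm r p I F < \<infinity>"
proof -
  have "W_norm r p I F < \<infinity> \<longleftrightarrow> W_pow r p I F < \<infinity>"
    unfolding W_norm_def using ennroot_eq_top_iff[of p "W_pow r p I F"] by (simp add: less_top[symmetric])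
  moreover have "W_pow r p I F < \<infinity> \<Longrightarrow> L_pow r p I F < \<infinity>" by (simp add: W_pow_def)
  ultimately show ?thesis by (auto simp: W_space_def L_space_def)
qed

lemma trace_norm_le: "F \<in> X \<Longrightarrow> restr S F = f \<Longrightarrow> trace_norm N X S f \<le> N F"
  unfolding trace_norm_def by (rule INF_lower) simp

text \<open>An extension in the \<open>W\<close> space is also one in the \<open>L\<close> space,
  with no larger seminorm. The assumed lower bound therefore controls the terms of order
  \<open>r\<close> with the factor \<open>1 / A\<close>, while \<open>c\<close> takes care of the
  lower orders; the 2 comes from \<open>ennroot_add_le\<close>.\<close>

lemma eqW_norm_le_W_trace_norm:
  assumes r: "1 \<le> r" and p: "1 \<le> p" and lam: "admissible_nodes K lam" and K: "0 < K"
    and A: "0 < A" "ennreal A * eqL_norm r p lam f \<le> L_trace_norm r p lam f"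
  defines "c \<equiv> real (r * (r + 1)) * (real r * (2 * real r * fact r * (4 * real r) ^ r + 2 * (real r * K) ^ r))"
  shows "ennreal (1 / (2 * (1 / A + c))) * eqW_norm r p lam f \<le> W_trace_norm r p lam f"
  unfolding trace_norm_def[of "W_norm r p (node_interval lam)"]
proof (rule INF_greatest)
  let ?I = "node_interval lam"
  have c: "0 \<le> c" using K by (simp add: c_def)
  fix F assume "F \<in> {F \<in> W_space r p ?I. restr (range lam) F = f}"
  then have F: "F \<in> W_space r p ?I" "restr (range lam) F = f" by auto
  have "ennreal A * eqL_norm r p lam f \<le> L_norm r p ?I F"
    using A(2) trace_norm_le[of F "L_space r p ?I" "range lam" f "L_norm r p ?I"] F
    by (auto simp: W_space_iff intro: order_trans)
  also have "\<dots> \<le> W_norm r p ?I F" by (rule L_norm_le_W_norm[OF p])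
  finally have 1: "eqL_norm r p lam f \<le> ennreal (1 / A) * W_norm r p ?I F"
    by (rule ennreal_le_inverse_mult[OF A(1)])
  have "ennroot p (low_order_pow r p lam F) \<le> ennreal c * W_norm r p ?I F"
    unfolding c_def by (rule ennroot_low_order_pow_le[OF _ r p lam K]) (use F in \<open>simp add: W_space_def\<close>)
  then have 2: "ennroot p (low_order_pow r p lam f) \<le> ennreal c * W_norm r p ?I F"
    using low_order_pow_restr[of r p lam F] F(2) by simp
  have "eqW_norm r p lam f \<le> 2 * (eqL_norm r p lam f + ennroot p (low_order_pow r p lam f))"
    unfolding eqW_norm_def eqW_pow_eq eqL_norm_def by (rule ennroot_add_le[OF p])
  also have "\<dots> \<le> 2 * (ennreal (1 / A) * W_norm r p ?I F + ennreal c * W_norm r p ?I F)"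
    using 1 2 by (intro mult_left_mono add_mono) auto
  also have "\<dots> = ennreal (2 * (1 / A + c)) * W_norm r p ?I F"
  proof -
    have "ennreal (2 * (1 / A + c)) = 2 * (ennreal (1 / A) + ennreal c)"
      using A(1) c by (subst ennreal_mult) (auto simp: ennreal_plus)
    then show ?thesis by (simp only: distrib_right mult.assoc)
  qed
  finally have "eqW_norm r p lam f \<le> ennreal (2 * (1 / A + c)) * W_norm r p ?I F" .
  moreover define k where "k = 2 * (1 / A + c)"
  ultimately have le: "eqW_norm r p lam f \<le> ennreal k * W_norm r p ?I F" by simp
  have k: "0 < k" using A(1) c by (simp add: k_def add_pos_nonneg)
  have "ennreal (1 / k) * eqW_norm r p lam f \<le> ennreal (1 / k) * (ennreal k * W_norm r p ?I F)"
    using le by (intro mult_left_mono) auto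
  also have "\<dots> = ennreal (1 / k * k) * W_norm r p ?I F"
    using k by (subst ennreal_mult) (auto simp: mult.assoc)
  also have "\<dots> = W_norm r p ?I F" using k by simp
  finally show "ennreal (1 / (2 * (1 / A + c))) * eqW_norm r p lam f \<le> W_norm r p ?I F"
    by (simp only: k_def)
qed

text \<open>The two infima run over different spaces. If the discrete norm is finite,
  \<open>W_norm_le\<close> shows that every extension in the \<open>L\<close> space has finite
  \<open>W\<close> norm and so competes for the other infimum too. Hence the infimum over the
  \<open>L\<close> extensions may be taken on the right, where the assumed upper bound
  applies.\<close>

lemma W_trace_norm_le_eqW_norm:
  assumes r: "1 \<le> r" and p: "1 \<le> p" and lam: "admissible_nodes K lam" and K: "0 < K"
    and B: "0 < B" "L_trace_norm r p lam f \<le> ennreal B * eqL_norm r p lam f"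
  defines "c \<equiv> real (r + 1) * (real r + 2 * (real r * K) ^ r)"
  shows "W_trace_norm r p lam f \<le> ennreal ((4 * c + 2) * (1 + B)) * eqW_norm r p lam f"
proof (cases "eqW_norm r p lam f = \<infinity>")
  case True
  have "0 \<le> c" using K by (simp add: c_def)
  then have "0 < (4 * c + 2) * (1 + B)" using B(1) by (intro mult_pos_pos) auto
  moreover have "ennreal k * \<infinity> = \<infinity>" if "0 < k" for k
    using that by (simp add: ennreal_mult_eq_top_iff)
  ultimately show ?thesis unfolding True by (simp only:) simp
next
  case False
  let ?I = "node_interval lam"
  have c: "0 < 4 * c + 2" using K by (simp add: c_def add_nonneg_pos)
  have low: "ennroot p (low_order_pow r p lam f) \<le> eqW_norm r p lam f"
    "eqL_norm r p lam f \<le> eqW_norm r p lam f"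
    unfolding eqW_norm_def eqL_norm_def eqW_pow_eq using p by (auto intro!: ennroot_mono)
  have "W_trace_norm r p lam f \<le> ennreal (4 * c + 2) * (eqW_norm r p lam f + L_norm r p ?I F)"
    if F: "F \<in> L_space r p ?I" "restr (range lam) F = f" for F
  proof -
    have "W_norm r p ?I F \<le> ennreal (4 * c + 2) * (ennroot p (low_order_pow r p lam F) + L_norm r p ?I F)"
      unfolding c_def by (rule W_norm_le[OF _ r p lam K]) (use F in \<open>simp add: L_space_def\<close>)
    also have "\<dots> \<le> ennreal (4 * c + 2) * (eqW_norm r p lam f + L_norm r p ?I F)"
      using low(1) low_order_pow_restr[of r p lam F] F(2) by (intro mult_left_mono add_right_mono) auto
    finally have le: "W_norm r p ?I F \<le> ennreal (4 * c + 2) * (eqW_norm r p lam f + L_norm r p ?I F)" .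
    have "L_pow r p ?I F \<noteq> \<infinity>" using F(1) by (auto simp: L_space_def)
    then have "L_norm r p ?I F \<noteq> \<infinity>" unfolding L_norm_def ennroot_eq_top_iff .
    then have "ennreal (4 * c + 2) * (eqW_norm r p lam f + L_norm r p ?I F) < \<infinity>"
      using False by (simp add: ennreal_mult_less_top less_top)
    then have "F \<in> W_space r p ?I" using F(1) le by (simp add: W_space_iff)
    from trace_norm_le[OF this F(2)] show ?thesis using le by (rule order_trans)
  qed
  then have "W_trace_norm r p lam f \<le> ennreal (4 * c + 2) * (eqW_norm r p lam f + L_trace_norm r p lam f)"
    unfolding trace_norm_def[of "L_norm r p ?I"] by (intro le_INF_cmult_add[OF c]) simp
  also have "\<dots> \<le> ennreal (4 * c + 2) * (eqW_norm r p lam f + ennreal B * eqW_norm r p lam f)"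
    by (intro mult_left_mono add_left_mono order_trans[OF B(2)] low(2)) simp_all
  also have "\<dots> = ennreal ((4 * c + 2) * (1 + B)) * eqW_norm r p lam f"
  proof -
    have "ennreal ((4 * c + 2) * (1 + B)) = ennreal (4 * c + 2) * (1 + ennreal B)"
      using c B(1) by (subst ennreal_mult) (auto simp: ennreal_plus)
    then show ?thesis by (simp only: distrib_right mult.assoc mult_1)
  qed
  finally show ?thesis .
qed

text \<open>\<open>T f\<close> and any \<open>W\<close> extension \<open>F\<close> of
  \<open>f\<close> agree at the nodes, hence have the same low-order sum, which the \<open>W\<close>
  norm of \<open>F\<close> bounds. The seminorm of \<open>T f\<close> is bounded by quasi-optimality
  for \<open>L\<close>, and \<open>W_norm_le\<close> combines the two.\<close>

lemma quasi_optimal_interpolator_L_imp_W: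
  assumes r: "1 \<le> r" and p: "1 \<le> p" and lam: "admissible_nodes K lam" and K: "0 < K"
    and T: "quasi_optimal_interpolator (L_norm r p (node_interval lam))
              (L_space r p (node_interval lam)) (range lam) T"
  shows "quasi_optimal_interpolator (W_norm r p (node_interval lam))
              (W_space r p (node_interval lam)) (range lam) T"
proof -
  let ?I = "node_interval lam"
  note sub = subsetD[OF W_trace_subset_L_trace]
  obtain M where TL: "\<And>f. f \<in> L_trace r p lam \<Longrightarrow> T f \<in> L_space r p ?I"
    and M: "\<And>f. f \<in> L_trace r p lam \<Longrightarrow> L_norm r p ?I (T f) \<le> ennreal M * L_trace_norm r p lam f"
    and TR: "\<And>f. f \<in> L_trace r p lam \<Longrightarrow> restr (range lam) (T f) = f"
    using T unfolding quasi_optimal_interpolator_def by blast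
  define c1 where "c1 = 4 * (real (r + 1) * (real r + 2 * (real r * K) ^ r)) + 2"
  define c2 where "c2 = real (r * (r + 1)) * (real r * (2 * real r * fact r * (4 * real r) ^ r + 2 * (real r * K) ^ r))"
  \<comment> \<open>\<open>M\<close> may be negative, in which case \<open>ennreal M\<close> is 0;
    with \<open>max 0 M\<close> the constants can be added as reals.\<close>
  define k where "k = c1 * (c2 + max 0 M)"
  have c12: "0 \<le> c1" "0 \<le> c2" using K by (auto simp: c1_def c2_def)
  have bound: "W_norm r p ?I (T f) \<le> ennreal k * W_norm r p ?I F"
    if F: "F \<in> W_space r p ?I" "restr (range lam) F = f" for f F
  proof -
    have f: "f \<in> L_trace r p lam" using F by (auto simp: trace_space_def W_space_iff)
    have reg: "sobolev_regular r ?I F" "sobolev_regular r ?I (T f)"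
      using F(1) TL[OF f] by (auto simp: W_space_def L_space_def)
    have "low_order_pow r p lam (T f) = low_order_pow r p lam F"
      using low_order_pow_restr[of r p lam "T f"] low_order_pow_restr[of r p lam F] TR[OF f] F(2) by simp
    then have 1: "ennroot p (low_order_pow r p lam (T f)) \<le> ennreal c2 * W_norm r p ?I F"
      using ennroot_low_order_pow_le[OF reg(1) r p lam K] by (simp only: c2_def)
    have "L_norm r p ?I (T f) \<le> ennreal M * L_trace_norm r p lam f" by (rule M[OF f])
    also have "\<dots> \<le> ennreal (max 0 M) * W_norm r p ?I F"
    proof (intro mult_mono)
      have "L_trace_norm r p lam f \<le> L_norm r p ?I F"
        by (rule trace_norm_le) (use F in \<open>auto simp: W_space_iff\<close>)
      also have "\<dots> \<le> W_norm r p ?I F" by (rule L_norm_le_W_norm[OF p])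
      finally show "L_trace_norm r p lam f \<le> W_norm r p ?I F" .
    qed (auto intro: ennreal_leI)
    finally have 2: "L_norm r p ?I (T f) \<le> ennreal (max 0 M) * W_norm r p ?I F" .
    have "W_norm r p ?I (T f) \<le> ennreal c1 * (ennroot p (low_order_pow r p lam (T f)) + L_norm r p ?I (T f))"
      unfolding c1_def by (rule W_norm_le[OF reg(2) r p lam K])
    also have "\<dots> \<le> ennreal c1 * (ennreal c2 * W_norm r p ?I F + ennreal (max 0 M) * W_norm r p ?I F)"
      using 1 2 by (intro mult_left_mono add_mono) auto
    also have "\<dots> = ennreal k * W_norm r p ?I F"
    proof -
      have "ennreal k = ennreal c1 * (ennreal c2 + ennreal (max 0 M))"
        unfolding k_def using c12 by (subst ennreal_mult) (auto simp: ennreal_plus)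
      then show ?thesis by (simp only: distrib_right mult.assoc)
    qed
    finally show ?thesis .
  qed
  show ?thesis
    unfolding quasi_optimal_interpolator_def
  proof (intro conjI ballI allI)
    fix f assume f: "f \<in> W_trace r p lam"
    then obtain F where F: "F \<in> W_space r p ?I" "restr (range lam) F = f"
      by (auto simp: trace_space_def)
    have "ennreal k * W_norm r p ?I F < \<infinity>"
      using F(1) by (simp add: W_space_iff ennreal_mult_less_top)
    then show "T f \<in> W_space r p ?I"
      using bound[OF F] TL[OF sub[OF f]] by (simp add: W_space_iff)
    show "restr (range lam) (T f) = f" by (rule TR[OF sub[OF f]])
  next
    have "W_norm r p ?I (T f) \<le> ennreal (max 1 k) * W_trace_norm r p lam f" if f: "f \<in> W_trace r p lam" for f
    proof -
      \<comment> \<open>The lemma on infima is used with \<open>e = 0\<close>. It asks for a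
        positive constant, hence \<open>max 1 k\<close>.\<close>
      have "W_norm r p ?I (T f) \<le> ennreal (max 1 k) * (0 + (INF F\<in>{F \<in> W_space r p ?I. restr (range lam) F = f}. W_norm r p ?I F))"
      proof (rule le_INF_cmult_add)
        fix F assume F: "F \<in> {F \<in> W_space r p ?I. restr (range lam) F = f}"
        then have "W_norm r p ?I (T f) \<le> ennreal k * W_norm r p ?I F" by (intro bound) auto
        also have "\<dots> \<le> ennreal (max 1 k) * W_norm r p ?I F"
          by (intro mult_right_mono ennreal_leI) auto
        finally show "W_norm r p ?I (T f) \<le> ennreal (max 1 k) * (0 + W_norm r p ?I F)" by simp
      qed simp
      then show ?thesis by (simp add: trace_norm_def)
    qed
    then show "\<exists>M::real. \<forall>f\<in>W_trace r p lam. W_norm r p ?I (T f) \<le> ennreal M * W_trace_norm r p lam f"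
      by blast
  next
    fix f g assume "f \<in> W_trace r p lam" "g \<in> W_trace r p lam"
    then show "T (\<lambda>x. f x + g x) = (\<lambda>x. T f x + T g x)"
      using T sub unfolding quasi_optimal_interpolator_def by blast
  next
    fix c f assume "f \<in> W_trace r p lam"
    then show "T (\<lambda>x. c * f x) = (\<lambda>x. c * T f x)"
      using T sub unfolding quasi_optimal_interpolator_def by blast
  qed
qed

theorem theorem2:
  fixes r :: nat and K :: real
  assumes "1 \<le> r" and "0 < K"
  shows "(\<forall>A>0. \<forall>B>0. \<exists>C>0. \<exists>C'>0. \<forall>(p::real) lam.
            1 \<le> p \<longrightarrow> admissible_nodes K lam \<longrightarrow>
            (\<forall>f\<in>L_trace r p lam.
               ennreal A * eqL_norm r p lam f \<le> L_trace_norm r p lam f \<and>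
               L_trace_norm r p lam f \<le> ennreal B * eqL_norm r p lam f) \<longrightarrow>
            (\<forall>f\<in>W_trace r p lam.
               ennreal C * eqW_norm r p lam f \<le> W_trace_norm r p lam f \<and>
               W_trace_norm r p lam f \<le> ennreal C' * eqW_norm r p lam f))
       \<and> (\<forall>(p::real) lam T.
            1 \<le> p \<longrightarrow> admissible_nodes K lam \<longrightarrow>
            quasi_optimal_interpolator (L_norm r p (node_interval lam))
              (L_space r p (node_interval lam)) (range lam) T \<longrightarrow>
            quasi_optimal_interpolator (W_norm r p (node_interval lam))
              (W_space r p (node_interval lam)) (range lam) T)"
proof (intro conjI allI impI)
  define c2 where "c2 = real (r * (r + 1)) * (real r * (2 * real r * fact r * (4 * real r) ^ r + 2 * (real r * K) ^ r))"
  define c1 where "c1 = real (r + 1) * (real r + 2 * (real r * K) ^ r)"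
  have c12: "0 \<le> c2" "0 \<le> c1" using assms by (auto simp: c1_def c2_def)
  fix A B :: real assume AB: "0 < A" "0 < B"
  \<comment> \<open>Both constants are built from \<open>r\<close>, \<open>K\<close>,
    \<open>A\<close> and \<open>B\<close> and are fixed before \<open>p\<close> and
    \<open>lam\<close> are introduced.\<close>
  let ?C = "1 / (2 * (1 / A + c2))" and ?C' = "(4 * c1 + 2) * (1 + B)"
  have "0 < 1 / A + c2" using AB(1) c12(1) by (intro add_pos_nonneg) auto
  then have pos: "0 < ?C" "0 < ?C'" using AB(2) c12(2) by (auto intro!: mult_pos_pos)
  show "\<exists>C>0. \<exists>C'>0. \<forall>(p::real) lam.
            1 \<le> p \<longrightarrow> admissible_nodes K lam \<longrightarrow>
            (\<forall>f\<in>L_trace r p lam.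
               ennreal A * eqL_norm r p lam f \<le> L_trace_norm r p lam f \<and>
               L_trace_norm r p lam f \<le> ennreal B * eqL_norm r p lam f) \<longrightarrow>
            (\<forall>f\<in>W_trace r p lam.
               ennreal C * eqW_norm r p lam f \<le> W_trace_norm r p lam f \<and>
               W_trace_norm r p lam f \<le> ennreal C' * eqW_norm r p lam f)"
  proof (rule exI[of _ ?C], rule conjI[OF pos(1)], rule exI[of _ ?C'], rule conjI[OF pos(2)], intro allI impI ballI)
    fix p :: real and lam f
    assume p: "1 \<le> p" and lam: "admissible_nodes K lam" and f: "f \<in> W_trace r p lam"
      and hyp: "\<forall>f\<in>L_trace r p lam.
               ennreal A * eqL_norm r p lam f \<le> L_trace_norm r p lam f \<and>
               L_trace_norm r p lam f \<le> ennreal B * eqL_norm r p lam f"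
    have fL: "ennreal A * eqL_norm r p lam f \<le> L_trace_norm r p lam f"
      "L_trace_norm r p lam f \<le> ennreal B * eqL_norm r p lam f"
      using hyp subsetD[OF W_trace_subset_L_trace f] by blast+
    show "ennreal ?C * eqW_norm r p lam f \<le> W_trace_norm r p lam f \<and>
        W_trace_norm r p lam f \<le> ennreal ?C' * eqW_norm r p lam f"
      unfolding c1_def c2_def
      using eqW_norm_le_W_trace_norm[OF assms(1) p lam assms(2) AB(1) fL(1)]
        W_trace_norm_le_eqW_norm[OF assms(1) p lam assms(2) AB(2) fL(2)] by (rule conjI)
  qed
next
  fix p :: real and lam T
  assume "1 \<le> p" "admissible_nodes K lam"
    "quasi_optimal_interpolator (L_norm r p (node_interval lam)) (L_space r p (node_interval lam)) (range lam) T"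
  then show "quasi_optimal_interpolator (W_norm r p (node_interval lam)) (W_space r p (node_interval lam)) (range lam) T"
    using quasi_optimal_interpolator_L_imp_W[OF assms(1) _ _ assms(2)] by blast
qed

end
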